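(* Let $(S^{(1)},\ldots,S^{(k)},\sigma)$ and $(T^{(1)},\ldots,T^{(k)},\tau)$ be finitely correlated, fully coisometric representations of a product system $E$ of $C^*$-correspondences over $\mathbb{N}^k$ (with coefficient algebra $\mathcal{A}$) on Hilbert spaces $\mathcal{H}_S$ and $\mathcal{H}_T$ respectively. Let $\mathcal{V}_S$ be the unique minimal cyclic coinvariant subspace for $(S^{(1)},\ldots,S^{(k)},\sigma)$ and let $\mathcal{V}_T$ be the unique minimal cyclic coinvariant subspace for $(T^{(1)},\ldots,T^{(k)},\tau)$. Then $(S^{(1)},\ldots,S^{(k)},\sigma)$ and $(T^{(1)},\ldots,T^{(k)},\tau)$ are unitarily equivalent if and only if the finite dimensional representations $(P_{\mathcal{V}_S}S^{(1)}(\cdot)|_{\mathcal{V}_S},\ldots,P_{\mathcal{V}_S}S^{(k)}(\cdot)|_{\mathcal{V}_S},\sigma(\cdot)|_{\mathcal{V}_S})$ and $(P_{\mathcal{V}_T}T^{(1)}(\cdot)|_{\mathcal{V}_T},\ldots,P_{\mathcal{V}_T}T^{(k)}(\cdot)|_{\mathcal{V}_T},\tau(\cdot)|_{\mathcal{V}_T})$ are unitarily equivalent.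
   Context: Conventions. All $C^*$-algebras and their representations on Hilbert spaces are unital; subspaces are closed; $\mathbb N=\{0,1,2,\dots\}$. A $C^*$-correspondence over $\mathcal A$ is a right Hilbert $C^*$-module over $\mathcal A$ with a left action of $\mathcal A$ by adjointable operators given by a $*$-homomorphism; tensor products are interior tensor products. A representation $(A,\sigma)$ of a $C^*$-correspondence $F$ over $\mathcal A$ on $\mathcal V$ is a completely contractive linear map $A:F\to\mathcal B(\mathcal V)$ and a unital representation $\sigma$ of $\mathcal A$ on $\mathcal V$ with $A(a\xi b)=\sigma(a)A(\xi)\sigma(b)$. $F\otimes_\sigma\mathcal V$ is the Hausdorff completion of the algebraic tensor product for $\langle\xi_1\otimes h_1,\xi_2\otimes h_2\rangle=\langle h_1,\sigma(\langle\xi_1,\xi_2\rangle)h_2\rangle$, and $\tilde A(\xi\otimes h)=A(\xi)h$ is a contraction $F\otimes_\sigma\mathcal V\to\mathcal V$. $(A,\sigma)$ is isometric if $A(\xi)^*A(\eta)=\sigma(\langle\xi,\eta\rangle)$ for all $\xi,\eta$, fully coisometric if $\tilde A\tilde A^*=I$. $\tilde A_m:F^m\otimes_\sigma\mathcal V\to\mathcal V$ is $\tilde A_m(\xi_1\otimes\cdots\otimes\xi_m\otimes h)=A(\xi_1)\cdots A(\xi_m)h$ ($F^m$ the $m$-fold tensor power, $F^0=\mathcal A$). A representation $(S,\rho)$ of $F$ on $\mathcal H\supseteq\mathcal V$ dilates $(A,\sigma)$ if $\mathcal V$ reduces $\rho$ with $\rho(a)|_{\mathcal V}=\sigma(a)$,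 $\mathcal V^\perp$ is invariant under all $S(\xi)$, and $P_{\mathcal V}S(\xi)|_{\mathcal V}=A(\xi)$. Product systems. A product system of $C^*$-correspondences over $\mathbb N^k$ (with coefficient algebra $\mathcal A$) is a semigroup $E$ with a semigroup homomorphism $p:E\to\mathbb N^k$ such that each $E(\mathbf n)=p^{-1}(\mathbf n)$ is a $C^*$-correspondence over $\mathcal A$, $E(\mathbf 0)=\mathcal A$, and multiplication $E(\mathbf n)\times E(\mathbf m)\to E(\mathbf n+\mathbf m)$ extends to an isomorphism $E(\mathbf n)\otimes E(\mathbf m)\cong E(\mathbf n+\mathbf m)$. With $\mathbf e_1,\dots,\mathbf e_k$ the standard generators, $E_i=E(\mathbf e_i)$; the isomorphisms $E_i\otimes E_j\cong E(\mathbf e_i+\mathbf e_j)\cong E_j\otimes E_i$ give isomorphisms $t_{i,j}:E_i\otimes E_j\to E_j\otimes E_i$ ($t_{i,i}$ is the identity). $E(\mathbf n)$ is identified with $E_1^{n_1}\otimes\cdots\otimes E_k^{n_k}$. A representation $(A^{(1)},\dots,A^{(k)},\sigma)$ of $E$ on $\mathcal V$ consists of representations $(A^{(i)},\sigma)$ of $E_i$ on $\mathcal V$ with $\tilde A^{(i)}(I_{E_i}\otimes\tilde A^{(j)})=\tilde A^{(j)}(I_{E_j}\otimes\tilde A^{(i)})(t_{i,j}\otimes I_{\mathcal V})$ for all $i,j$. It is isometric (fully coisometric) if each $(A^{(i)},\sigma)$ is. For $\mathbf n\in\mathbb N^k$, $\tilde A_{\mathbf n}=\tilde A^{(1)}_{n_1}(I_{E_1^{n_1}}\otimes\tilde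 A^{(2)}_{n_2})\cdots(I_{E_1^{n_1}}\otimes\cdots\otimes I_{E_{k-1}^{n_{k-1}}}\otimes\tilde A^{(k)}_{n_k}):E(\mathbf n)\otimes_\sigma\mathcal V\to\mathcal V$. Unitary equivalence of representations means a single unitary intertwines all the maps and the representations of $\mathcal A$. A representation $(S^{(1)},\dots,S^{(k)},\rho)$ of $E$ on $\mathcal H\supseteq\mathcal V$ dilates $(A^{(1)},\dots,A^{(k)},\sigma)$ if each $(S^{(i)},\rho)$ dilates $(A^{(i)},\sigma)$; it is an isometric dilation if it is an isometric representation, and minimal if $\mathcal H=\bigvee_{\mathbf n\in\mathbb N^k}\tilde S_{\mathbf n}(E(\mathbf n)\otimes\mathcal V)$. Fully coisometric representations of $E$ have a minimal isometric dilation, unique up to unitary equivalence. An isometric representation of $E$ is finitely correlated if it is the minimal isometric dilation of a representation on a non-zero finite dimensional subspace. The unital WOT-closed algebra $\mathfrak S$ generated by $(S^{(1)},\dots,S^{(k)},\rho)$ is the WOT-closure of the algebra generated by $I$, all $S^{(i)}(\xi_i)$ ($\xi_i\in E_i$) and all $\rho(a)$. A minimal cyclic coinvariant subspace for the representation is an $\mathfrak S^*$-invariant subspace which is cyclic for $\mathfrak S$ (i.e. the closed span of its image under $\mathfrak S$ is $\mathcal H$) and has no proper $\mathfrak S^*$-invariant subspace which is cyclic for $\mathfrak S$. (For a finitely correlated, fully coisometric representation it exists, is unique, and is finite dimensional.) *)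

theory Defs
  imports "HOL-Analysis.Analysis"
begin

section \<open>Hilbert spaces and unital C*-algebras\<close>

class complex_vector = real_vector +
  fixes scaleC :: "complex \<Rightarrow> 'a \<Rightarrow> 'a" (infixr "*\<^sub>C" 75)
  assumes scaleC_add_right: "c *\<^sub>C (x + y) = c *\<^sub>C x + c *\<^sub>C y"
    and scaleC_add_left: "(c + d) *\<^sub>C x = c *\<^sub>C x + d *\<^sub>C x"
    and scaleC_scaleC: "c *\<^sub>C d *\<^sub>C x = (c * d) *\<^sub>C x"
    and scaleC_one: "1 *\<^sub>C x = x"
    and scaleR_scaleC: "scaleR r x = complex_of_real r *\<^sub>C x"

text \<open>Inner products are linear in the second argument, as is customary for Hilbert C*-modules.\<close>

class complex_hilbert = complex_vector + banach +
  fixes cinner :: "'a \<Rightarrow> 'a \<Rightarrow> complex"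
  assumes cinner_commute: "cinner x y = cnj (cinner y x)"
    and cinner_add_right: "cinner x (y + z) = cinner x y + cinner x z"
    and cinner_scaleC_right: "cinner x (c *\<^sub>C y) = c * cinner x y"
    and cinner_same: "cinner x x = complex_of_real ((norm x)\<^sup>2)"

text \<open>The superclass \<open>real_normed_algebra_1\<close> excludes the zero algebra, which has no unital
  representation on a non-zero Hilbert space.\<close>

class cstar_algebra = complex_vector + banach + real_normed_algebra_1 +
  fixes star :: "'a \<Rightarrow> 'a"
  assumes scaleC_mult_left: "(c *\<^sub>C x) * y = c *\<^sub>C (x * y)"
    and scaleC_mult_right: "x * (c *\<^sub>C y) = c *\<^sub>C (x * y)"
    and norm_scaleC: "norm (c *\<^sub>C x) = cmod c * norm x"
    and star_star: "star (star x) = x"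
    and star_add: "star (x + y) = star x + star y"
    and star_scaleC: "star (c *\<^sub>C x) = cnj c *\<^sub>C star x"
    and star_mult: "star (x * y) = star y * star x"
    and cstar_identity: "norm (star x * x) = (norm x)\<^sup>2"

instantiation complex :: cstar_algebra
begin

definition scaleC_complex :: "complex \<Rightarrow> complex \<Rightarrow> complex"
  where "scaleC_complex c x = c * x"

definition star_complex :: "complex \<Rightarrow> complex"
  where "star_complex x = cnj x"

instance
  by standard
    (auto simp: scaleC_complex_def star_complex_def algebra_simps norm_mult power2_eq_square
      scaleR_conv_of_real)

end

definition positive :: "'b::cstar_algebra \<Rightarrow> bool"
  where "positive b \<longleftrightarrow> (\<exists>c. b = star c * c)"

definition csubspace :: "'h::complex_vector set \<Rightarrow> bool"
  where "csubspace V \<longleftrightarrow> 0 \<in> V \<and> (\<forall>x\<in>V. \<forall>y\<in>V. x + y \<in> V) \<and> (\<forall>c. \<forall>x\<in>V. c *\<^sub>C x \<in> V)"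

definition closed_csubspace :: "'h::complex_hilbert set \<Rightarrow> bool"
  where "closed_csubspace V \<longleftrightarrow> csubspace V \<and> closed V"

definition finite_dimensional :: "'h::complex_vector set \<Rightarrow> bool"
  where "finite_dimensional V \<longleftrightarrow> (\<exists>B. finite B \<and> V \<subseteq> csubspace hull B)"

definition closed_span :: "'h::complex_hilbert set \<Rightarrow> 'h set"
  where "closed_span X = closed_csubspace hull X"

definition orth_compl :: "'h::complex_hilbert set \<Rightarrow> 'h set"
  where "orth_compl V = {x. \<forall>v\<in>V. cinner v x = 0}"

definition proj :: "'h::complex_hilbert set \<Rightarrow> 'h \<Rightarrow> 'h"
  where "proj V x = (THE y. y \<in> V \<and> x - y \<in> orth_compl V)"

definition bounded_op :: "'h::complex_hilbert set \<Rightarrow> ('h \<Rightarrow> 'h) \<Rightarrow> bool"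
  where "bounded_op V T \<longleftrightarrow>
    (\<forall>x\<in>V. T x \<in> V) \<and>
    (\<forall>x\<in>V. \<forall>y\<in>V. T (x + y) = T x + T y) \<and>
    (\<forall>c. \<forall>x\<in>V. T (c *\<^sub>C x) = c *\<^sub>C T x) \<and>
    (\<exists>K. \<forall>x\<in>V. norm (T x) \<le> K * norm x)"


section \<open>C*-correspondences\<close>

text \<open>A right Hilbert module over \<open>'b\<close> with a left action of \<open>'a\<close>. For \<open>'b = complex\<close> this is a
  Hilbert space carrying a representation of \<open>'a\<close>, so that the interior tensor products of two
  correspondences over \<open>\<A>\<close> and of a correspondence with a represented Hilbert space are
  instances of one construction. Since all algebras are unital, multiplication by a complex scalar
  \<open>c\<close> is the right action of \<open>c *\<^sub>C 1\<close>.\<close>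

record ('a, 'b, 'x) corr =
  carrier :: "'x set"
  mzero :: "'x"
  madd :: "'x \<Rightarrow> 'x \<Rightarrow> 'x"
  ract :: "'x \<Rightarrow> 'b \<Rightarrow> 'x"
  ip :: "'x \<Rightarrow> 'x \<Rightarrow> 'b"
  lact :: "'a \<Rightarrow> 'x \<Rightarrow> 'x"

definition mnorm :: "('a, 'b::cstar_algebra, 'x) corr \<Rightarrow> 'x \<Rightarrow> real"
  where "mnorm M x = sqrt (norm (ip M x x))"

definition mdist :: "('a, 'b::cstar_algebra, 'x) corr \<Rightarrow> 'x \<Rightarrow> 'x \<Rightarrow> real"
  where "mdist M x y = mnorm M (madd M x (ract M y (- 1)))"

definition msum :: "('a, 'b, 'x) corr \<Rightarrow> 'x list \<Rightarrow> 'x"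
  where "msum M xs = foldr (madd M) xs (mzero M)"

definition hilbert_module :: "('a, 'b::cstar_algebra, 'x) corr \<Rightarrow> bool"
  where "hilbert_module M \<longleftrightarrow>
    mzero M \<in> carrier M \<and>
    (\<forall>x\<in>carrier M. \<forall>y\<in>carrier M. madd M x y \<in> carrier M) \<and>
    (\<forall>x\<in>carrier M. \<forall>y\<in>carrier M. \<forall>z\<in>carrier M.
       madd M (madd M x y) z = madd M x (madd M y z)) \<and>
    (\<forall>x\<in>carrier M. \<forall>y\<in>carrier M. madd M x y = madd M y x) \<and>
    (\<forall>x\<in>carrier M. madd M x (mzero M) = x) \<and>
    (\<forall>x\<in>carrier M. \<exists>y\<in>carrier M. madd M x y = mzero M) \<and>
    (\<forall>x\<in>carrier M. \<forall>b. ract M x b \<in> carrier M) \<and>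
    (\<forall>x\<in>carrier M. \<forall>y\<in>carrier M. \<forall>b. ract M (madd M x y) b = madd M (ract M x b) (ract M y b)) \<and>
    (\<forall>x\<in>carrier M. \<forall>b c. ract M x (b + c) = madd M (ract M x b) (ract M x c)) \<and>
    (\<forall>x\<in>carrier M. \<forall>b c. ract M x (b * c) = ract M (ract M x b) c) \<and>
    (\<forall>x\<in>carrier M. ract M x 1 = x) \<and>
    (\<forall>x\<in>carrier M. \<forall>y\<in>carrier M. \<forall>z\<in>carrier M. ip M x (madd M y z) = ip M x y + ip M x z) \<and>
    (\<forall>x\<in>carrier M. \<forall>y\<in>carrier M. \<forall>b. ip M x (ract M y b) = ip M x y * b) \<and>
    (\<forall>x\<in>carrier M. \<forall>y\<in>carrier M. star (ip M x y) = ip M y x) \<and>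
    (\<forall>x\<in>carrier M. positive (ip M x x)) \<and>
    (\<forall>x\<in>carrier M. ip M x x = 0 \<longrightarrow> x = mzero M) \<and>
    (\<forall>X. (\<forall>n. X n \<in> carrier M) \<and>
         (\<forall>e>0. \<exists>N. \<forall>m\<ge>N. \<forall>n\<ge>N. mdist M (X m) (X n) < e) \<longrightarrow>
         (\<exists>x\<in>carrier M. (\<lambda>n. mdist M (X n) x) \<longlonglongrightarrow> 0))"

text \<open>The condition \<open>\<langle>a x, y\<rangle> = \<langle>x, a\<^sup>* y\<rangle>\<close> says that \<open>a\<close> acts by an adjointable operator (hence a
  bounded module map) whose adjoint is the action of \<open>a\<^sup>*\<close>.\<close>

definition cstar_correspondence :: "('a::cstar_algebra, 'b::cstar_algebra, 'x) corr \<Rightarrow> bool"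
  where "cstar_correspondence M \<longleftrightarrow>
    hilbert_module M \<and>
    (\<forall>a. \<forall>x\<in>carrier M. lact M a x \<in> carrier M) \<and>
    (\<forall>a. \<forall>x\<in>carrier M. \<forall>y\<in>carrier M. ip M (lact M a x) y = ip M x (lact M (star a) y)) \<and>
    (\<forall>a b. \<forall>x\<in>carrier M. lact M (a + b) x = madd M (lact M a x) (lact M b x)) \<and>
    (\<forall>a b. \<forall>x\<in>carrier M. lact M (a * b) x = lact M a (lact M b x)) \<and>
    (\<forall>c a. \<forall>x\<in>carrier M. lact M (c *\<^sub>C a) x = ract M (lact M a x) (c *\<^sub>C 1))"

definition corr_iso ::
    "('a, 'b, 'x) corr \<Rightarrow> ('a, 'b, 'y) corr \<Rightarrow> ('x \<Rightarrow> 'y) \<Rightarrow> bool"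
  where "corr_iso M N f \<longleftrightarrow>
    bij_betw f (carrier M) (carrier N) \<and>
    (\<forall>x\<in>carrier M. \<forall>y\<in>carrier M. f (madd M x y) = madd N (f x) (f y)) \<and>
    (\<forall>x\<in>carrier M. \<forall>b. f (ract M x b) = ract N (f x) b) \<and>
    (\<forall>a. \<forall>x\<in>carrier M. f (lact M a x) = lact N a (f x)) \<and>
    (\<forall>x\<in>carrier M. \<forall>y\<in>carrier M. ip N (f x) (f y) = ip M x y)"

definition madjoint ::
    "('a, 'b, 'x) corr \<Rightarrow> ('c, 'b, 'y) corr \<Rightarrow> ('x \<Rightarrow> 'y) \<Rightarrow> 'y \<Rightarrow> 'x"
  where "madjoint M N f y = (THE x. x \<in> carrier M \<and> (\<forall>z\<in>carrier M. ip M z x = ip N (f z) y))"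

definition algebra_corr :: "('a::cstar_algebra, 'a, 'a) corr"
  where "algebra_corr = \<lparr>carrier = UNIV, mzero = 0, madd = (+), ract = (*),
    ip = (\<lambda>x y. star x * y), lact = (*)\<rparr>"

definition hilbert_corr ::
    "'h::complex_hilbert set \<Rightarrow> ('a \<Rightarrow> 'h \<Rightarrow> 'h) \<Rightarrow> ('a, complex, 'h) corr"
  where "hilbert_corr V \<sigma> = \<lparr>carrier = V, mzero = 0, madd = (+), ract = (\<lambda>x c. c *\<^sub>C x),
    ip = cinner, lact = \<sigma>\<rparr>"


section \<open>Interior tensor products\<close>

text \<open>A list \<open>[(x\<^sub>1, y\<^sub>1), \<dots>, (x\<^sub>m, y\<^sub>m)]\<close> stands for \<open>\<Sum> x\<^sub>i \<otimes> y\<^sub>i\<close> in the algebraic tensor product.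
  Lists with the same value there differ by a vector that is null for the semi-inner product
  \<open>pre_ip\<close>, so the Hausdorff completion can be formed from lists directly: its points are the
  classes of Cauchy sequences of lists modulo null sequences.\<close>

definition pre_ip ::
    "('a, 'b, 'x) corr \<Rightarrow> ('b, 'c::cstar_algebra, 'y) corr \<Rightarrow>
      ('x \<times> 'y) list \<Rightarrow> ('x \<times> 'y) list \<Rightarrow> 'c"
  where "pre_ip F G u v =
    (\<Sum>(x1, y1)\<leftarrow>u. \<Sum>(x2, y2)\<leftarrow>v. ip G y1 (lact G (ip F x1 x2) y2))"

definition pre_dist ::
    "('a, 'b, 'x) corr \<Rightarrow> ('b, 'c::cstar_algebra, 'y) corr \<Rightarrow>
      ('x \<times> 'y) list \<Rightarrow> ('x \<times> 'y) list \<Rightarrow> real"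
  where "pre_dist F G u v =
    (let w = u @ map (\<lambda>(x, y). (x, ract G y (- 1))) v in sqrt (norm (pre_ip F G w w)))"

definition pre_cauchy ::
    "('a, 'b, 'x) corr \<Rightarrow> ('b, 'c::cstar_algebra, 'y) corr \<Rightarrow> (nat \<Rightarrow> ('x \<times> 'y) list) \<Rightarrow> bool"
  where "pre_cauchy F G X \<longleftrightarrow>
    (\<forall>n. set (X n) \<subseteq> carrier F \<times> carrier G) \<and>
    (\<forall>e>0. \<exists>N. \<forall>m\<ge>N. \<forall>n\<ge>N. pre_dist F G (X m) (X n) < e)"

type_synonym ('x, 'y) tens = "(nat \<Rightarrow> ('x \<times> 'y) list) set"

definition tclass ::
    "('a, 'b, 'x) corr \<Rightarrow> ('b, 'c::cstar_algebra, 'y) corr \<Rightarrow>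
      (nat \<Rightarrow> ('x \<times> 'y) list) \<Rightarrow> ('x, 'y) tens"
  where "tclass F G X = {Y. pre_cauchy F G Y \<and> (\<lambda>n. pre_dist F G (X n) (Y n)) \<longlonglongrightarrow> 0}"

definition trep :: "('x, 'y) tens \<Rightarrow> nat \<Rightarrow> ('x \<times> 'y) list"
  where "trep z = (SOME X. X \<in> z)"

definition tensor ::
    "('a, 'b, 'x) corr \<Rightarrow> ('b, 'c::cstar_algebra, 'y) corr \<Rightarrow> ('a, 'c, ('x, 'y) tens) corr"
  where "tensor F G =
    \<lparr>carrier = tclass F G ` {X. pre_cauchy F G X},
     mzero = tclass F G (\<lambda>n. []),
     madd = (\<lambda>z w. tclass F G (\<lambda>n. trep z n @ trep w n)),
     ract = (\<lambda>z c. tclass F G (\<lambda>n. map (\<lambda>(x, y). (x, ract G y c)) (trep z n))),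
     ip = (\<lambda>z w. lim (\<lambda>n. pre_ip F G (trep z n) (trep w n))),
     lact = (\<lambda>a z. tclass F G (\<lambda>n. map (\<lambda>(x, y). (lact F a x, y)) (trep z n)))\<rparr>"

definition elem_tensor ::
    "('a, 'b, 'x) corr \<Rightarrow> ('b, 'c::cstar_algebra, 'y) corr \<Rightarrow> 'x \<Rightarrow> 'y \<Rightarrow> ('x, 'y) tens"
  where "elem_tensor F G x y = tclass F G (\<lambda>n. [(x, y)])"

text \<open>The continuous extension of the map \<open>\<Sum> x\<^sub>i \<otimes> y\<^sub>i \<mapsto> \<Sum> f x\<^sub>i y\<^sub>i\<close> from an algebraic tensor product
  to its completion, with values in \<open>M\<close>; meaningful whenever that map is well defined and bounded.\<close>

definition tensor_lift ::
    "('d, 'c::cstar_algebra, 'z) corr \<Rightarrow> ('x \<Rightarrow> 'y \<Rightarrow> 'z) \<Rightarrow> ('x, 'y) tens \<Rightarrow> 'z"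
  where "tensor_lift M f z =
    (THE w. w \<in> carrier M \<and>
      (\<forall>X\<in>z. (\<lambda>n. mdist M (msum M (map (\<lambda>(x, y). f x y) (X n))) w) \<longlonglongrightarrow> 0))"

text \<open>\<open>f \<otimes> g\<close> as a map into \<open>F \<otimes> G\<close>.\<close>

definition tensor_map ::
    "('a, 'b, 'x) corr \<Rightarrow> ('b, 'c::cstar_algebra, 'y) corr \<Rightarrow>
      ('x1 \<Rightarrow> 'x) \<Rightarrow> ('y1 \<Rightarrow> 'y) \<Rightarrow> ('x1, 'y1) tens \<Rightarrow> ('x, 'y) tens"
  where "tensor_map F G f g = tensor_lift (tensor F G) (\<lambda>x y. elem_tensor F G (f x) (g y))"

text \<open>The isomorphism \<open>(F \<otimes> G) \<otimes> K \<rightarrow> F \<otimes> (G \<otimes> K)\<close>.\<close>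

definition tensor_assoc ::
    "('a, 'b, 'x) corr \<Rightarrow> ('b, 'c::cstar_algebra, 'y) corr \<Rightarrow> ('c, 'd::cstar_algebra, 'z) corr \<Rightarrow>
      (('x, 'y) tens, 'z) tens \<Rightarrow> ('x, ('y, 'z) tens) tens"
  where "tensor_assoc F G K =
    (let M = tensor F (tensor G K) in
      tensor_lift M (\<lambda>w z. tensor_lift M (\<lambda>x y. elem_tensor F (tensor G K) x (elem_tensor G K y z)) w))"


section \<open>Representations of a C*-correspondence\<close>

definition unital_representation ::
    "'h::complex_hilbert set \<Rightarrow> ('a::cstar_algebra \<Rightarrow> 'h \<Rightarrow> 'h) \<Rightarrow> bool"
  where "unital_representation V \<sigma> \<longleftrightarrow>
    (\<forall>a. bounded_op V (\<sigma> a)) \<and>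
    (\<forall>a b. \<forall>h\<in>V. \<sigma> (a + b) h = \<sigma> a h + \<sigma> b h) \<and>
    (\<forall>c a. \<forall>h\<in>V. \<sigma> (c *\<^sub>C a) h = c *\<^sub>C \<sigma> a h) \<and>
    (\<forall>a b. \<forall>h\<in>V. \<sigma> (a * b) h = \<sigma> a (\<sigma> b h)) \<and>
    (\<forall>a. \<forall>h\<in>V. \<forall>g\<in>V. cinner (\<sigma> a h) g = cinner h (\<sigma> (star a) g)) \<and>
    (\<forall>h\<in>V. \<sigma> 1 h = h)"

text \<open>The norm in the direct sum \<open>M\<^sup>n\<close>, and the operator norm of a map \<open>M\<^sup>n \<rightarrow> N\<^sup>n\<close>; vectors are
  functions on \<open>nat\<close> of which only the first \<open>n\<close> values matter.\<close>

definition vec_norm :: "('a, 'b::cstar_algebra, 'x) corr \<Rightarrow> nat \<Rightarrow> (nat \<Rightarrow> 'x) \<Rightarrow> real"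
  where "vec_norm M n x = sqrt (norm (\<Sum>i<n. ip M (x i) (x i)))"

definition op_norm ::
    "('a, 'b::cstar_algebra, 'x) corr \<Rightarrow> ('c, 'd::cstar_algebra, 'y) corr \<Rightarrow> nat \<Rightarrow>
      ((nat \<Rightarrow> 'x) \<Rightarrow> (nat \<Rightarrow> 'y)) \<Rightarrow> real"
  where "op_norm M N n T =
    Inf {C. 0 \<le> C \<and> (\<forall>x. (\<forall>i<n. x i \<in> carrier M) \<longrightarrow> vec_norm N n (T x) \<le> C * vec_norm M n x)}"

text \<open>The operator space structure of a Hilbert module \<open>F\<close> over \<open>\<A>\<close> is that of a corner of its
  linking algebra: a matrix over \<open>F\<close> is normed as the operator \<open>\<A>\<^sup>n \<rightarrow> F\<^sup>n\<close> it defines.\<close>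

definition completely_contractive ::
    "('a::cstar_algebra, 'a, 'e) corr \<Rightarrow> 'h::complex_hilbert set \<Rightarrow> ('e \<Rightarrow> 'h \<Rightarrow> 'h) \<Rightarrow> bool"
  where "completely_contractive F V A \<longleftrightarrow>
    (\<forall>n \<xi>. (\<forall>i<n. \<forall>j<n. \<xi> i j \<in> carrier F) \<longrightarrow>
      op_norm (hilbert_corr V (\<lambda>_::'a. id)) (hilbert_corr V (\<lambda>_::'a. id)) n
        (\<lambda>h i. \<Sum>j<n. A (\<xi> i j) (h j))
      \<le> op_norm (algebra_corr :: ('a, 'a, 'a) corr) F n
        (\<lambda>b i. msum F (map (\<lambda>j. ract F (\<xi> i j) (b j)) [0..<n])))"

definition corr_representation ::
    "('a::cstar_algebra, 'a, 'e) corr \<Rightarrow> 'h::complex_hilbert set \<Rightarrow>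
      ('e \<Rightarrow> 'h \<Rightarrow> 'h) \<Rightarrow> ('a \<Rightarrow> 'h \<Rightarrow> 'h) \<Rightarrow> bool"
  where "corr_representation F V A \<sigma> \<longleftrightarrow>
    closed_csubspace V \<and>
    unital_representation V \<sigma> \<and>
    (\<forall>\<xi>\<in>carrier F. bounded_op V (A \<xi>)) \<and>
    (\<forall>\<xi>\<in>carrier F. \<forall>\<eta>\<in>carrier F. \<forall>h\<in>V. A (madd F \<xi> \<eta>) h = A \<xi> h + A \<eta> h) \<and>
    (\<forall>c. \<forall>\<xi>\<in>carrier F. \<forall>h\<in>V. A (ract F \<xi> (c *\<^sub>C 1)) h = c *\<^sub>C A \<xi> h) \<and>
    completely_contractive F V A \<and>
    (\<forall>a b. \<forall>\<xi>\<in>carrier F. \<forall>h\<in>V. A (lact F a (ract F \<xi> b)) h = \<sigma> a (A \<xi> (\<sigma> b h)))"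

definition corr_isometric ::
    "('a::cstar_algebra, 'a, 'e) corr \<Rightarrow> 'h::complex_hilbert set \<Rightarrow>
      ('e \<Rightarrow> 'h \<Rightarrow> 'h) \<Rightarrow> ('a \<Rightarrow> 'h \<Rightarrow> 'h) \<Rightarrow> bool"
  where "corr_isometric F V A \<sigma> \<longleftrightarrow>
    (\<forall>\<xi>\<in>carrier F. \<forall>\<eta>\<in>carrier F. \<forall>h\<in>V. \<forall>g\<in>V.
      cinner (A \<xi> h) (A \<eta> g) = cinner h (\<sigma> (ip F \<xi> \<eta>) g))"

text \<open>The map \<open>\<xi> \<otimes> h \<mapsto> A \<xi> h\<close> from \<open>F \<otimes>\<^sub>\<sigma> V\<close> to \<open>V\<close>.\<close>

definition tilde ::
    "'h::complex_hilbert set \<Rightarrow> ('a::cstar_algebra \<Rightarrow> 'h \<Rightarrow> 'h) \<Rightarrow> ('e \<Rightarrow> 'h \<Rightarrow> 'h) \<Rightarrow>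
      ('e, 'h) tens \<Rightarrow> 'h"
  where "tilde V \<sigma> A = tensor_lift (hilbert_corr V \<sigma>) A"

definition corr_fully_coisometric ::
    "('a::cstar_algebra, 'a, 'e) corr \<Rightarrow> 'h::complex_hilbert set \<Rightarrow>
      ('e \<Rightarrow> 'h \<Rightarrow> 'h) \<Rightarrow> ('a \<Rightarrow> 'h \<Rightarrow> 'h) \<Rightarrow> bool"
  where "corr_fully_coisometric F V A \<sigma> \<longleftrightarrow>
    (\<forall>h\<in>V. tilde V \<sigma> A
      (madjoint (tensor F (hilbert_corr V \<sigma>)) (hilbert_corr V \<sigma>) (tilde V \<sigma> A) h) = h)"

definition corr_dilates ::
    "('a::cstar_algebra, 'a, 'e) corr \<Rightarrow>
      'h::complex_hilbert set \<Rightarrow> ('e \<Rightarrow> 'h \<Rightarrow> 'h) \<Rightarrow> ('a \<Rightarrow> 'h \<Rightarrow> 'h) \<Rightarrow>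
      'h set \<Rightarrow> ('e \<Rightarrow> 'h \<Rightarrow> 'h) \<Rightarrow> ('a \<Rightarrow> 'h \<Rightarrow> 'h) \<Rightarrow> bool"
  where "corr_dilates F H S \<rho> V A \<sigma> \<longleftrightarrow>
    V \<subseteq> H \<and>
    (\<forall>a. \<rho> a ` V \<subseteq> V \<and> \<rho> a ` (H \<inter> orth_compl V) \<subseteq> orth_compl V) \<and>
    (\<forall>a. \<forall>v\<in>V. \<rho> a v = \<sigma> a v) \<and>
    (\<forall>\<xi>\<in>carrier F. S \<xi> ` (H \<inter> orth_compl V) \<subseteq> orth_compl V) \<and>
    (\<forall>\<xi>\<in>carrier F. \<forall>v\<in>V. proj V (S \<xi> v) = A \<xi> v)"


section \<open>Product systems over \<open>\<nat>\<^sup>k\<close>\<close>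

text \<open>The index set \<open>{1, \<dots>, k}\<close> is a finite linearly ordered type \<open>'k\<close>, and the semigroup \<open>E\<close> is the
  type \<open>'e\<close>. The field \<open>coeff\<close> is the identification of \<open>\<A>\<close> with the fibre over \<open>0\<close>.\<close>

record ('a, 'e, 'k) product_sys =
  degree :: "'e \<Rightarrow> nat ^ 'k"
  fibre :: "nat ^ 'k \<Rightarrow> ('a, 'a, 'e) corr"
  mult :: "'e \<Rightarrow> 'e \<Rightarrow> 'e"
  coeff :: "'a \<Rightarrow> 'e"

definition product_system :: "('a::cstar_algebra, 'e, 'k::{finite, linorder}) product_sys \<Rightarrow> bool"
  where "product_system E \<longleftrightarrow>
    (\<forall>x y z. mult E (mult E x y) z = mult E x (mult E y z)) \<and>
    (\<forall>x y. degree E (mult E x y) = degree E x + degree E y) \<and>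
    (\<forall>n. carrier (fibre E n) = {x. degree E x = n}) \<and>
    (\<forall>n. cstar_correspondence (fibre E n)) \<and>
    corr_iso algebra_corr (fibre E 0) (coeff E) \<and>
    (\<forall>a n. \<forall>x\<in>carrier (fibre E n).
       mult E (coeff E a) x = lact (fibre E n) a x \<and>
       mult E x (coeff E a) = ract (fibre E n) x a) \<and>
    (\<forall>n m. \<exists>\<Phi>. corr_iso (tensor (fibre E n) (fibre E m)) (fibre E (n + m)) \<Phi> \<and>
       (\<forall>x\<in>carrier (fibre E n). \<forall>y\<in>carrier (fibre E m).
          \<Phi> (elem_tensor (fibre E n) (fibre E m) x y) = mult E x y))"

definition gen :: "('a, 'e, 'k::finite) product_sys \<Rightarrow> 'k \<Rightarrow> ('a, 'a, 'e) corr"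
  where "gen E i = fibre E (axis i 1)"

definition mult_iso ::
    "('a::cstar_algebra, 'e, 'k::finite) product_sys \<Rightarrow> nat ^ 'k \<Rightarrow> nat ^ 'k \<Rightarrow> ('e, 'e) tens \<Rightarrow> 'e"
  where "mult_iso E n m = tensor_lift (fibre E (n + m)) (mult E)"

definition mult_iso_inv ::
    "('a::cstar_algebra, 'e, 'k::finite) product_sys \<Rightarrow> nat ^ 'k \<Rightarrow> nat ^ 'k \<Rightarrow> 'e \<Rightarrow> ('e, 'e) tens"
  where "mult_iso_inv E n m = inv_into (carrier (tensor (fibre E n) (fibre E m))) (mult_iso E n m)"

definition flip_iso ::
    "('a::cstar_algebra, 'e, 'k::finite) product_sys \<Rightarrow> 'k \<Rightarrow> 'k \<Rightarrow> ('e, 'e) tens \<Rightarrow> ('e, 'e) tens"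
  where "flip_iso E i j = mult_iso_inv E (axis j 1) (axis i 1) \<circ> mult_iso E (axis i 1) (axis j 1)"


section \<open>Representations of a product system\<close>

text \<open>\<open>I\<^sub>F \<otimes> g\<close> for a map \<open>g\<close> into the represented Hilbert space \<open>V\<close>, and \<open>f \<otimes> I\<^sub>V\<close> for a map \<open>f\<close>
  into \<open>F\<close>.\<close>

definition id_tensor ::
    "('a::cstar_algebra, 'a, 'e) corr \<Rightarrow> 'h::complex_hilbert set \<Rightarrow> ('a \<Rightarrow> 'h \<Rightarrow> 'h) \<Rightarrow>
      ('y \<Rightarrow> 'h) \<Rightarrow> ('e, 'y) tens \<Rightarrow> ('e, 'h) tens"
  where "id_tensor F V \<sigma> g = tensor_map F (hilbert_corr V \<sigma>) id g"

definition tensor_id ::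
    "('a, 'a, 'x) corr \<Rightarrow> 'h::complex_hilbert set \<Rightarrow> ('a \<Rightarrow> 'h \<Rightarrow> 'h) \<Rightarrow>
      ('y \<Rightarrow> 'x) \<Rightarrow> ('y, 'h) tens \<Rightarrow> ('x, 'h) tens"
  where "tensor_id F V \<sigma> f = tensor_map F (hilbert_corr V \<sigma>) f id"

definition representation ::
    "('a::cstar_algebra, 'e, 'k::{finite, linorder}) product_sys \<Rightarrow> 'h::complex_hilbert set \<Rightarrow>
      ('k \<Rightarrow> 'e \<Rightarrow> 'h \<Rightarrow> 'h) \<Rightarrow> ('a \<Rightarrow> 'h \<Rightarrow> 'h) \<Rightarrow> bool"
  where "representation E V A \<sigma> \<longleftrightarrow>
    (\<forall>i. corr_representation (gen E i) V (A i) \<sigma>) \<and>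
    (\<forall>i j. \<forall>z\<in>carrier (tensor (tensor (gen E i) (gen E j)) (hilbert_corr V \<sigma>)).
       tilde V \<sigma> (A i) (id_tensor (gen E i) V \<sigma> (tilde V \<sigma> (A j))
         (tensor_assoc (gen E i) (gen E j) (hilbert_corr V \<sigma>) z)) =
       tilde V \<sigma> (A j) (id_tensor (gen E j) V \<sigma> (tilde V \<sigma> (A i))
         (tensor_assoc (gen E j) (gen E i) (hilbert_corr V \<sigma>)
           (tensor_id (tensor (gen E j) (gen E i)) V \<sigma> (flip_iso E i j) z))))"

definition isometric ::
    "('a::cstar_algebra, 'e, 'k::{finite, linorder}) product_sys \<Rightarrow> 'h::complex_hilbert set \<Rightarrow>
      ('k \<Rightarrow> 'e \<Rightarrow> 'h \<Rightarrow> 'h) \<Rightarrow> ('a \<Rightarrow> 'h \<Rightarrow> 'h) \<Rightarrow> bool"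
  where "isometric E V A \<sigma> \<longleftrightarrow> (\<forall>i. corr_isometric (gen E i) V (A i) \<sigma>)"

definition fully_coisometric ::
    "('a::cstar_algebra, 'e, 'k::{finite, linorder}) product_sys \<Rightarrow> 'h::complex_hilbert set \<Rightarrow>
      ('k \<Rightarrow> 'e \<Rightarrow> 'h \<Rightarrow> 'h) \<Rightarrow> ('a \<Rightarrow> 'h \<Rightarrow> 'h) \<Rightarrow> bool"
  where "fully_coisometric E V A \<sigma> \<longleftrightarrow> (\<forall>i. corr_fully_coisometric (gen E i) V (A i) \<sigma>)"

text \<open>For a word \<open>i\<^sub>1 \<dots> i\<^sub>m\<close> with \<open>n = e\<^bsub>i\<^sub>1\<^esub> + \<dots> + e\<^bsub>i\<^sub>m\<^esub>\<close>, the map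
  \<open>x\<^sub>1 \<cdots> x\<^sub>m \<otimes> h \<mapsto> A\<^bsub>i\<^sub>1\<^esub> x\<^sub>1 (\<dots> (A\<^bsub>i\<^sub>m\<^esub> x\<^sub>m h))\<close> from \<open>E(n) \<otimes>\<^sub>\<sigma> V\<close> to \<open>V\<close>, where \<open>E(n)\<close> is identified
  with \<open>E\<^bsub>i\<^sub>1\<^esub> \<otimes> \<dots> \<otimes> E\<^bsub>i\<^sub>m\<^esub>\<close>. The non-decreasing word \<open>sorted_word n\<close>
  corresponds to the identification of \<open>E(n)\<close> with \<open>E\<^sub>1\<^bsup>n\<^sub>1\<^esup> \<otimes> \<dots> \<otimes> E\<^sub>k\<^bsup>n\<^sub>k\<^esup>\<close>.\<close>

definition word_degree :: "'k::finite list \<Rightarrow> nat ^ 'k"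
  where "word_degree w = (\<Sum>i\<leftarrow>w. axis i 1)"

definition sorted_word :: "nat ^ 'k::{finite, linorder} \<Rightarrow> 'k list"
  where "sorted_word n = concat (map (\<lambda>i. replicate (n $ i) i) (sorted_list_of_set UNIV))"

primrec tilde_word ::
    "('a::cstar_algebra, 'e, 'k::{finite, linorder}) product_sys \<Rightarrow> 'h::complex_hilbert set \<Rightarrow>
      ('k \<Rightarrow> 'e \<Rightarrow> 'h \<Rightarrow> 'h) \<Rightarrow> ('a \<Rightarrow> 'h \<Rightarrow> 'h) \<Rightarrow> 'k list \<Rightarrow> ('e, 'h) tens \<Rightarrow> 'h"
  where
    "tilde_word E V A \<sigma> [] = tilde V \<sigma> (\<lambda>x. \<sigma> (inv (coeff E) x))"
  | "tilde_word E V A \<sigma> (i # w) =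
      tilde V \<sigma> (A i) \<circ>
      id_tensor (gen E i) V \<sigma> (tilde_word E V A \<sigma> w) \<circ>
      tensor_assoc (gen E i) (fibre E (word_degree w)) (hilbert_corr V \<sigma>) \<circ>
      tensor_id (tensor (gen E i) (fibre E (word_degree w))) V \<sigma>
        (mult_iso_inv E (axis i 1) (word_degree w))"

definition tilde_n ::
    "('a::cstar_algebra, 'e, 'k::{finite, linorder}) product_sys \<Rightarrow> 'h::complex_hilbert set \<Rightarrow>
      ('k \<Rightarrow> 'e \<Rightarrow> 'h \<Rightarrow> 'h) \<Rightarrow> ('a \<Rightarrow> 'h \<Rightarrow> 'h) \<Rightarrow> nat ^ 'k::{finite, linorder} \<Rightarrow> ('e, 'h) tens \<Rightarrow> 'h"
  where "tilde_n E V A \<sigma> n = tilde_word E V A \<sigma> (sorted_word n)"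

definition dilates ::
    "('a::cstar_algebra, 'e, 'k::{finite, linorder}) product_sys \<Rightarrow>
      'h::complex_hilbert set \<Rightarrow> ('k \<Rightarrow> 'e \<Rightarrow> 'h \<Rightarrow> 'h) \<Rightarrow> ('a \<Rightarrow> 'h \<Rightarrow> 'h) \<Rightarrow>
      'h set \<Rightarrow> ('k \<Rightarrow> 'e \<Rightarrow> 'h \<Rightarrow> 'h) \<Rightarrow> ('a \<Rightarrow> 'h \<Rightarrow> 'h) \<Rightarrow> bool"
  where "dilates E H S \<rho> V A \<sigma> \<longleftrightarrow> (\<forall>i. corr_dilates (gen E i) H (S i) \<rho> V (A i) \<sigma>)"

text \<open>For a \<open>\<rho>\<close>-reducing subspace \<open>V\<close> of \<open>H\<close>, the map \<open>id_tensor (fibre E n) H \<rho> id\<close> below is the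
  inclusion of \<open>E(n) \<otimes> V\<close> into \<open>E(n) \<otimes> H\<close>.\<close>

definition minimal_dilation ::
    "('a::cstar_algebra, 'e, 'k::{finite, linorder}) product_sys \<Rightarrow>
      'h::complex_hilbert set \<Rightarrow> ('k \<Rightarrow> 'e \<Rightarrow> 'h \<Rightarrow> 'h) \<Rightarrow> ('a \<Rightarrow> 'h \<Rightarrow> 'h) \<Rightarrow> 'h set \<Rightarrow> bool"
  where "minimal_dilation E H S \<rho> V \<longleftrightarrow>
    H = closed_span (\<Union>n. tilde_n E H S \<rho> n ` id_tensor (fibre E n) H \<rho> id `
      carrier (tensor (fibre E n) (hilbert_corr V \<rho>)))"

definition finitely_correlated ::
    "('a::cstar_algebra, 'e, 'k::{finite, linorder}) product_sys \<Rightarrow> 'h::complex_hilbert set \<Rightarrow>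
      ('k \<Rightarrow> 'e \<Rightarrow> 'h \<Rightarrow> 'h) \<Rightarrow> ('a \<Rightarrow> 'h \<Rightarrow> 'h) \<Rightarrow> bool"
  where "finitely_correlated E H S \<rho> \<longleftrightarrow>
    representation E H S \<rho> \<and> isometric E H S \<rho> \<and>
    (\<exists>V A \<sigma>. V \<noteq> {0} \<and> finite_dimensional V \<and> representation E V A \<sigma> \<and>
       dilates E H S \<rho> V A \<sigma> \<and> minimal_dilation E H S \<rho> V)"

definition unitarily_equivalent ::
    "('a, 'e, 'k::finite) product_sys \<Rightarrow>
      'h::complex_hilbert set \<Rightarrow> ('k \<Rightarrow> 'e \<Rightarrow> 'h \<Rightarrow> 'h) \<Rightarrow> ('a \<Rightarrow> 'h \<Rightarrow> 'h) \<Rightarrow>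
      'g::complex_hilbert set \<Rightarrow> ('k \<Rightarrow> 'e \<Rightarrow> 'g \<Rightarrow> 'g) \<Rightarrow> ('a \<Rightarrow> 'g \<Rightarrow> 'g) \<Rightarrow> bool"
  where "unitarily_equivalent E V A \<sigma> W B \<tau> \<longleftrightarrow>
    (\<exists>U. bij_betw U V W \<and>
      (\<forall>x\<in>V. \<forall>y\<in>V. U (x + y) = U x + U y) \<and>
      (\<forall>c. \<forall>x\<in>V. U (c *\<^sub>C x) = c *\<^sub>C U x) \<and>
      (\<forall>x\<in>V. \<forall>y\<in>V. cinner (U x) (U y) = cinner x y) \<and>
      (\<forall>i. \<forall>\<xi>\<in>carrier (gen E i). \<forall>x\<in>V. U (A i \<xi> x) = B i \<xi> (U x)) \<and>
      (\<forall>a. \<forall>x\<in>V. U (\<sigma> a x) = \<tau> a (U x)))"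

definition compress :: "'h::complex_hilbert set \<Rightarrow> ('k \<Rightarrow> 'e \<Rightarrow> 'h \<Rightarrow> 'h) \<Rightarrow> 'k \<Rightarrow> 'e \<Rightarrow> 'h \<Rightarrow> 'h"
  where "compress V S = (\<lambda>i \<xi> x. proj V (S i \<xi> x))"


section \<open>The generated algebra and minimal cyclic coinvariant subspaces\<close>

inductive_set generated_algebra :: "('h::complex_hilbert \<Rightarrow> 'h) set \<Rightarrow> ('h \<Rightarrow> 'h) set"
  for X :: "('h \<Rightarrow> 'h) set"
  where
    ident: "id \<in> generated_algebra X"
  | incl: "T \<in> X \<Longrightarrow> T \<in> generated_algebra X"
  | add: "R \<in> generated_algebra X \<Longrightarrow> T \<in> generated_algebra X \<Longrightarrow>
      (\<lambda>x. R x + T x) \<in> generated_algebra X"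
  | scale: "T \<in> generated_algebra X \<Longrightarrow> (\<lambda>x. c *\<^sub>C T x) \<in> generated_algebra X"
  | comp: "R \<in> generated_algebra X \<Longrightarrow> T \<in> generated_algebra X \<Longrightarrow> R \<circ> T \<in> generated_algebra X"

definition wot_closure :: "('h::complex_hilbert \<Rightarrow> 'h) set \<Rightarrow> ('h \<Rightarrow> 'h) set"
  where "wot_closure X = {T. bounded_op UNIV T \<and>
    (\<forall>P e. finite P \<and> e > 0 \<longrightarrow>
      (\<exists>R\<in>X. \<forall>(x, y)\<in>P. cmod (cinner y (T x - R x)) < e))}"

definition wot_algebra ::
    "('a, 'e, 'k::finite) product_sys \<Rightarrow> ('k \<Rightarrow> 'e \<Rightarrow> 'h::complex_hilbert \<Rightarrow> 'h) \<Rightarrow> ('a \<Rightarrow> 'h \<Rightarrow> 'h) \<Rightarrow>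
      ('h \<Rightarrow> 'h) set"
  where "wot_algebra E S \<rho> =
    wot_closure (generated_algebra ({S i \<xi> | i \<xi>. \<xi> \<in> carrier (gen E i)} \<union> range \<rho>))"

definition op_adjoint :: "('h::complex_hilbert \<Rightarrow> 'h) \<Rightarrow> 'h \<Rightarrow> 'h"
  where "op_adjoint T y = (THE x. \<forall>z. cinner z x = cinner (T z) y)"

definition cyclic_coinvariant :: "('h::complex_hilbert \<Rightarrow> 'h) set \<Rightarrow> 'h set \<Rightarrow> bool"
  where "cyclic_coinvariant \<SS> W \<longleftrightarrow>
    closed_csubspace W \<and>
    (\<forall>T\<in>\<SS>. op_adjoint T ` W \<subseteq> W) \<and>
    closed_span {T w | T w. T \<in> \<SS> \<and> w \<in> W} = UNIV"

definition minimal_cyclic_coinvariant ::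
    "('a, 'e, 'k::finite) product_sys \<Rightarrow> ('k \<Rightarrow> 'e \<Rightarrow> 'h::complex_hilbert \<Rightarrow> 'h) \<Rightarrow> ('a \<Rightarrow> 'h \<Rightarrow> 'h) \<Rightarrow>
      'h set \<Rightarrow> bool"
  where "minimal_cyclic_coinvariant E S \<rho> V \<longleftrightarrow>
    cyclic_coinvariant (wot_algebra E S \<rho>) V \<and>
    \<not> (\<exists>W. W \<subset> V \<and> cyclic_coinvariant (wot_algebra E S \<rho>) W)"

end

theory Submission
  imports Defs
begin

text \<open>
  The pairs of vectors on which two representations agree are treated as subspaces of the direct sum
  of the two Hilbert spaces. If \<open>G\<close> is the graph of a unitary between the minimal subspaces that
  intertwines the compressions, full coisometry gives \<open>G \<subseteq> \<Theta>\<^sub>i G\<close>, where \<open>\<Theta>\<^sub>i M\<close> is the closed span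
  of \<open>S\<^sub>i(E\<^sub>i)M\<close>. Hence the subspaces obtained from \<open>G\<close> by words in the \<open>\<Theta>\<^sub>i\<close> are directed, and the
  closure of their union is the graph of a unitary on the whole space.

  Conversely, a unitary equivalence maps the minimal cyclic coinvariant subspace onto the other one
  because such subspaces are unique: if \<open>W\<^sub>1\<close> and \<open>W\<^sub>2\<close> are cyclic and coinvariant, so is their
  intersection. This rests on the fact that a non-zero finite dimensional coinvariant \<open>N\<close> meets every
  cyclic coinvariant \<open>W\<close>. Otherwise the cosine of the angle between \<open>N\<close> and \<open>W\<close> would be some
  \<open>\<gamma> < 1\<close>; applying \<open>\<Theta>\<^sub>i\<close> to both does not increase it, so \<open>N\<close> would stay away from a dense union.

  The interior tensor products are defined through Cauchy sequences and choices of limits. To evaluate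
  them, positivity of the form \<open>pre_ip\<close> is needed, hence positivity of \<open>c\<^sup>* c\<close> in a C*-algebra.
\<close>

subsection \<open>Complex vector spaces and C*-algebras\<close>

text \<open>Full coisometry is used through one consequence, \<open>dense_range\<close>: a vector
  orthogonal to all \<open>S i x g\<close> is zero. A coinvariant \<open>W\<close> then lies in
  \<open>Theta i W\<close>, because \<open>S i x\<close> sends the orthogonal complement of
  \<open>W\<close> into the complements of both \<open>W\<close> and \<open>Theta i W\<close>. Words
  in the \<open>Theta i\<close> are directed because the \<open>Theta i\<close> commute, but
  commutation is only available in the limit: the flip of an elementary tensor is approximated by
  finite sums. The geometric part therefore lives in the locale \<open>commuting_rep\<close>, which
  keeps these sums and forgets tensor products. It is closed under direct sums, so the graph of an
  intertwiner is a subspace like any other. Angles survive \<open>Theta i\<close> because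
  projections onto \<sigma>-invariant subspaces commute with \<sigma>, so that tensoring them with
  the identity makes sense. Finite dimension turns a trivial intersection into a cosine strictly
  below 1. The cyclic coinvariant subspaces to be compared may be infinite dimensional; the finite
  dimensional \<open>N\<close> is obtained by projecting a cyclic subspace supplied by finite
  correlation.\<close>

lemma scaleC_zero_left [simp]: "0 *\<^sub>C (x::'a::complex_vector) = 0"
  by (metis of_real_0 scaleR_scaleC scaleR_zero_left)

lemma scaleC_one_left [simp]: "1 *\<^sub>C (x::'a::complex_vector) = x"
  by (rule scaleC_one)

lemma scaleC_minus1_left: "(-1) *\<^sub>C (x::'a::complex_vector) = - x"
  by (metis of_real_1 of_real_minus scaleR_minus1_left scaleR_scaleC)

lemma scaleC_zero_right [simp]: "c *\<^sub>C (0::'a::complex_vector) = 0"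
  using scaleC_add_right[of c "0::'a" 0] by simp

lemma scaleC_minus_left: "(- c) *\<^sub>C (x::'a::complex_vector) = - (c *\<^sub>C x)"
  by (metis scaleC_minus1_left mult_minus1 scaleC_scaleC)

lemma scaleC_minus_right: "c *\<^sub>C (- x::'a::complex_vector) = - (c *\<^sub>C x)"
  by (metis scaleC_add_right add.right_inverse add_eq_0_iff scaleC_zero_right)

lemma scaleC_diff_right: "c *\<^sub>C (x - y::'a::complex_vector) = c *\<^sub>C x - c *\<^sub>C y"
  by (metis add_uminus_conv_diff scaleC_add_right scaleC_minus_right)

lemma scaleC_scaleR: "c *\<^sub>C (r *\<^sub>R x) = r *\<^sub>R (c *\<^sub>C (x::'a::complex_vector))"
  by (simp add: scaleR_scaleC scaleC_scaleC mult.commute)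

lemma star_zero [simp]: "star (0::'a::cstar_algebra) = 0"
  using star_add[of "0::'a" 0] by simp

lemma star_one [simp]: "star (1::'a::cstar_algebra) = 1"
  by (metis mult.right_neutral mult_1 star_mult star_star)

lemma star_minus: "star (- x::'a::cstar_algebra) = - star x"
  by (metis add.right_inverse add_eq_0_iff star_add star_zero)

lemma star_diff: "star (x - y::'a::cstar_algebra) = star x - star y"
  by (metis add_uminus_conv_diff star_add star_minus)

lemma star_scaleR: "star (r *\<^sub>R x::'a::cstar_algebra) = r *\<^sub>R star x"
  by (simp add: scaleR_scaleC star_scaleC)

lemma star_of_real [simp]: "star (of_real r::'a::cstar_algebra) = of_real r"
  by (simp add: of_real_def star_scaleR)

lemma star_power: "star (x ^ n::'a::cstar_algebra) = star x ^ n"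
  by (induction n) (auto simp: star_mult power_commutes)

lemma star_sum: "star (\<Sum>i\<in>I. f i :: 'a::cstar_algebra) = (\<Sum>i\<in>I. star (f i))"
  by (induction I rule: infinite_finite_induct) (auto simp: star_add)

lemma norm_star [simp]: "norm (star (x::'a::cstar_algebra)) = norm x"
proof -
  have le: "norm y \<le> norm (star y)" for y :: 'a
  proof (cases "y = 0")
    case False
    have "norm y * norm y \<le> norm (star y) * norm y"
      using cstar_identity[of y] norm_mult_ineq[of "star y" y] by (simp add: power2_eq_square)
    with False show ?thesis by simp
  qed simp
  show ?thesis using le[of x] le[of "star x"] by (simp add: star_star)
qed

lemma bounded_linear_star: "bounded_linear (star :: 'a::cstar_algebra \<Rightarrow> 'a)"
  by (rule bounded_linear_intro[of _ 1]) (auto simp: star_add star_scaleR)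

section \<open>Norms of powers and square roots of self-adjoint elements\<close>

lemma norm_sa_square: "star (x::'a::cstar_algebra) = x \<Longrightarrow> norm (x * x) = (norm x)\<^sup>2"
  using cstar_identity[of x] by simp

lemma norm_sa_power_pow2:
  assumes "star (x::'a::cstar_algebra) = x"
  shows "norm (x ^ (2 ^ n)) = norm x ^ (2 ^ n)"
proof (induction n)
  case (Suc n)
  have "x ^ (2 ^ Suc n) = x ^ (2 ^ n) * x ^ (2 ^ n)"
    by (simp add: mult_2 flip: power_add)
  then have "norm (x ^ (2 ^ Suc n)) = (norm (x ^ (2 ^ n)))\<^sup>2"
    using norm_sa_square[of "x ^ (2 ^ n)"] assms by (simp add: star_power)
  moreover have "norm x ^ (2 ^ Suc n) = (norm x ^ (2 ^ n))\<^sup>2"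
    by (metis mult.commute power_Suc power_mult)
  ultimately show ?case using Suc by simp
qed simp

text \<open>Squaring settles the exponents \<open>2 ^ n\<close>. For the others, split
  \<open>x ^ (2 ^ n)\<close> as \<open>x ^ n\<close> times a remaining power and cancel; a loss in
  \<open>norm (x ^ n)\<close> would otherwise show up in the larger power.\<close>

lemma norm_sa_power:
  assumes "star (x::'a::cstar_algebra) = x"
  shows "norm (x ^ n) = norm x ^ n"
proof (rule antisym)
  show "norm (x ^ n) \<le> norm x ^ n" by (rule norm_power_ineq)
  show "norm x ^ n \<le> norm (x ^ n)"
  proof (cases "x = 0")
    case False
    have le: "n \<le> 2 ^ n" by (simp add: less_imp_le)
    have "norm x ^ n * norm x ^ (2 ^ n - n) = norm (x ^ (2 ^ n))"
      using le by (simp add: norm_sa_power_pow2[OF assms] flip: power_add)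
    also have "\<dots> = norm (x ^ n * x ^ (2 ^ n - n))"
      using le by (simp flip: power_add)
    also have "\<dots> \<le> norm (x ^ n) * norm x ^ (2 ^ n - n)"
      by (intro order_trans[OF norm_mult_ineq] mult_left_mono norm_power_ineq) simp
    finally show ?thesis using False by simp
  qed (cases n; simp)
qed

text \<open>Consecutive coefficients have ratio \<open>(1/2 - n) / (1 + n)\<close>, of modulus at
  most 1. This crude bound suffices for the root series strictly inside the unit ball.\<close>

lemma abs_half_gbinomial_le: "\<bar>(1/2::real) gchoose n\<bar> \<le> 1"
proof (induction n)
  case (Suc n)
  have "((1/2::real) gchoose Suc n) = ((1/2) gchoose n) * ((1/2 - n) / (1 + n))"
    by (simp add: gbinomial_mult_1[of "1/2::real" n] gbinomial_absorb_comp field_simps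
        gbinomial_Suc_rec)
  moreover have "\<bar>(1/2 - real n) / (1 + n)\<bar> \<le> 1"
    by (auto simp: field_simps abs_if)
  ultimately show ?case using Suc
    by (metis abs_ge_zero abs_mult mult_le_one)
qed simp

text \<open>The binomial series of \<open>(1 - a)^(1/2)\<close>. Vandermonde's identity for
  \<open>1/2 + 1/2 = 1\<close> collapses its Cauchy product to \<open>1 - a\<close>. Elements
  commuting with \<open>a\<close> commute with every partial sum, hence with \<open>b\<close>; later
  products of several roots rely on this.\<close>

lemma sqrt_one_minus:
  fixes a :: "'a::cstar_algebra"
  assumes "star a = a" and "norm a < 1"
  obtains b where "star b = b" "b * b = 1 - a" "\<And>y. y * a = a * y \<Longrightarrow> y * b = b * y"
proof -
  define c where "c n = (-1) ^ n * ((1/2::real) gchoose n)" for n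
  define f where "f n = c n *\<^sub>R a ^ n" for n
  have cle: "\<bar>c n\<bar> \<le> 1" for n
    using abs_half_gbinomial_le by (simp add: c_def abs_mult)
  have nf: "norm (f n) \<le> norm a ^ n" for n
    unfolding f_def norm_scaleR
    using mult_mono[OF cle[of n] norm_power_ineq[of a n]] by simp
  have sn: "summable (\<lambda>n. norm (f n))"
    by (rule summable_comparison_test[OF _ summable_geometric[of "norm a"]])
      (use nf assms in auto)
  then have sf: "summable f" by (rule summable_norm_cancel)
  define b where "b = suminf f"
  have "b * b = (\<Sum>k. \<Sum>i\<le>k. f i * f (k - i))"
    unfolding b_def by (rule Cauchy_product[OF sn sn])
  also have "(\<lambda>k. \<Sum>i\<le>k. f i * f (k - i)) = (\<lambda>k. if k = 0 then 1 else if k = 1 then - a else 0)"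
  proof
    fix k
    have "(\<Sum>i\<le>k. f i * f (k - i)) = (\<Sum>i\<le>k. (c i * c (k - i)) *\<^sub>R a ^ k)"
      by (intro sum.cong) (auto simp: f_def simp flip: power_add)
    also have "\<dots> = (\<Sum>i\<le>k. c i * c (k - i)) *\<^sub>R a ^ k"
      by (simp add: scaleR_sum_left)
    also have "(\<Sum>i\<le>k. c i * c (k - i)) = (\<Sum>i\<le>k. (-1) ^ k * (((1/2) gchoose i) * ((1/2) gchoose (k - i))))"
      unfolding c_def by (intro sum.cong) (auto simp: mult_ac simp flip: power_add)
    also have "\<dots> = (-1) ^ k * ((1::real) gchoose k)"
      using gbinomial_Vandermonde[of "1/2::real" "1/2" k]
      by (simp add: atLeast0AtMost flip: sum_distrib_left)
    also have "((1::real) gchoose k) = of_nat (1 choose k)"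
      by (metis binomial_gbinomial of_nat_1)
    finally show "(\<Sum>i\<le>k. f i * f (k - i)) = (if k = 0 then 1 else if k = 1 then - a else 0)"
      by (cases k; cases "k - 1") auto
  qed
  also have "(\<Sum>k. if k = 0 then 1 else if k = 1 then - a else 0) = (\<Sum>k\<in>{0,1::nat}. if k = 0 then 1 else if k = 1 then - a else 0)"
    by (rule suminf_finite) auto
  also have "\<dots> = 1 - a" by simp
  finally have bb: "b * b = 1 - a" .
  have "star b = (\<Sum>n. star (f n))"
    unfolding b_def by (rule bounded_linear.suminf[OF bounded_linear_star sf])
  also have "\<dots> = b" by (simp add: f_def[abs_def] b_def star_scaleR star_power assms)
  finally have sb: "star b = b" .
  have "y * b = b * y" if "y * a = a * y" for y
  proof -
    have "y * a ^ n = a ^ n * y" for n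
      by (induction n) (auto simp: mult.assoc, metis mult.assoc that)
    then have "y * f n = f n * y" for n by (simp add: f_def)
    then show ?thesis unfolding b_def
      by (simp only: suminf_mult[OF sf, symmetric] suminf_mult2[OF sf])
  qed
  with sb bb that show thesis by blast
qed

text \<open>Spectrum in the nonnegative half-line, expressed by the norm alone, so that no
  functional calculus is needed. The algebraic notion \<open>positive\<close> is compared with it in
  \<open>nonneg_if_positive\<close>.\<close>

definition nonneg :: "'a::cstar_algebra \<Rightarrow> bool"
  where "nonneg a \<longleftrightarrow> star a = a \<and> norm (of_real (norm a) - a) \<le> norm a"

text \<open>The element \<open>w = u + \<i> *\<^sub>C v\<close> satisfies
  \<open>star w * w = of_real (r\<^sup>2)\<close> because \<open>u\<close> and \<open>v\<close>
  commute; so its norm is \<open>\<bar>r\<bar>\<close>, and \<open>u\<close> is its real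
  part.\<close>

lemma norm_sa_le_if_squares:
  fixes u v :: "'a::cstar_algebra"
  assumes "star u = u" "star v = v" "u * v = v * u" and uv: "u * u + v * v = of_real (r\<^sup>2)"
  shows "norm u \<le> \<bar>r\<bar>"
proof -
  define w where "w = u + \<i> *\<^sub>C v"
  have sw: "star w = u - \<i> *\<^sub>C v"
    by (simp add: w_def star_add star_scaleC assms scaleC_minus_left)
  have "star w * w = u * u + v * v"
    unfolding sw by (simp add: w_def algebra_simps assms(3) scaleC_mult_left scaleC_mult_right
        scaleC_scaleC scaleC_minus1_left scaleC_diff_right scaleC_add_right)
  then have "(norm w)\<^sup>2 = r\<^sup>2"
    using cstar_identity[of w] uv by (metis abs_power2 norm_of_real)
  then have nw: "norm w = \<bar>r\<bar>" by (simp add: power2_eq_iff abs_if split: if_splits) (smt (verit) norm_ge_zero)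
  have "2 *\<^sub>R u = w + star w" unfolding sw by (simp add: w_def scaleR_2)
  then have "2 * norm u \<le> norm w + norm (star w)"
    by (metis norm_scaleR norm_triangle_ineq abs_numeral)
  then show ?thesis using nw by simp
qed

text \<open>Rescaling of the root series: \<open>x\<close> is \<open>t\<close> times
  \<open>1 - a\<close> with \<open>norm a < 1\<close>.\<close>

lemma sqrt_ball:
  fixes x :: "'a::cstar_algebra"
  assumes "star x = x" and "norm (of_real t - x) < t"
  obtains b where "star b = b" "b * b = x" "\<And>y. y * x = x * y \<Longrightarrow> y * b = b * y"
proof -
  have t: "t > 0" using assms(2) norm_ge_zero[of "of_real t - x"] by linarith
  define a where "a = 1 - (1/t) *\<^sub>R x"
  have "a = (1/t) *\<^sub>R (of_real t - x)"
    using t by (simp add: a_def algebra_simps of_real_def)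
  then have "norm a = norm (of_real t - x) / t" using t by simp
  then have "norm a < 1" using assms(2) t by (metis divide_less_eq_1_pos)
  moreover have "star a = a" by (simp add: a_def star_diff star_scaleR assms)
  ultimately obtain b where b: "star b = b" "b * b = 1 - a" "\<And>y. y * a = a * y \<Longrightarrow> y * b = b * y"
    using sqrt_one_minus by blast
  show thesis
  proof
    show "star (sqrt t *\<^sub>R b) = sqrt t *\<^sub>R b" by (simp add: star_scaleR b)
    show "sqrt t *\<^sub>R b * sqrt t *\<^sub>R b = x"
      using t by (simp add: b(2)) (simp add: a_def)
    show "y * sqrt t *\<^sub>R b = sqrt t *\<^sub>R b * y" if "y * x = x * y" for y
      using b(3)[of y] that by (simp add: a_def algebra_simps)
  qed
qed

text \<open>The hypotheses express that \<open>x\<close> lies between 0 and \<open>s\<close>, with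
  arbitrary radii as witnesses. The idea is the identity
  \<open>(x - s/2)\<^sup>2 + x (s - x) = (s/2)\<^sup>2\<close>, in which the product is the square
  of \<open>b * d\<close> for commuting roots of the two factors. Shifting both factors by
  \<open>e\<close> makes the balls strict, as the root series requires, and changes the right side
  to \<open>(s/2 + e)\<^sup>2\<close>.\<close>

lemma ball_interval:
  fixes x :: "'a::cstar_algebra"
  assumes x: "star x = x" and t: "norm (of_real t - x) \<le> t"
    and t': "norm (of_real t' - (of_real s - x)) \<le> t'" and s: "s \<ge> 0"
  shows "norm (x - of_real (s/2)) \<le> s/2"
proof (rule field_le_epsilon)
  fix e :: real assume e: "e > 0"
  have "of_real (t + e) - (x + of_real e) = of_real t - x" by simp
  then have "norm (of_real (t + e) - (x + of_real e)) < t + e" using t e by (smt (verit))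
  moreover have "star (x + of_real e) = x + of_real e" by (simp add: star_add x)
  ultimately obtain b where b: "star b = b" "b * b = x + of_real e"
    and bc: "\<And>y. y * (x + of_real e) = (x + of_real e) * y \<Longrightarrow> y * b = b * y"
    using sqrt_ball by metis
  have "of_real (t' + e) - (of_real s - x + of_real e) = of_real t' - (of_real s - x)" by simp
  then have "norm (of_real (t' + e) - (of_real s - x + of_real e)) < t' + e" using t' e by (smt (verit))
  moreover have "star (of_real s - x + of_real e) = of_real s - x + of_real e"
    by (simp add: star_add star_diff x)
  ultimately obtain d where d: "star d = d" "d * d = of_real s - x + of_real e"
    and dc: "\<And>y. y * (of_real s - x + of_real e) = (of_real s - x + of_real e) * y \<Longrightarrow> y * d = d * y"
    using sqrt_ball by metis
  have xd: "x * d = d * x" by (rule dc) (simp add: algebra_simps of_real_def)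
  have db: "d * b = b * d" by (rule bc) (simp add: algebra_simps of_real_def xd)
  have xb: "x * b = b * x" by (rule bc) (simp add: algebra_simps of_real_def)
  have "norm (x - of_real (s/2)) \<le> \<bar>s/2 + e\<bar>"
  proof (rule norm_sa_le_if_squares[where v = "b * d"])
    show "(x - of_real (s/2)) * (b * d) = b * d * (x - of_real (s/2))"
      by (simp add: algebra_simps of_real_def) (metis mult.assoc xb xd)
    have "(b * d) * (b * d) = (b * b) * (d * d)" by (metis db mult.assoc)
    also have "\<dots> = (x + of_real e) * (of_real s - x + of_real e)" by (simp add: b d)
    also have "(x - of_real (s/2)) * (x - of_real (s/2)) + \<dots> = of_real ((s/2 + e)\<^sup>2)"
      by (simp add: algebra_simps of_real_def power2_eq_square flip: scaleR_add_left)
    finally show "(x - of_real (s/2)) * (x - of_real (s/2)) + (b * d) * (b * d) = of_real ((s/2 + e)\<^sup>2)" .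
  qed (auto simp: star_diff star_mult x b d db)
  then show "norm (x - of_real (s/2)) \<le> s/2 + e" using s e by simp
qed

text \<open>Any radius \<open>t\<close> may witness nonnegativity: with the upper end
  \<open>norm x\<close>, the interval estimate recentres the ball at \<open>norm x / 2\<close>, and
  enlarging that ball gives the one centred at \<open>norm x\<close>.\<close>

lemma nonnegI:
  fixes x :: "'a::cstar_algebra"
  assumes x: "star x = x" and "norm (of_real t - x) \<le> t"
  shows "nonneg x"
proof -
  have "norm (x - of_real (norm x / 2)) \<le> norm x / 2"
    by (rule ball_interval[OF assms, of "norm x"]) auto
  moreover have "of_real (norm x) - x = of_real (norm x / 2) - (x - of_real (norm x / 2))"
    by (simp add: of_real_def algebra_simps flip: scaleR_add_left)
  then have "norm (of_real (norm x) - x) \<le> norm (of_real (norm x / 2) :: 'a) + norm (x - of_real (norm x / 2))"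
    by (metis norm_triangle_ineq4)
  ultimately have "norm (of_real (norm x) - x) \<le> norm x"
    by (simp del: of_real_divide)
  with x show ?thesis by (simp add: nonneg_def)
qed

lemma nonneg_sa: "nonneg x \<Longrightarrow> star x = x"
  by (simp add: nonneg_def)

lemma nonneg_of_real [simp]: "0 \<le> r \<Longrightarrow> nonneg (of_real r)"
  by (simp add: nonneg_def)

lemma nonneg_0 [simp]: "nonneg 0"
  by (simp add: nonneg_def)

lemma nonneg_1 [simp]: "nonneg 1"
  by (simp add: nonneg_def)

lemma nonneg_add:
  assumes "nonneg x" "nonneg y"
  shows "nonneg (x + y)"
proof (rule nonnegI[where t = "norm x + norm y"])
  have "of_real (norm x + norm y) - (x + y) = (of_real (norm x) - x) + (of_real (norm y) - y)"
    by simp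
  also have "norm \<dots> \<le> norm x + norm y"
    using assms by (intro norm_triangle_mono) (auto simp: nonneg_def)
  finally show "norm (of_real (norm x + norm y) - (x + y)) \<le> norm x + norm y" .
qed (use assms in \<open>auto simp: nonneg_def star_add\<close>)

lemma nonneg_sum: "(\<And>i. i \<in> I \<Longrightarrow> nonneg (f i)) \<Longrightarrow> nonneg (\<Sum>i\<in>I. f i)"
  by (induction I rule: infinite_finite_induct) (auto intro: nonneg_add)

lemma nonneg_scaleR:
  assumes "nonneg x" "0 \<le> r"
  shows "nonneg (r *\<^sub>R x)"
proof (rule nonnegI[where t = "r * norm x"])
  have "of_real (r * norm x) - r *\<^sub>R x = r *\<^sub>R (of_real (norm x) - x)"
    by (simp add: algebra_simps of_real_def)
  then show "norm (of_real (r * norm x) - r *\<^sub>R x) \<le> r * norm x"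
    using assms by (simp add: nonneg_def mult_left_mono del: of_real_mult)
qed (use assms in \<open>auto simp: nonneg_def star_scaleR\<close>)

lemma nonneg_norm_minus: "star x = x \<Longrightarrow> norm x \<le> r \<Longrightarrow> nonneg (of_real r - x)"
  by (rule nonnegI[where t = r]) (auto simp: star_diff)

lemma nonneg_norm_plus: "star x = x \<Longrightarrow> norm x \<le> r \<Longrightarrow> nonneg (of_real r + x)"
  using nonneg_norm_minus[of "- x" r] by (simp add: star_minus)

lemma nonneg_interval:
  assumes "nonneg x" "nonneg (of_real s - x)" "0 \<le> s"
  shows "norm (x - of_real (s/2)) \<le> s/2"
  using ball_interval[of x "norm x" "norm (of_real s - x)" s] assms by (auto simp: nonneg_def)

lemma nonneg_norm_le:
  assumes "nonneg x" "nonneg (of_real s - x)" "0 \<le> s"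
  shows "norm x \<le> s"
  using nonneg_interval[OF assms] norm_triangle_sub[of x "of_real (s/2)"] assms(3)
  by (simp del: of_real_divide)

text \<open>Since \<open>y\<close> is dominated by the scalar \<open>norm y\<close>, so is
  \<open>x\<close>.\<close>

lemma nonneg_norm_mono:
  assumes "nonneg x" "nonneg (y - x)"
  shows "norm x \<le> norm y"
proof (rule nonneg_norm_le[OF assms(1)])
  have "nonneg y" using nonneg_add[OF assms] by simp
  then show "nonneg (of_real (norm y) - x)"
    using nonneg_add[OF nonneg_norm_minus[of y "norm y"] assms(2)] by (simp add: nonneg_sa)
qed simp

lemma nonneg_limit:
  assumes "X \<longlonglongrightarrow> x" and nn: "\<And>n. nonneg (X n)"
  shows "nonneg x"
proof -
  have "(\<lambda>n. star (X n)) \<longlonglongrightarrow> star x"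
    by (rule bounded_linear.tendsto[OF bounded_linear_star assms(1)])
  then have "star x = x"
    using assms(1) nn LIMSEQ_unique by (simp add: nonneg_sa)
  moreover have "norm (of_real (norm x) - x) \<le> norm x"
    by (rule LIMSEQ_le[of "\<lambda>n. norm (of_real (norm (X n)) - X n)" _ "\<lambda>n. norm (X n)"])
      (auto intro!: tendsto_intros assms(1) simp: nn[unfolded nonneg_def])
  ultimately show ?thesis by (simp add: nonneg_def)
qed

text \<open>The perturbation may point along any \<open>y\<close>, not only along 1: congruences
  turn \<open>e *\<^sub>R 1\<close> into a multiple of \<open>star c * c\<close>, and a left action
  turns it into a multiple of a term with \<open>lact G 1\<close>.\<close>

lemma nonneg_eps:
  assumes "\<And>e. e > 0 \<Longrightarrow> nonneg (x + e *\<^sub>R y)"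
  shows "nonneg x"
proof (rule nonneg_limit)
  have "(\<lambda>n. x + (1 / real (Suc n)) *\<^sub>R y) \<longlonglongrightarrow> x + 0 *\<^sub>R y"
    by (intro tendsto_intros) (use LIMSEQ_Suc[OF lim_1_over_n] in simp)
  then show "(\<lambda>n. x + (1 / real (Suc n)) *\<^sub>R y) \<longlonglongrightarrow> x" by simp
qed (use assms in auto)

text \<open>The root is taken of \<open>x + e\<close> because the series needs a strict inequality;
  \<open>nonneg_eps\<close> removes the shift afterwards.\<close>

lemma nonneg_sqrt:
  assumes "nonneg x" "e > 0"
  obtains b where "star b = b" "b * b = x + e *\<^sub>R 1" "\<And>y. y * x = x * y \<Longrightarrow> y * b = b * y"
proof -
  have "of_real (norm x + e) - (x + e *\<^sub>R 1) = of_real (norm x) - x"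
    by (simp add: of_real_def algebra_simps)
  then have "norm (of_real (norm x + e) - (x + e *\<^sub>R 1)) \<le> norm x"
    using assms(1) by (simp only: nonneg_def)
  then have "norm (of_real (norm x + e) - (x + e *\<^sub>R 1)) < norm x + e"
    using assms(2) by linarith
  moreover have "star (x + e *\<^sub>R 1) = x + e *\<^sub>R 1"
    using assms by (simp add: star_add star_scaleR nonneg_sa)
  ultimately obtain b where b: "star b = b" "b * b = x + e *\<^sub>R 1"
      "\<And>y. y * (x + e *\<^sub>R 1) = (x + e *\<^sub>R 1) * y \<Longrightarrow> y * b = b * y"
    using sqrt_ball by metis
  show thesis by (rule that[OF b(1,2)]) (rule b(3), simp add: algebra_simps)
qed

text \<open>Neumann series: after division by \<open>t = norm x + e\<close> the element
  \<open>x + e\<close> differs from 1 by at most \<open>norm x / t\<close>, which is below 1. This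
  supplies the inverse in the Schur complement of \<open>kernel_nonneg\<close>.\<close>

lemma nonneg_inverse:
  assumes "nonneg (x::'a::cstar_algebra)" "e > 0"
  obtains r where "star r = r" "(x + e *\<^sub>R 1) * r = 1"
proof -
  define t where "t = norm x + e"
  have t: "t > 0" using assms(2) by (simp add: t_def add_nonneg_pos)
  define a where "a = 1 - (1/t) *\<^sub>R (x + e *\<^sub>R 1)"
  have "t *\<^sub>R a = of_real (norm x) - x"
    using t by (simp add: a_def scaleR_right_diff_distrib)
      (simp add: t_def of_real_def algebra_simps)
  then have "t * norm a \<le> norm x"
    using assms(1) t unfolding nonneg_def by (metis norm_scaleR abs_of_pos)
  then have "t * norm a < t * 1" using assms(2) by (simp add: t_def)
  then have "norm a < 1" using t by (simp only: mult_less_cancel_left_pos)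
  then have "summable (\<lambda>n. norm a ^ n)" by (simp add: summable_geometric)
  then have sn: "summable (\<lambda>n. norm (a ^ n))"
    by (rule summable_comparison_test[rotated]) (auto simp: norm_power_ineq)
  then have s: "summable (\<lambda>n. a ^ n)" by (rule summable_norm_cancel)
  have "a * (\<Sum>n. a ^ n) = (\<Sum>n. a ^ Suc n)" by (simp add: suminf_mult[OF s])
  also have "\<dots> = (\<Sum>n. a ^ n) - 1" using suminf_split_head[OF s] by simp
  finally have "(1 - a) * (\<Sum>n. a ^ n) = 1" by (simp add: algebra_simps)
  then have r: "(x + e *\<^sub>R 1) * ((1/t) *\<^sub>R (\<Sum>n. a ^ n)) = 1" by (simp add: a_def)
  define r where "r = (1/t) *\<^sub>R (\<Sum>n. a ^ n)"
  have sx: "star (x + e *\<^sub>R 1) = x + e *\<^sub>R 1"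
    using assms by (simp add: star_add star_scaleR nonneg_sa)
  have r: "(x + e *\<^sub>R 1) * r = 1" using r by (simp add: r_def)
  then have "star r * (x + e *\<^sub>R 1) = 1" using star_mult[of "x + e *\<^sub>R 1" r] sx by simp
  then have "star r = r" by (metis mult.assoc mult_1 mult.right_neutral r)
  with r that show thesis by blast
qed

text \<open>After scaling to \<open>norm v < 1\<close> there is a root \<open>d\<close> of
  \<open>1 - v * v\<close> commuting with \<open>v\<close>. From \<open>d * d + v * v = 1\<close>
  follows \<open>norm d \<le> 1\<close>, so \<open>1 - v * v\<close> has norm at most 1, which is
  the ball condition for \<open>v * v\<close>.\<close>

lemma nonneg_square:
  fixes a :: "'a::cstar_algebra"
  assumes a: "star a = a"
  shows "nonneg (a * a)"
proof -
  define r where "r = norm a + 1"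
  have r: "r > 0" "norm a < r" by (auto simp: r_def add_nonneg_pos)
  define v where "v = (1/r) *\<^sub>R a"
  have v: "star v = v" by (simp add: v_def star_scaleR a)
  have "norm v < 1" using r by (simp add: v_def field_simps)
  then have "norm (v * v) < 1" by (simp add: norm_sa_square[OF v] power_less_one_iff abs_square_less_1)
  moreover have "star (v * v) = v * v" by (simp add: star_mult v)
  ultimately obtain d where d: "star d = d" "d * d = 1 - v * v"
    "\<And>y. y * (v * v) = v * v * y \<Longrightarrow> y * d = d * y"
    using sqrt_one_minus by blast
  have "v * d = d * v" by (rule d(3)) (simp add: mult.assoc)
  then have "norm d \<le> \<bar>1\<bar>"
    by (intro norm_sa_le_if_squares[where v = v]) (auto simp: d v)
  then have "norm (1 - v * v) \<le> 1"
    using norm_sa_square[OF d(1)] d(2) by (simp add: power_le_one)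
  then have "norm (r\<^sup>2 *\<^sub>R (1 - v * v)) \<le> r\<^sup>2" by (simp add: mult_left_le)
  moreover have "r\<^sup>2 *\<^sub>R (1 - v * v) = of_real (r\<^sup>2) - a * a"
    using r by (simp add: v_def algebra_simps of_real_def power2_eq_square)
  ultimately show ?thesis
    using nonnegI[of "a * a" "r\<^sup>2"] by (simp add: star_mult a)
qed

text \<open>For commuting self-adjoint \<open>y\<close> the congruence is, up to \<open>e\<close>,
  the square of the self-adjoint \<open>y * b\<close>. The general congruence rests on
  \<open>nonneg_star_mult_self\<close>, whose proof needs this special case.\<close>

lemma nonneg_congruence_commute:
  fixes x y :: "'a::cstar_algebra"
  assumes x: "nonneg x" and y: "star y = y" "y * x = x * y"
  shows "nonneg (y * x * y)"
proof (rule nonneg_eps)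
  fix e :: real assume "e > 0"
  then obtain b where b: "star b = b" "b * b = x + e *\<^sub>R 1" "y * b = b * y"
    using nonneg_sqrt[OF x] y(2) by metis
  have "nonneg ((y * b) * (y * b))" by (rule nonneg_square) (simp add: star_mult b y)
  also have "(y * b) * (y * b) = y * (b * b) * y" by (metis b(3) mult.assoc)
  finally show "nonneg (y * x * y + e *\<^sub>R (y * y))" by (simp add: b algebra_simps)
qed

lemma nonneg_power:
  fixes y :: "'a::cstar_algebra"
  assumes "nonneg y"
  shows "nonneg (y ^ n)"
proof -
  have sy: "star (y ^ k) = y ^ k" for k using assms by (simp add: star_power nonneg_sa)
  obtain k where "n = 2 * k \<or> n = 2 * k + 1" by (metis evenE oddE)
  then show ?thesis
  proof
    assume "n = 2 * k"
    then have "y ^ n = y ^ k * y ^ k" by (simp add: mult_2 power_add)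
    then show ?thesis using nonneg_square[OF sy] by simp
  next
    assume "n = 2 * k + 1"
    then have "y ^ n = y ^ k * y * y ^ k"
      by (simp add: mult_2 power_add mult.assoc power_commutes)
    then show ?thesis using nonneg_congruence_commute[OF assms sy] by (simp add: power_commutes)
  qed
qed

text \<open>The spectra of \<open>d\<^sup>* d\<close> and \<open>d d\<^sup>*\<close> agree up to \<open>0\<close>; the proof uses only the polynomial identity
  \<open>f (d d\<^sup>*) d d\<^sup>* = d f (d\<^sup>* d) d\<^sup>*\<close> for a linear \<open>f\<close>.\<close>

lemma norm_le_one_if_bounds:
  fixes d :: "'a::cstar_algebra"
  assumes q: "nonneg (1 + d * star d)" and r: "nonneg (1 - star d * d)"
  shows "norm (star d * d) \<le> 1"
proof (rule ccontr)
  define r q where "r = star d * d" and "q = d * star d"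
  define N where "N = norm r"
  \<comment> \<open>\<open>-\<kappa>\<close> is the midpoint of \<open>[-N, 1]\<close>, an interval
    containing \<open>r\<close>; hence \<open>r + \<kappa>\<close> has norm at most half its length,
    \<open>(N + 1)/2\<close>.\<close>
  define \<kappa> where "\<kappa> = (N - 1) / 2"
  define z where "z = q + of_real \<kappa>"
  assume "\<not> norm (star d * d) \<le> 1"
  then have N: "N > 1" by (simp add: N_def r_def)
  then have \<kappa>: "\<kappa> > 0" by (simp add: \<kappa>_def)
  have dN: "(norm d)\<^sup>2 = N" by (simp add: N_def r_def cstar_identity)
  have qN: "norm q = N" using cstar_identity[of "star d"] dN by (simp add: q_def star_star)
  have sr: "star r = r" and sq: "star q = q" by (auto simp: r_def q_def star_mult star_star)
  have sz: "star z = z" by (simp add: z_def star_add sq)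
  have "nonneg (of_real (N + 1) - (1 - r))"
    using nonneg_norm_plus[OF sr, of N] by (simp add: N_def)
  then have "norm (1 - r - of_real ((N + 1)/2)) \<le> (N + 1)/2"
    using nonneg_interval[of "1 - r" "N + 1"] assms(2) N by (simp add: r_def)
  moreover have "(N + 1)/2 = 1 + \<kappa>" by (simp add: \<kappa>_def field_simps)
  then have "1 - r - of_real ((N + 1)/2) = - (r + of_real \<kappa>)"
    by (simp only: of_real_add of_real_1) simp
  ultimately have rb: "norm (r + of_real \<kappa>) \<le> (N + 1)/2" by (metis norm_minus_cancel)
  have "z * q = d * (r + of_real \<kappa>) * star d"
    by (simp add: z_def q_def r_def algebra_simps of_real_def)
  then have "norm (z * q) \<le> norm d * norm (r + of_real \<kappa>) * norm d"
    by (metis norm_mult_ineq norm_star mult_right_mono norm_ge_zero order_trans)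
  also have "\<dots> = N * norm (r + of_real \<kappa>)" using dN by (simp add: power2_eq_square)
  also have "\<dots> \<le> N * ((N + 1)/2)" using rb N by simp
  finally have zq: "norm (z * q) \<le> N * ((N + 1)/2)" .
  \<comment> \<open>As \<open>q\<close> is bounded below by -1 while its norm \<open>N\<close>
    exceeds 1, the norm is reached on the positive side, and the shift by \<kappa> adds to it.
    Otherwise \<open>q\<close> would lie between -1 and some \<open>N' < N\<close>, contradicting
    \<open>norm q = N\<close>.\<close>
  have zN: "norm z \<ge> N + \<kappa>"
  proof (rule ccontr)
    assume *: "\<not> norm z \<ge> N + \<kappa>"
    define N' where "N' = max 1 (norm z - \<kappa>)"
    have N': "N' < N" "1 \<le> N'" using * N by (auto simp: N'_def)
    have "nonneg ((of_real (norm z) - z) + of_real (N' + \<kappa> - norm z))"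
      by (intro nonneg_add nonneg_norm_minus[OF sz] nonneg_of_real) (auto simp: N'_def)
    then have "nonneg (of_real (N' + 1) - (1 + q))" by (simp add: z_def)
    then have "norm (1 + q - of_real ((N' + 1)/2)) \<le> (N' + 1)/2"
      using nonneg_interval[of "1 + q" "N' + 1"] q N' by (simp add: q_def)
    moreover have "(N' + 1)/2 = 1 + (N' - 1)/2" by (simp add: field_simps)
    then have "q = (1 + q - of_real ((N' + 1)/2)) + of_real ((N' - 1)/2)"
      by (simp only: of_real_add of_real_1) simp
    then have "norm q \<le> norm (1 + q - of_real ((N' + 1)/2)) + norm (of_real ((N' - 1)/2) :: 'a)"
      by (metis norm_triangle_ineq)
    then have "norm q \<le> norm (1 + q - of_real ((N' + 1)/2)) + \<bar>(N' - 1)/2\<bar>"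
      by (simp only: norm_of_real)
    ultimately have "norm q \<le> N'" using N' by (simp add: abs_if field_simps del: of_real_divide of_real_add)
    with N' qN show False by simp
  qed
  have "z * q = z * z - \<kappa> *\<^sub>R z" by (simp add: z_def algebra_simps of_real_def)
  then have "norm (z * q) \<ge> norm z * norm z - \<kappa> * norm z"
    using norm_triangle_ineq2[of "z * z" "\<kappa> *\<^sub>R z"] norm_sa_square[OF sz] \<kappa>
    by (simp add: power2_eq_square)
  moreover have "norm z * (norm z - \<kappa>) \<ge> (N + \<kappa>) * N"
    using zN N \<kappa> by (intro mult_mono) auto
  ultimately have "(N + \<kappa>) * N \<le> N * ((N + 1)/2)" using zq by (simp add: algebra_simps)
  then have "N * (N + \<kappa>) \<le> N * ((N + 1)/2)" by (simp only: mult.commute)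
  then have "N + \<kappa> \<le> (N + 1)/2" using N by (subst (asm) mult_le_cancel_left_pos) auto
  with N show False by (simp add: \<kappa>_def field_simps)
qed

text \<open>If \<open>a = star c * c\<close> were not nonnegative, \<open>y = 1 - a\<close> would
  have norm \<open>M > 1\<close>, and multiplying \<open>c\<close> by powers of \<open>y\<close>
  would amplify the negative part. Yet every \<open>d = c * y ^ n\<close> satisfies the two bounds
  of \<open>norm_le_one_if_bounds\<close>, so \<open>y ^ (2 * n) * (y - 1)\<close> stays in the unit
  ball, while its norm is at least \<open>M ^ (2 * n) * (M - 1)\<close>.\<close>

lemma nonneg_star_mult_self_aux:
  fixes c :: "'a::cstar_algebra"
  assumes c: "norm c \<le> 1"
  shows "nonneg (star c * c)"
proof (rule ccontr)
  define a y M where "a = star c * c" and "y = 1 - a" and "M = norm y"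
  have sa: "star a = a" by (simp add: a_def star_mult star_star)
  then have sy: "star y = y" by (simp add: y_def star_diff)
  have na: "norm a \<le> 1" using c by (simp add: a_def cstar_identity power_le_one)
  assume "\<not> nonneg (star c * c)"
  then have M: "M > 1" using nonnegI[of a 1] sa
    by (metis M_def a_def not_le of_real_1 y_def)
  have y: "nonneg y" by (rule nonnegI[of _ 1]) (use sy na in \<open>auto simp: y_def\<close>)
  have "M ^ (2 * n) * (M - 1) \<le> 1" for n
  proof -
    define d where "d = c * y ^ n"
    define p where "p = y ^ (2 * n) * (y - 1)"
    have "star d * d = y ^ n * a * y ^ n"
      by (simp add: d_def star_mult star_power sy a_def mult.assoc)
    also have "\<dots> = y ^ n * y ^ n * a" 
    proof -
      have "y * a = a * y" by (simp add: y_def algebra_simps)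
      then show ?thesis by (metis mult.assoc power_commuting_commutes)
    qed
    also have "\<dots> = - p" proof -
      have "y - 1 = - a" by (simp add: y_def)
      then show ?thesis by (simp only: p_def mult_2 power_add mult_minus_right minus_minus)
    qed
    finally have dd: "star d * d = - p" .
    \<comment> \<open>Each summand is a congruence of a power of \<open>y\<close> by the commuting
      element \<open>y - 1\<close>. The geometric sum makes the total equal to \<open>1 + p\<close>,
      which bounds \<open>star d * d = - p\<close> above by 1.\<close>
    have "nonneg (y + (\<Sum>j<2*n. (y - 1) * y ^ j * (y - 1)))"
      by (intro nonneg_add nonneg_sum y nonneg_congruence_commute nonneg_power)
        (auto simp: star_diff sy algebra_simps power_commutes)
    also have "y + (\<Sum>j<2*n. (y - 1) * y ^ j * (y - 1)) = y + (y - 1) * (\<Sum>j<2*n. y ^ j) * (y - 1)"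
      by (simp add: sum_distrib_left sum_distrib_right)
    also have "(y - 1) * (\<Sum>j<2*n. y ^ j) = y ^ (2*n) - 1"
    proof (induction n)
      case (Suc n)
      then show ?case by (simp add: algebra_simps)
    qed simp
    also have "y + (y ^ (2*n) - 1) * (y - 1) = 1 + p" by (simp add: p_def algebra_simps)
    finally have p: "nonneg (1 + p)" .
    \<comment> \<open>Twice the real and, up to sign, the imaginary part of \<open>d\<close>. Half
      the sum of their squares is \<open>star d * d + d * star d\<close>, so
      \<open>d * star d\<close> is at least \<open>p\<close>, hence at least -1.\<close>
    define u v where "u = d + star d" and "v = \<i> *\<^sub>C (d - star d)"
    have "star u = u" "star v = v"
      by (auto simp: u_def v_def star_add star_scaleC star_diff star_star scaleC_diff_right
          scaleC_minus_left add.commute)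
    then have "nonneg ((1/2) *\<^sub>R (u * u + v * v))"
      by (intro nonneg_scaleR nonneg_add nonneg_square) auto
    also have "u * u + v * v = 2 *\<^sub>R (star d * d + d * star d)"
      by (simp add: u_def v_def scaleC_mult_left scaleC_mult_right scaleC_scaleC scaleC_minus1_left
          scaleC_diff_right algebra_simps scaleR_2)
    finally have "nonneg (star d * d + d * star d)" by simp
    from nonneg_add[OF this p] have "nonneg (1 + d * star d)" by (simp add: dd add.commute)
    then have "norm (star d * d) \<le> 1"
      by (rule norm_le_one_if_bounds) (use p dd in simp)
    then have "norm (y ^ Suc (2 * n) - y ^ (2 * n)) \<le> 1"
      by (simp add: dd p_def algebra_simps power_commutes norm_minus_commute)
    moreover have "norm (y ^ Suc (2*n)) - norm (y ^ (2*n)) \<le> norm (y ^ Suc (2 * n) - y ^ (2 * n))"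
      by (rule norm_triangle_ineq2)
    ultimately have "norm (y ^ Suc (2*n)) - norm (y ^ (2*n)) \<le> 1" by linarith
    then show ?thesis by (simp only: norm_sa_power[OF sy]) (simp add: M_def algebra_simps)
  qed
  moreover obtain n where "1 / (M - 1) < M ^ n" using real_arch_pow[OF M] by blast
  moreover have "M ^ n \<le> M ^ (2 * n)" using M by (intro power_increasing) auto
  ultimately show False using M by (smt (verit, best) divide_less_eq)
qed

theorem nonneg_star_mult_self: "nonneg (star c * (c::'a::cstar_algebra))"
proof (cases "c = 0")
  case False
  define d where "d = (1 / norm c) *\<^sub>R c"
  have "nonneg (star d * d)" by (rule nonneg_star_mult_self_aux) (use False in \<open>simp add: d_def\<close>)
  then have "nonneg ((norm c)\<^sup>2 *\<^sub>R (star d * d))" by (rule nonneg_scaleR) simp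
  then show ?thesis using False by (simp add: d_def star_scaleR power2_eq_square)
qed simp

lemma nonneg_if_positive: "positive x \<Longrightarrow> nonneg x"
  by (auto simp: positive_def nonneg_star_mult_self)

lemma nonneg_congruence:
  fixes x :: "'a::cstar_algebra"
  assumes "nonneg x"
  shows "nonneg (star c * x * c)"
proof (rule nonneg_eps)
  fix e :: real assume "e > 0"
  then obtain b where b: "star b = b" "b * b = x + e *\<^sub>R 1"
    using nonneg_sqrt[OF assms] by metis
  have "star (b * c) * (b * c) = star c * (b * b) * c" by (simp add: star_mult b(1) mult.assoc)
  also have "\<dots> = star c * x * c + e *\<^sub>R (star c * c)" by (simp add: b algebra_simps)
  finally show "nonneg (star c * x * c + e *\<^sub>R (star c * c))"
    using nonneg_star_mult_self[of "b * c"] by simp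
qed

subsection \<open>Hilbert spaces\<close>

lemma cinner_add_left: "cinner (x + y) z = cinner x z + cinner (y::'h::complex_hilbert) z"
  by (metis cinner_add_right cinner_commute complex_cnj_add)

lemma cinner_scaleC_left: "cinner (c *\<^sub>C x) (y::'h::complex_hilbert) = cnj c * cinner x y"
  by (metis cinner_commute cinner_scaleC_right complex_cnj_mult)

lemma cinner_zero_right [simp]: "cinner (x::'h::complex_hilbert) 0 = 0"
  using cinner_scaleC_right[of x 0 0] by simp

lemma cinner_zero_left [simp]: "cinner 0 (x::'h::complex_hilbert) = 0"
  using cinner_scaleC_left[of 0 0 x] by simp

lemma cinner_minus_right: "cinner x (- y) = - cinner x (y::'h::complex_hilbert)"
  using cinner_scaleC_right[of x "-1" y] by (simp add: scaleC_minus1_left)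

lemma cinner_minus_left: "cinner (- x) y = - cinner x (y::'h::complex_hilbert)"
  using cinner_scaleC_left[of "-1" x y] by (simp add: scaleC_minus1_left)

lemma cinner_diff_right: "cinner x (y - z) = cinner x y - cinner x (z::'h::complex_hilbert)"
  using cinner_add_right[of x y "- z"] by (simp add: cinner_minus_right)

lemma cinner_diff_left: "cinner (x - y) z = cinner x z - cinner y (z::'h::complex_hilbert)"
  using cinner_add_left[of x "- y" z] by (simp add: cinner_minus_left)

lemmas cinner_simps = cinner_add_left cinner_add_right cinner_diff_left cinner_diff_right
  cinner_minus_left cinner_minus_right cinner_scaleC_left cinner_scaleC_right

lemma cinner_self_eq_0 [simp]: "cinner x x = 0 \<longleftrightarrow> x = (0::'h::complex_hilbert)"
  by (simp add: cinner_same)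

lemma norm_square_eq: "(norm (x::'h::complex_hilbert))\<^sup>2 = Re (cinner x x)"
  by (simp add: cinner_same)

lemma norm_scaleC_hilbert: "norm (c *\<^sub>C (x::'h::complex_hilbert)) = cmod c * norm x"
proof -
  have "(norm (c *\<^sub>C x))\<^sup>2 = Re (cnj c * c * cinner x x)"
    by (simp add: norm_square_eq cinner_simps mult.assoc mult.left_commute)
  also have "cnj c * c * cinner x x = of_real ((cmod c * norm x)\<^sup>2)"
    using complex_norm_square[of c] by (simp add: cinner_same power_mult_distrib mult.commute)
  finally show ?thesis by (simp add: power2_eq_iff_nonneg)
qed

lemma norm_diff_square:
  "(norm (x - y))\<^sup>2 = (norm x)\<^sup>2 - 2 * Re (cinner x y) + (norm (y::'h::complex_hilbert))\<^sup>2"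
proof -
  have "Re (cinner y x) = Re (cinner x y)" by (metis cinner_commute complex_cnj_cnj cnj.sel(1))
  then show ?thesis by (simp add: norm_square_eq cinner_simps)
qed

lemma norm_add_square_orthogonal:
  "cinner x y = 0 \<Longrightarrow> (norm (x + y))\<^sup>2 = (norm x)\<^sup>2 + (norm (y::'h::complex_hilbert))\<^sup>2"
  using norm_diff_square[of x "- y"] by (simp add: cinner_simps)

lemma norm_cinner_le: "cmod (cinner x y) \<le> norm x * norm (y::'h::complex_hilbert)"
proof (cases "y = 0")
  case False
  define a where "a = cnj (cinner x y) / (norm y)\<^sup>2"
  have yx: "cinner y x = cnj (cinner x y)" by (metis cinner_commute)
  have ax: "cinner x (a *\<^sub>C y) = of_real ((cmod (cinner x y))\<^sup>2 / (norm y)\<^sup>2)"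
    unfolding cinner_scaleC_right a_def using complex_norm_square[of "cinner x y"]
    by (simp add: mult.commute)
  have "0 \<le> (norm (x - a *\<^sub>C y))\<^sup>2" by simp
  also have "\<dots> = (norm x)\<^sup>2 - 2 * ((cmod (cinner x y))\<^sup>2 / (norm y)\<^sup>2) + (cmod a)\<^sup>2 * (norm y)\<^sup>2"
    by (simp only: norm_diff_square ax norm_scaleC_hilbert Re_complex_of_real power_mult_distrib)
  also have "(cmod a)\<^sup>2 * (norm y)\<^sup>2 = (cmod (cinner x y))\<^sup>2 / (norm y)\<^sup>2"
    proof -
    have "cmod a = cmod (cinner x y) / (norm y)\<^sup>2" by (simp add: a_def norm_divide norm_power)
    then show ?thesis using False by (simp add: power_divide field_simps power2_eq_square)
  qed
  finally have "(cmod (cinner x y))\<^sup>2 \<le> (norm x * norm y)\<^sup>2"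
    using False by (simp add: field_simps power_mult_distrib)
  then show ?thesis by (rule power2_le_imp_le) simp
qed simp

lemma bounded_bilinear_cinner: "bounded_bilinear (cinner :: 'h::complex_hilbert \<Rightarrow> 'h \<Rightarrow> complex)"
proof
  show "\<exists>K. \<forall>a b::'h. norm (cinner a b) \<le> norm a * norm b * K"
    using norm_cinner_le by (intro exI[of _ 1]) auto
qed (auto simp: cinner_simps scaleR_scaleC scaleC_complex_def)

lemmas tendsto_cinner = bounded_bilinear.tendsto[OF bounded_bilinear_cinner]

lemma bounded_linear_scaleC: "bounded_linear (\<lambda>x::'h::complex_hilbert. c *\<^sub>C x)"
  by (rule bounded_linear_intro[of _ "cmod c"])
    (auto simp: scaleC_add_right scaleC_scaleR norm_scaleC_hilbert mult.commute)

lemmas tendsto_scaleC = bounded_linear.tendsto[OF bounded_linear_scaleC]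

lemma csubspaceI:
  assumes "0 \<in> V" "\<And>x y. x \<in> V \<Longrightarrow> y \<in> V \<Longrightarrow> x + y \<in> V" "\<And>c x. x \<in> V \<Longrightarrow> c *\<^sub>C x \<in> V"
  shows "csubspace V"
  using assms by (auto simp: csubspace_def)

lemma csubspaceD:
  assumes "csubspace V"
  shows "0 \<in> V" "x \<in> V \<Longrightarrow> y \<in> V \<Longrightarrow> x + y \<in> V" "x \<in> V \<Longrightarrow> c *\<^sub>C x \<in> V"
    "x \<in> V \<Longrightarrow> y \<in> V \<Longrightarrow> x - y \<in> V" "x \<in> V \<Longrightarrow> - x \<in> V"
proof -
  show 1: "0 \<in> V" "x \<in> V \<Longrightarrow> y \<in> V \<Longrightarrow> x + y \<in> V" "x \<in> V \<Longrightarrow> c *\<^sub>C x \<in> V" for x y c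
    using assms by (auto simp: csubspace_def)
  show "x \<in> V \<Longrightarrow> - x \<in> V" for x
    using 1(3)[of x "-1"] by (simp add: scaleC_minus1_left)
  then show "x \<in> V \<Longrightarrow> y \<in> V \<Longrightarrow> x - y \<in> V"
    using 1(2)[of x "- y"] by simp
qed

lemma csubspace_hull: "csubspace (csubspace hull X)"
  by (rule hull_in) (auto simp: csubspace_def)

lemma closed_csubspaceD:
  assumes "closed_csubspace V"
  shows "closed V" "csubspace V" "0 \<in> V" "x \<in> V \<Longrightarrow> y \<in> V \<Longrightarrow> x + y \<in> V" "x \<in> V \<Longrightarrow> c *\<^sub>C x \<in> V"
    "x \<in> V \<Longrightarrow> y \<in> V \<Longrightarrow> x - y \<in> V" "x \<in> V \<Longrightarrow> - x \<in> V"
  using assms csubspaceD[of V] by (auto simp: closed_csubspace_def)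

lemma closed_csubspace_limit:
  "closed_csubspace V \<Longrightarrow> X \<longlonglongrightarrow> x \<Longrightarrow> (\<And>n. X n \<in> V) \<Longrightarrow> x \<in> V"
  using closed_sequentially closed_csubspaceD(1) by blast

lemma closed_csubspace_UNIV [simp]: "closed_csubspace UNIV"
  by (simp add: closed_csubspace_def csubspace_def)

lemma closed_csubspace_Int: "closed_csubspace V \<Longrightarrow> closed_csubspace W \<Longrightarrow> closed_csubspace (V \<inter> W)"
  by (auto simp: closed_csubspace_def csubspace_def)

lemma closed_csubspace_closure:
  assumes "csubspace V"
  shows "closed_csubspace (closure V)"
  unfolding closed_csubspace_def csubspace_def
proof (intro conjI ballI allI)
  show "0 \<in> closure V" using csubspaceD(1)[OF assms] closure_subset by blast
  show "x + y \<in> closure V" if xy: "x \<in> closure V" "y \<in> closure V" for x y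
  proof -
    obtain f g where "\<And>n. f n \<in> V" "f \<longlonglongrightarrow> x" "\<And>n. g n \<in> V" "g \<longlonglongrightarrow> y"
      using xy unfolding closure_sequential by blast
    then have "(\<lambda>n. f n + g n) \<longlonglongrightarrow> x + y" "\<And>n. f n + g n \<in> V"
      by (auto intro: tendsto_add csubspaceD(2)[OF assms])
    then show ?thesis unfolding closure_sequential by (intro exI conjI allI)
  qed
  show "c *\<^sub>C x \<in> closure V" if xy: "x \<in> closure V" for c x
  proof -
    obtain f where "\<And>n. f n \<in> V" "f \<longlonglongrightarrow> x"
      using xy unfolding closure_sequential by blast
    then have "(\<lambda>n. c *\<^sub>C f n) \<longlonglongrightarrow> c *\<^sub>C x" "\<And>n. c *\<^sub>C f n \<in> V"
      by (auto intro: tendsto_scaleC csubspaceD(3)[OF assms])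
    then show ?thesis unfolding closure_sequential by (intro exI conjI allI)
  qed
qed simp

lemma closed_csubspace_closed_span: "closed_csubspace (closed_span X)"
  unfolding closed_span_def
  by (rule hull_in) (auto simp: closed_csubspace_def csubspace_def)

lemma closed_span_superset: "X \<subseteq> closed_span X"
  unfolding closed_span_def by (rule hull_subset)

lemma closed_span_minimal: "X \<subseteq> V \<Longrightarrow> closed_csubspace V \<Longrightarrow> closed_span X \<subseteq> V"
  unfolding closed_span_def by (rule hull_minimal)

lemma closed_span_mono: "X \<subseteq> Y \<Longrightarrow> closed_span X \<subseteq> closed_span Y"
  unfolding closed_span_def by (rule hull_mono)

section \<open>Orthogonal complements and projections\<close>

lemma closed_csubspace_orth_compl: "closed_csubspace (orth_compl V)"
proof -
  have "closed (orth_compl V)"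
    unfolding closed_sequential_limits orth_compl_def
  proof safe
    fix X x v assume X: "\<forall>n. X n \<in> {x. \<forall>v\<in>V. cinner v x = 0}" "X \<longlonglongrightarrow> x" "v \<in> V"
    have "(\<lambda>n. cinner v (X n)) \<longlonglongrightarrow> cinner v x" by (intro tendsto_cinner tendsto_const X)
    then show "cinner v x = 0" using X by (simp add: LIMSEQ_const_iff)
  qed
  then show ?thesis
    by (auto simp: closed_csubspace_def csubspace_def orth_compl_def cinner_simps)
qed

lemma orth_complD: "x \<in> orth_compl V \<Longrightarrow> v \<in> V \<Longrightarrow> cinner v x = 0 \<and> cinner x v = 0"
  unfolding orth_compl_def by (metis (mono_tags, lifting) cinner_commute complex_cnj_zero mem_Collect_eq)

lemma orth_compl_singleton: "y \<in> orth_compl {x} \<longleftrightarrow> cinner x y = 0"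
  by (simp add: orth_compl_def)

lemma orth_compl_orth_compl_superset: "V \<subseteq> orth_compl (orth_compl V)"
  by (auto simp: orth_compl_def[of "orth_compl V"] dest: orth_complD)

lemma orth_compl_closed_span: "orth_compl (closed_span X) = orth_compl X"
proof
  show "orth_compl (closed_span X) \<subseteq> orth_compl X"
    using closed_span_superset by (auto simp: orth_compl_def)
  show "orth_compl X \<subseteq> orth_compl (closed_span X)"
  proof
    fix x assume "x \<in> orth_compl X"
    then have "X \<subseteq> orth_compl {x}" by (auto simp: orth_compl_singleton dest: orth_complD)
    then have "closed_span X \<subseteq> orth_compl {x}"
      by (rule closed_span_minimal[OF _ closed_csubspace_orth_compl])
    then show "x \<in> orth_compl (closed_span X)"
      using orth_compl_orth_compl_superset[of "{x}"]
      by (auto simp: orth_compl_def[of "closed_span X"] dest: orth_complD)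
  qed
qed

text \<open>The parallelogram law makes a distance-minimising sequence Cauchy, since midpoints stay
  in \<open>V\<close>. At the minimiser, moving by the component of \<open>x - y\<close> along
  \<open>v\<close> cannot shorten the distance, so that component vanishes.\<close>

lemma proj_exists:
  fixes V :: "'h::complex_hilbert set"
  assumes V: "closed_csubspace V"
  shows "\<exists>y\<in>V. x - y \<in> orth_compl V"
proof -
  define d where "d = infdist x V"
  have ne: "V \<noteq> {}" using closed_csubspaceD(3)[OF V] by auto
  have d0: "d \<ge> 0" by (simp add: d_def infdist_nonneg)
  have le: "d \<le> norm (x - v)" if "v \<in> V" for v
    using infdist_le[OF that, of x] by (simp add: d_def dist_norm)
  have "\<exists>v\<in>V. norm (x - v) < d + 1 / real (Suc n)" for n
  proof -
    have "(INF a\<in>V. dist x a) < d + 1 / real (Suc n)"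
      by (simp add: d_def infdist_notempty[OF ne])
    then show ?thesis
      using ne by (subst (asm) cINF_less_iff) (auto simp: dist_norm intro!: bdd_belowI2[of _ 0])
  qed
  then obtain Y where YV: "\<And>n. Y n \<in> V" and Y: "\<And>n. norm (x - Y n) < d + 1 / real (Suc n)"
    by metis
  have lim: "(\<lambda>n. norm (x - Y n)) \<longlonglongrightarrow> d"
  proof (rule tendsto_sandwich[of "\<lambda>_. d" _ _ "\<lambda>n. d + 1 / real (Suc n)"])
    have "(\<lambda>n. d + 1 / real (Suc n)) \<longlonglongrightarrow> d + 0"
      by (intro tendsto_add tendsto_const) (use LIMSEQ_Suc[OF lim_1_over_n] in simp)
    then show "(\<lambda>n. d + 1 / real (Suc n)) \<longlonglongrightarrow> d" by simp
  qed (use le YV less_imp_le[OF Y] in \<open>auto intro!: always_eventually\<close>)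
  have par: "(norm (Y m - Y n))\<^sup>2 \<le> 2 * (norm (x - Y m))\<^sup>2 + 2 * (norm (x - Y n))\<^sup>2 - 4 * d\<^sup>2" for m n
  proof -
    define a b where "a = x - Y m" and "b = x - Y n"
    have "(norm (a - b))\<^sup>2 + (norm (a - (- b)))\<^sup>2 = 2 * (norm a)\<^sup>2 + 2 * (norm b)\<^sup>2"
      unfolding norm_diff_square by (simp add: cinner_simps)
    moreover have "a - b = - (Y m - Y n)" by (simp add: a_def b_def)
    then have "norm (a - b) = norm (Y m - Y n)" by (metis norm_minus_cancel)
    moreover have "a - (- b) = 2 *\<^sub>R (x - (1/2) *\<^sub>R (Y m + Y n))"
      by (simp add: a_def b_def algebra_simps scaleR_2)
    then have "norm (a - (- b)) = 2 * norm (x - (1/2) *\<^sub>R (Y m + Y n))" by simp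
    moreover have "(1/2) *\<^sub>R (Y m + Y n) \<in> V"
      unfolding scaleR_scaleC by (intro closed_csubspaceD[OF V] YV)
    then have "(norm (x - (1/2) *\<^sub>R (Y m + Y n)))\<^sup>2 \<ge> d\<^sup>2" using le d0 by (intro power_mono) auto
    ultimately show ?thesis by (simp add: a_def b_def power_mult_distrib)
  qed
  have "Cauchy Y"
  proof (rule CauchyI)
    fix e :: real assume e: "e > 0"
    have "(\<lambda>n. (norm (x - Y n))\<^sup>2) \<longlonglongrightarrow> d\<^sup>2" by (intro tendsto_intros lim)
    then obtain N where N: "\<And>n. n \<ge> N \<Longrightarrow> \<bar>(norm (x - Y n))\<^sup>2 - d\<^sup>2\<bar> < e\<^sup>2 / 4"
      using e by (metis LIMSEQ_D real_norm_def divide_pos_pos zero_less_numeral zero_less_power)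
    have "norm (Y m - Y n) < e" if "m \<ge> N" "n \<ge> N" for m n
    proof -
      have "(norm (Y m - Y n))\<^sup>2 < e\<^sup>2"
        using par[of m n] N[OF that(1)] N[OF that(2)] by linarith
      then show ?thesis using e by (simp add: power_less_imp_less_base)
    qed
    then show "\<exists>M. \<forall>m\<ge>M. \<forall>n\<ge>M. norm (Y m - Y n) < e" by blast
  qed
  then obtain y where y: "Y \<longlonglongrightarrow> y" using Cauchy_convergent_iff convergent_def by blast
  then have yV: "y \<in> V" using closed_csubspace_limit[OF V] YV by blast
  have "(\<lambda>n. norm (x - Y n)) \<longlonglongrightarrow> norm (x - y)" by (intro tendsto_intros y)
  then have yd: "norm (x - y) = d" using lim LIMSEQ_unique by blast
  have "cinner v (x - y) = 0" if v: "v \<in> V" for v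
  proof (cases "v = 0")
    case False
    define a where "a = cinner v (x - y) / (norm v)\<^sup>2"
    have vx: "cinner (x - y) v = cnj (cinner v (x - y))" by (metis cinner_commute)
    have ax: "cinner (x - y) (a *\<^sub>C v) = of_real ((cmod (cinner v (x - y)))\<^sup>2 / (norm v)\<^sup>2)"
      unfolding cinner_scaleC_right vx a_def using complex_norm_square[of "cinner v (x - y)"]
      by (simp add: mult.commute)
    have "y + a *\<^sub>C v \<in> V" by (intro closed_csubspaceD[OF V] yV v)
    then have "d \<le> norm (x - y - a *\<^sub>C v)" using le by (metis diff_diff_eq)
    then have "d\<^sup>2 \<le> (norm (x - y - a *\<^sub>C v))\<^sup>2" using d0 by (intro power_mono) auto
    also have "\<dots> = d\<^sup>2 - 2 * ((cmod (cinner v (x - y)))\<^sup>2 / (norm v)\<^sup>2) + (cmod a)\<^sup>2 * (norm v)\<^sup>2"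
      by (simp only: norm_diff_square ax norm_scaleC_hilbert Re_complex_of_real power_mult_distrib yd)
    also have "(cmod a)\<^sup>2 * (norm v)\<^sup>2 = (cmod (cinner v (x - y)))\<^sup>2 / (norm v)\<^sup>2"
      proof -
    have "cmod a = cmod (cinner v (x - y)) / (norm v)\<^sup>2" by (simp add: a_def norm_divide norm_power)
    then show ?thesis using False by (simp add: power_divide field_simps power2_eq_square)
  qed
    finally show ?thesis using False by (simp add: field_simps)
  qed simp
  then show ?thesis using yV by (auto simp: orth_compl_def)
qed

lemma orth_compl_Int:
  assumes "x \<in> V" "x \<in> orth_compl V"
  shows "x = 0"
  using orth_complD[OF assms(2,1)] by simp

lemma proj_eqI:
  assumes V: "closed_csubspace V" and y: "y \<in> V" "x - y \<in> orth_compl V"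
  shows "proj V x = y"
  unfolding proj_def
proof (rule the_equality)
  fix z assume z: "z \<in> V \<and> x - z \<in> orth_compl V"
  have "(x - y) - (x - z) \<in> orth_compl V"
    using z y closed_csubspaceD(6)[OF closed_csubspace_orth_compl] by blast
  then have "z - y \<in> orth_compl V" by simp
  moreover have "z - y \<in> V" using z y closed_csubspaceD(6)[OF V] by blast
  ultimately show "z = y" using orth_compl_Int by fastforce
qed (use y in blast)

lemma
  assumes V: "closed_csubspace V"
  shows proj_in: "proj V x \<in> V" and proj_orth: "x - proj V x \<in> orth_compl V"
proof -
  obtain y where "y \<in> V" "x - y \<in> orth_compl V" using proj_exists[OF V] by blast
  then show "proj V x \<in> V" "x - proj V x \<in> orth_compl V" using proj_eqI[OF V] by auto
qed

lemma proj_ident: "closed_csubspace V \<Longrightarrow> x \<in> V \<Longrightarrow> proj V x = x"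
  by (rule proj_eqI) (auto simp: closed_csubspaceD(3)[OF closed_csubspace_orth_compl])

lemma proj_add: 
  assumes V: "closed_csubspace V"
  shows "proj V (x + y) = proj V x + proj V y"
proof (rule proj_eqI[OF V])
  have "x + y - (proj V x + proj V y) = (x - proj V x) + (y - proj V y)" by simp
  then show "x + y - (proj V x + proj V y) \<in> orth_compl V"
    using closed_csubspaceD(4)[OF closed_csubspace_orth_compl proj_orth[OF V] proj_orth[OF V]] by metis
qed (intro closed_csubspaceD[OF V] proj_in[OF V])

lemma proj_scaleC:
  assumes V: "closed_csubspace V"
  shows "proj V (c *\<^sub>C x) = c *\<^sub>C proj V x"
proof (rule proj_eqI[OF V])
  show "c *\<^sub>C x - c *\<^sub>C proj V x \<in> orth_compl V"
    using closed_csubspaceD(5)[OF closed_csubspace_orth_compl proj_orth[OF V]]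
    by (metis scaleC_diff_right)
qed (intro closed_csubspaceD[OF V] proj_in[OF V])

lemma cinner_proj_right: "closed_csubspace V \<Longrightarrow> v \<in> V \<Longrightarrow> cinner v (proj V x) = cinner v x"
  using orth_complD[OF proj_orth[of V x]] by (simp add: cinner_simps)

lemma cinner_proj_left: "closed_csubspace V \<Longrightarrow> v \<in> V \<Longrightarrow> cinner (proj V x) v = cinner x v"
  using orth_complD[OF proj_orth[of V x]] by (simp add: cinner_simps)

lemma norm_proj_square:
  assumes V: "closed_csubspace V"
  shows "(norm x)\<^sup>2 = (norm (proj V x))\<^sup>2 + (norm (x - proj V x))\<^sup>2"
  using norm_add_square_orthogonal[of "proj V x" "x - proj V x"]
    orth_complD[OF proj_orth[OF V] proj_in[OF V]] by simp

lemma norm_proj_le: "closed_csubspace V \<Longrightarrow> norm (proj V x) \<le> norm x"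
  using norm_proj_square[of V x] by (simp add: power2_le_imp_le)

lemma bounded_linear_proj: "closed_csubspace V \<Longrightarrow> bounded_linear (proj V)"
  by (rule bounded_linear_intro[of _ 1])
    (auto simp: proj_add proj_scaleC scaleR_scaleC norm_proj_le)

lemma orth_compl_orth_compl:
  assumes V: "closed_csubspace V"
  shows "orth_compl (orth_compl V) = V"
proof
  show "V \<subseteq> orth_compl (orth_compl V)" by (rule orth_compl_orth_compl_superset)
  show "orth_compl (orth_compl V) \<subseteq> V"
  proof
    fix x assume x: "x \<in> orth_compl (orth_compl V)"
    have "proj V x \<in> orth_compl (orth_compl V)"
      using proj_in[OF V, of x] orth_compl_orth_compl_superset by blast
    then have "x - proj V x \<in> orth_compl (orth_compl V)"
      using x closed_csubspaceD(6)[OF closed_csubspace_orth_compl] by blast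
    then have "x - proj V x = 0" using orth_compl_Int[OF proj_orth[OF V]] by blast
    then show "x \<in> V" using proj_in[OF V, of x] by simp
  qed
qed

lemma closed_csubspace_eq_UNIV:
  assumes "closed_csubspace V" "\<And>x. x \<in> orth_compl V \<Longrightarrow> x = 0"
  shows "V = UNIV"
proof -
  have "orth_compl V = {0}"
    using assms(2) closed_csubspaceD(3)[OF closed_csubspace_orth_compl] by blast
  then have "orth_compl (orth_compl V) = UNIV" by (auto simp: orth_compl_def)
  then show ?thesis using orth_compl_orth_compl[OF assms(1)] by simp
qed

section \<open>Bounded operators and their adjoints\<close>

lemma bounded_opD:
  assumes "bounded_op UNIV T"
  shows "T (x + y) = T x + T y" "T (c *\<^sub>C x) = c *\<^sub>C T x" "T 0 = 0" "T (x - y) = T x - T y"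
    "bounded_linear T"
proof -
  show 1: "T (x + y) = T x + T y" "T (c *\<^sub>C x) = c *\<^sub>C T x" for x y c
    using assms by (auto simp: bounded_op_def)
  show "T 0 = 0" using 1(2)[of 0 0] by simp
  show "T (x - y) = T x - T y" using 1(1)[of "x - y" y] by simp
  obtain K where "\<forall>x. norm (T x) \<le> K * norm x" using assms by (auto simp: bounded_op_def)
  then show "bounded_linear T"
    by (intro bounded_linear_intro[of _ K]) (auto simp: 1 scaleR_scaleC mult.commute)
qed

text \<open>Riesz representation of the antilinear functional \<open>cinner (T z) y\<close> of
  \<open>z\<close>: a vector \<open>e\<close> orthogonal to its kernel represents it after scaling.
  This is what makes the definite description in \<open>op_adjoint\<close> meaningful.\<close>

lemma op_adjoint:
  fixes T :: "'h::complex_hilbert \<Rightarrow> 'h"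
  assumes T: "bounded_op UNIV T"
  shows "cinner z (op_adjoint T y) = cinner (T z) y"
proof -
  note Td = bounded_opD[OF T]
  define K where "K = {z. cinner (T z) y = 0}"
  have "closed K"
    unfolding closed_sequential_limits
  proof safe
    fix X x assume X: "\<forall>n. X n \<in> K" "X \<longlonglongrightarrow> x"
    have "(\<lambda>n. cinner (T (X n)) y) \<longlonglongrightarrow> cinner (T x) y"
      by (intro tendsto_cinner tendsto_const bounded_linear.tendsto[OF Td(5)] X)
    then show "x \<in> K" using X by (simp add: LIMSEQ_const_iff K_def)
  qed
  then have K: "closed_csubspace K"
    by (auto simp: closed_csubspace_def csubspace_def K_def cinner_simps Td)
  have "\<exists>x. \<forall>z. cinner z x = cinner (T z) y"
  proof (cases "K = UNIV")
    case True
    then show ?thesis by (intro exI[of _ 0]) (auto simp: K_def)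
  next
    case False
    then obtain e where e: "e \<in> orth_compl K" "e \<noteq> 0"
      using closed_csubspace_eq_UNIV[OF K] by blast
    define a where "a = cinner (T e) y"
    have a0: "a \<noteq> 0" using e orth_compl_Int[of e K] by (auto simp: K_def a_def)
    have "cinner z ((a / (norm e)\<^sup>2) *\<^sub>C e) = cinner (T z) y" for z
    proof -
      define c where "c = cnj (cinner (T z) y / a)"
      have "z - c *\<^sub>C e \<in> K"
        using a0 by (simp add: K_def Td cinner_simps c_def flip: a_def)
      from orth_complD[OF e(1) this] have "cinner z e = cnj c * cinner e e" by (simp add: cinner_simps)
      then show ?thesis using e(2) a0 by (simp add: cinner_simps cinner_same c_def)
    qed
    then show ?thesis by blast
  qed
  then obtain x where x: "\<forall>z. cinner z x = cinner (T z) y" by blast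
  have "op_adjoint T y = x"
    unfolding op_adjoint_def
  proof (rule the_equality)
    show "\<forall>z. cinner z x = cinner (T z) y" by (rule x)
    fix w assume "\<forall>z. cinner z w = cinner (T z) y"
    then have "cinner (w - x) (w - x) = 0" using x by (simp only: cinner_diff_right) simp
    then show "w = x" by simp
  qed
  then show ?thesis using x by simp
qed

text \<open>Removes adjoints from the argument: coinvariance is used below as invariance of the
  orthogonal complement.\<close>

lemma op_adjoint_invariant_iff:
  assumes T: "bounded_op UNIV T" and V: "closed_csubspace V"
  shows "op_adjoint T ` V \<subseteq> V \<longleftrightarrow> T ` orth_compl V \<subseteq> orth_compl V"
proof
  assume *: "op_adjoint T ` V \<subseteq> V"
  show "T ` orth_compl V \<subseteq> orth_compl V"
  proof safe
    fix x assume x: "x \<in> orth_compl V"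
    have "cinner v (T x) = 0" if "v \<in> V" for v
    proof -
      have "cinner x (op_adjoint T v) = 0" using orth_complD[OF x] * that by blast
      then show ?thesis by (metis op_adjoint[OF T] cinner_commute complex_cnj_zero)
    qed
    then show "T x \<in> orth_compl V" by (simp add: orth_compl_def)
  qed
next
  assume *: "T ` orth_compl V \<subseteq> orth_compl V"
  show "op_adjoint T ` V \<subseteq> V"
  proof safe
    fix v assume v: "v \<in> V"
    have "cinner x (op_adjoint T v) = 0" if "x \<in> orth_compl V" for x
      using orth_complD[of "T x" V v] that v * by (auto simp: op_adjoint[OF T])
    then have "op_adjoint T v \<in> orth_compl (orth_compl V)" by (simp add: orth_compl_def)
    then show "op_adjoint T v \<in> V" by (simp add: orth_compl_orth_compl[OF V])
  qed
qed

section \<open>Finite dimensional subspaces: closedness and compact unit balls\<close>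

lemma csubspace_hull_insert:
  "csubspace hull (insert b B) = {y + c *\<^sub>C b |y c. y \<in> csubspace hull B}"
proof (rule hull_unique)
  have 0: "0 \<in> csubspace hull B" by (rule csubspaceD(1)[OF csubspace_hull])
  show "insert b B \<subseteq> {y + c *\<^sub>C b |y c. y \<in> csubspace hull B}"
  proof (rule insert_subsetI)
    show "b \<in> {y + c *\<^sub>C b |y c. y \<in> csubspace hull B}"
      using 0 by (auto intro!: exI[of _ "0::'a"] exI[of _ 1])
    have "x = x + 0 *\<^sub>C b" for x by simp
    then show "B \<subseteq> {y + c *\<^sub>C b |y c. y \<in> csubspace hull B}"
      using hull_inc[of _ B csubspace] by blast
  qed
  show "csubspace {y + c *\<^sub>C b |y c. y \<in> csubspace hull B}"
  proof (rule csubspaceI)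
    show "0 \<in> {y + c *\<^sub>C b |y c. y \<in> csubspace hull B}"
      using 0 by (auto intro!: exI[of _ "0::'a"] exI[of _ 0])
    show "x + x' \<in> {y + c *\<^sub>C b |y c. y \<in> csubspace hull B}"
      if "x \<in> {y + c *\<^sub>C b |y c. y \<in> csubspace hull B}"
        "x' \<in> {y + c *\<^sub>C b |y c. y \<in> csubspace hull B}" for x x'
    proof -
      obtain y c y' c' where "x = y + c *\<^sub>C b" "x' = y' + c' *\<^sub>C b"
        and *: "y \<in> csubspace hull B" "y' \<in> csubspace hull B" using \<open>x \<in> _\<close> \<open>x' \<in> _\<close> by blast
      then have "x + x' = (y + y') + (c + c') *\<^sub>C b" by (simp add: scaleC_add_left)
      moreover have "y + y' \<in> csubspace hull B" by (intro csubspaceD[OF csubspace_hull] *)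
      ultimately show ?thesis by blast
    qed
    show "a *\<^sub>C x \<in> {y + c *\<^sub>C b |y c. y \<in> csubspace hull B}"
      if x: "x \<in> {y + c *\<^sub>C b |y c. y \<in> csubspace hull B}" for a x
    proof -
      obtain y c where "x = y + c *\<^sub>C b" and *: "y \<in> csubspace hull B" using x by blast
      then have "a *\<^sub>C x = a *\<^sub>C y + (a * c) *\<^sub>C b" by (simp add: scaleC_add_right scaleC_scaleC)
      moreover have "a *\<^sub>C y \<in> csubspace hull B" by (intro csubspaceD[OF csubspace_hull] *)
      ultimately show ?thesis by blast
    qed
  qed
  show "{y + c *\<^sub>C b |y c. y \<in> csubspace hull B} \<subseteq> T" if "insert b B \<subseteq> T" "csubspace T" for T
  proof -
    have "csubspace hull B \<subseteq> T" using that by (intro hull_minimal) auto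
    then show ?thesis using that csubspaceD[OF that(2)] by blast
  qed
qed

text \<open>A convergent sequence is bounded, so it can be scaled into the unit ball. In the next
  induction this turns compactness of the ball into closedness of the subspace.\<close>

lemma closed_if_unit_ball_closed:
  fixes V :: "'h::complex_hilbert set"
  assumes V: "csubspace V" and cl: "closed (V \<inter> cball 0 1)"
  shows "closed V"
  unfolding closed_sequential_limits
proof safe
  fix X l assume X: "\<forall>n. X n \<in> V" "X \<longlonglongrightarrow> l"
  then obtain R where R: "R > 0" "\<And>n. norm (X n) \<le> R"
    using convergent_imp_Bseq[of X] by (auto simp: convergent_def Bseq_def)
  have "(\<lambda>n. (1/R) *\<^sub>R X n) \<longlonglongrightarrow> (1/R) *\<^sub>R l" by (intro tendsto_intros X)
  moreover have "(1/R) *\<^sub>R X n \<in> V \<inter> cball 0 1" for n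
    using X R csubspaceD(3)[OF V] by (auto simp: scaleR_scaleC norm_scaleC_hilbert norm_divide field_simps)
  ultimately have "(1/R) *\<^sub>R l \<in> V \<inter> cball 0 1" by (rule closed_sequentially[OF cl, rotated])
  then have "complex_of_real R *\<^sub>C (1/R) *\<^sub>R l \<in> V" using csubspaceD(3)[OF V] by blast
  then have "R *\<^sub>R (1/R) *\<^sub>R l \<in> V" by (simp only: scaleR_scaleC)
  then show "l \<in> V" using R by simp
qed

text \<open>The new generator is replaced by its component \<open>b'\<close> orthogonal to the span
  so far. Then Pythagoras bounds \<open>y\<close> and \<open>c\<close> separately in
  \<open>y + c *\<^sub>C b'\<close>, and the ball is cut out of the continuous image of a compact
  product. The projection defining \<open>b'\<close> exists because the induction hypothesis yields
  closedness.\<close>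

lemma compact_unit_ball_finite_hull:
  fixes B :: "'h::complex_hilbert set"
  assumes "finite B"
  shows "compact ((csubspace hull B) \<inter> cball 0 1)"
  using assms
proof (induction B)
  case empty
  have "csubspace hull {} = {0::'h}"
    by (rule hull_unique) (auto simp: csubspace_def)
  then show ?case by (simp add: finite_imp_compact)
next
  case (insert b B)
  define V where "V = csubspace hull B"
  have V: "closed_csubspace V"
    using closed_if_unit_ball_closed[OF csubspace_hull] insert compact_imp_closed csubspace_hull
    by (auto simp: closed_csubspace_def V_def)
  define b' where "b' = b - proj V b"
  have hull: "csubspace hull (insert b B) = {y + c *\<^sub>C b' |y c. y \<in> V}"
  proof -
    have "y + c *\<^sub>C b = (y + c *\<^sub>C proj V b) + c *\<^sub>C b'" "y + c *\<^sub>C b' = (y - c *\<^sub>C proj V b) + c *\<^sub>C b"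
      for y c by (simp_all add: b'_def scaleC_diff_right)
    moreover have "y + c *\<^sub>C proj V b \<in> V" "y - c *\<^sub>C proj V b \<in> V" if "y \<in> V" for y c
      using that by (auto intro!: closed_csubspaceD[OF V] proj_in[OF V])
    ultimately show ?thesis unfolding csubspace_hull_insert V_def[symmetric] by blast
  qed
  have orth: "cinner y (c *\<^sub>C b') = 0" if "y \<in> V" for y c
    using orth_complD[OF proj_orth[OF V] that] by (simp add: cinner_simps(8) b'_def)
  show ?case
  proof (cases "b' = 0")
    case True
    then have "csubspace hull (insert b B) = V" by (auto simp: hull)
    then show ?thesis using insert by (simp add: V_def)
  next
    case False
    define f where "f = (\<lambda>(y, c). y + c *\<^sub>C b')"
    define Q :: "('h \<times> complex) set" where "Q = (V \<inter> cball 0 1) \<times> cball 0 (1 / norm b')"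
    have "continuous_on Q f"
      unfolding f_def case_prod_beta
    proof (intro continuous_intros)
      have "bounded_linear (\<lambda>c. c *\<^sub>C b')"
        by (rule bounded_linear_intro[of _ "norm b'"])
          (auto simp: scaleC_add_left norm_scaleC_hilbert scaleR_scaleC scaleC_scaleC scaleC_complex_def)
      then show "continuous_on Q (\<lambda>x. snd x *\<^sub>C b')"
        by (rule bounded_linear.continuous_on) (intro continuous_intros)
    qed
    moreover have "compact Q"
      unfolding Q_def using insert by (intro compact_Times compact_cball) (simp add: V_def)
    ultimately have "compact (f ` Q)" by (rule compact_continuous_image)
    then have "compact (f ` Q \<inter> cball 0 1)" by (rule compact_Int_closed) simp
    also have "f ` Q \<inter> cball 0 1 = (csubspace hull (insert b B)) \<inter> cball 0 1"
    proof (intro equalityI subsetI)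
      fix x assume "x \<in> (csubspace hull (insert b B)) \<inter> cball 0 1"
      then obtain y c where x: "x = y + c *\<^sub>C b'" "y \<in> V" "norm x \<le> 1" by (auto simp: hull)
      have "(norm x)\<^sup>2 = (norm y)\<^sup>2 + (norm (c *\<^sub>C b'))\<^sup>2"
        unfolding x(1) by (rule norm_add_square_orthogonal[OF orth[OF x(2)]])
      moreover have "(norm x)\<^sup>2 \<le> 1" using x(3) by (simp add: power_le_one)
      ultimately have "(norm y)\<^sup>2 \<le> 1\<^sup>2" "(norm (c *\<^sub>C b'))\<^sup>2 \<le> 1\<^sup>2"
        using zero_le_power2[of "norm y"] zero_le_power2[of "norm (c *\<^sub>C b')"] unfolding one_power2
        by linarith+
      then have "norm y \<le> 1" "norm (c *\<^sub>C b') \<le> 1" using power2_le_imp_le zero_le_one by blast+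
      then have "(y, c) \<in> Q" using False x by (auto simp: Q_def norm_scaleC_hilbert field_simps)
      then show "x \<in> f ` Q \<inter> cball 0 1" using x by (auto simp: f_def intro!: image_eqI[of _ _ "(y, c)"])
    qed (auto simp: f_def Q_def hull)
    finally show ?thesis .
  qed
qed

lemma compact_unit_ball_finite_dimensional:
  assumes "finite_dimensional V" "closed V"
  shows "compact (V \<inter> cball 0 (1::real) :: 'h::complex_hilbert set)"
proof -
  obtain B where B: "finite B" "V \<subseteq> csubspace hull B"
    using assms(1) by (auto simp: finite_dimensional_def)
  have "V \<inter> cball 0 1 = V \<inter> ((csubspace hull B) \<inter> cball 0 1)" using B(2) by auto
  then show ?thesis
    using closed_Int_compact[OF assms(2) compact_unit_ball_finite_hull[OF B(1)]] by simp
qed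

lemma closed_finite_hull: "finite B \<Longrightarrow> closed (csubspace hull (B::'h::complex_hilbert set))"
  using closed_if_unit_ball_closed[OF csubspace_hull] compact_unit_ball_finite_hull compact_imp_closed
  by blast

section \<open>The direct sum of two Hilbert spaces\<close>

instantiation prod :: (complex_vector, complex_vector) complex_vector
begin

definition scaleC_prod :: "complex \<Rightarrow> 'a \<times> 'b \<Rightarrow> 'a \<times> 'b"
  where "scaleC_prod c p = (c *\<^sub>C fst p, c *\<^sub>C snd p)"

instance
  by standard (auto simp: scaleC_prod_def scaleC_add_right scaleC_add_left scaleC_scaleC scaleR_scaleC
      scaleR_prod_def)

end

instantiation prod :: (complex_hilbert, complex_hilbert) complex_hilbert
begin

definition cinner_prod :: "'a \<times> 'b \<Rightarrow> 'a \<times> 'b \<Rightarrow> complex"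
  where "cinner_prod p q = cinner (fst p) (fst q) + cinner (snd p) (snd q)"

instance
proof
  fix x y z :: "'a \<times> 'b" and c
  show "cinner x y = cnj (cinner y x)"
    unfolding cinner_prod_def by (metis cinner_commute complex_cnj_add)
  show "cinner x x = complex_of_real ((norm x)\<^sup>2)"
    by (simp add: cinner_prod_def cinner_same norm_prod_def)
qed (auto simp: cinner_prod_def cinner_simps scaleC_prod_def algebra_simps)

end

subsection \<open>Semi-inner products with values in a C*-algebra\<close>

text \<open>No module laws are demanded of \<open>add\<close> and \<open>act\<close>: in the
  instance for tensor products the vectors are lists under append, where a difference of equal
  vectors is null but not zero. Vector identities are replaced by equality of all values of the
  form, see \<open>nrm_cong\<close>.\<close>

locale semi_ip =
  fixes C :: "'x set" and add :: "'x \<Rightarrow> 'x \<Rightarrow> 'x" and act :: "'x \<Rightarrow> 'b::cstar_algebra \<Rightarrow> 'x"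
    and form :: "'x \<Rightarrow> 'x \<Rightarrow> 'b"
  assumes add_closed: "x \<in> C \<Longrightarrow> y \<in> C \<Longrightarrow> add x y \<in> C"
    and act_closed: "x \<in> C \<Longrightarrow> act x b \<in> C"
    and form_add_right: "x \<in> C \<Longrightarrow> y \<in> C \<Longrightarrow> z \<in> C \<Longrightarrow> form x (add y z) = form x y + form x z"
    and form_act_right: "x \<in> C \<Longrightarrow> y \<in> C \<Longrightarrow> form x (act y b) = form x y * b"
    and form_star: "x \<in> C \<Longrightarrow> y \<in> C \<Longrightarrow> star (form x y) = form y x"
    and form_nonneg: "x \<in> C \<Longrightarrow> nonneg (form x x)"
begin

lemma form_add_left: "x \<in> C \<Longrightarrow> y \<in> C \<Longrightarrow> z \<in> C \<Longrightarrow> form (add y z) x = form y x + form z x"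
  by (metis add_closed form_add_right form_star star_add)

lemma form_act_left: "x \<in> C \<Longrightarrow> y \<in> C \<Longrightarrow> form (act y b) x = star b * form y x"
  by (metis act_closed form_act_right form_star star_mult)

definition nrm :: "'x \<Rightarrow> real" where "nrm x = sqrt (norm (form x x))"

definition dst :: "'x \<Rightarrow> 'x \<Rightarrow> real" where "dst x y = nrm (add x (act y (- 1)))"

lemma nrm_ge_0 [simp]: "0 \<le> nrm x" by (simp add: nrm_def)

lemma dst_ge_0 [simp]: "0 \<le> dst x y" by (simp add: dst_def)

lemma nrm_square: "(nrm x)\<^sup>2 = norm (form x x)" by (simp add: nrm_def)

text \<open>Nonnegativity of the form at \<open>z = y - x a\<close> with \<open>a = c / N\<close>,
  where \<open>N\<close> exceeds \<open>norm (form x x)\<close> by \<open>e\<close> to keep the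
  division legitimate. Adding the congruence of \<open>N - form x x\<close> by \<open>a\<close>
  replaces \<open>form x x\<close> by the scalar \<open>N\<close> and leaves \<open>form y y\<close>
  minus \<open>star c * c / N\<close>.\<close>

lemma cauchy_schwarz_square:
  assumes x: "x \<in> C" and y: "y \<in> C"
  shows "(norm (form x y))\<^sup>2 \<le> norm (form x x) * norm (form y y)"
proof -
  define c where "c = form x y"
  have le: "(norm c)\<^sup>2 \<le> (norm (form x x) + e) * norm (form y y)" if e: "e > 0" for e
  proof -
    define N where "N = norm (form x x) + e"
    have N: "N > 0" using e by (simp add: N_def add_nonneg_pos)
    define a where "a = (1/N) *\<^sub>R c"
    define z where "z = add y (act x (- a))"
    have z: "z \<in> C" unfolding z_def by (intro add_closed act_closed x y)
    have yx: "form y x = star c" by (simp add: c_def form_star x y)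
    have zz: "form z z = form y y - star c * a - star a * c + star a * form x x * a"
      unfolding z_def
      by (simp add: form_add_left form_add_right form_act_left form_act_right add_closed act_closed
          x y yx star_minus algebra_simps flip: c_def)
    have "nonneg (of_real N - form x x)"
      by (rule nonneg_norm_minus) (use e form_star[OF x x] in \<open>auto simp: N_def\<close>)
    then have "nonneg (form z z + star a * (of_real N - form x x) * a)"
      by (intro nonneg_add nonneg_congruence form_nonneg z)
    also have "form z z + star a * (of_real N - form x x) * a = form y y - (1/N) *\<^sub>R (star c * c)"
      unfolding zz using N by (simp add: a_def star_scaleR algebra_simps of_real_def)
    finally have "norm ((1/N) *\<^sub>R (star c * c)) \<le> norm (form y y)"
      using N by (intro nonneg_norm_mono nonneg_scaleR nonneg_star_mult_self) auto
    then show ?thesis using N by (simp add: cstar_identity field_simps N_def)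
  qed
  have "(norm c)\<^sup>2 \<le> norm (form x x) * norm (form y y)"
  proof (rule tendsto_lowerbound)
    have "((\<lambda>e. (norm (form x x) + e) * norm (form y y)) \<longlongrightarrow> (norm (form x x) + 0) * norm (form y y)) (at_right 0)"
      by (intro tendsto_intros)
    then show "((\<lambda>e. (norm (form x x) + e) * norm (form y y)) \<longlongrightarrow> norm (form x x) * norm (form y y)) (at_right 0)"
      by simp
    show "\<forall>\<^sub>F e in at_right 0. (norm c)\<^sup>2 \<le> (norm (form x x) + e) * norm (form y y)"
      by (rule eventually_at_rightI[of 0 1]) (use le in auto)
  qed simp
  then show ?thesis by (simp add: c_def)
qed

lemma cauchy_schwarz: "x \<in> C \<Longrightarrow> y \<in> C \<Longrightarrow> norm (form x y) \<le> nrm x * nrm y"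
  using cauchy_schwarz_square[of x y]
  by (rule_tac power2_le_imp_le) (simp_all add: power_mult_distrib nrm_square)

lemma nrm_add: 
  assumes "x \<in> C" "y \<in> C"
  shows "nrm (add x y) \<le> nrm x + nrm y"
proof (rule power2_le_imp_le)
  have "form (add x y) (add x y) = form x x + form x y + (form y x + form y y)"
    by (simp add: form_add_left form_add_right assms add_closed)
  also have "norm \<dots> \<le> (norm (form x x) + norm (form x y)) + (norm (form y x) + norm (form y y))"
    by (intro norm_triangle_mono) auto
  also have "\<dots> \<le> (nrm x + nrm y)\<^sup>2"
    using cauchy_schwarz[OF assms] cauchy_schwarz[OF assms(2,1)] mult.commute[of "nrm x" "nrm y"]
    unfolding power2_sum nrm_square by linarith
  finally show "(nrm (add x y))\<^sup>2 \<le> (nrm x + nrm y)\<^sup>2" by (simp add: nrm_square)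
qed simp

lemma nrm_act: "x \<in> C \<Longrightarrow> nrm (act x b) \<le> norm b * nrm x"
proof (rule power2_le_imp_le)
  assume x: "x \<in> C"
  have "norm (star b * form x x * b) \<le> norm (star b) * norm (form x x) * norm b"
    by (intro order_trans[OF norm_mult_ineq] mult_right_mono norm_mult_ineq) simp
  moreover have "(nrm (act x b))\<^sup>2 = norm (star b * form x x * b)"
    by (simp add: nrm_square form_act_left form_act_right act_closed x)
  ultimately have "(nrm (act x b))\<^sup>2 \<le> norm b * (nrm x)\<^sup>2 * norm b" by (simp add: nrm_square)
  then show "(nrm (act x b))\<^sup>2 \<le> (norm b * nrm x)\<^sup>2"
    by (simp add: power2_eq_square mult_ac)
qed simp

lemma nrm_cong:
  assumes "u \<in> C" "v \<in> C" "\<And>w. w \<in> C \<Longrightarrow> form w u = form w v"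
  shows "nrm u = nrm v"
  by (metis assms form_star nrm_def)

lemma form_diff_right:
  "x \<in> C \<Longrightarrow> y \<in> C \<Longrightarrow> z \<in> C \<Longrightarrow> form x (add y (act z (- 1))) = form x y - form x z"
  by (simp add: form_add_right form_act_right act_closed)

lemma form_diff_left:
  "x \<in> C \<Longrightarrow> y \<in> C \<Longrightarrow> z \<in> C \<Longrightarrow> form (add y (act z (- 1))) x = form y x - form z x"
  by (simp add: form_add_left form_act_left act_closed star_minus)

lemma diff_closed: "x \<in> C \<Longrightarrow> y \<in> C \<Longrightarrow> add x (act y (- 1)) \<in> C"
  by (simp add: add_closed act_closed)

lemma dst_triangle:
  assumes "x \<in> C" "y \<in> C" "z \<in> C"
  shows "dst x z \<le> dst x y + dst y z"
proof -
  have "dst x z = nrm (add (add x (act y (- 1))) (add y (act z (- 1))))"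
    unfolding dst_def
    by (rule nrm_cong) (auto simp: assms diff_closed add_closed form_add_right form_diff_right)
  also have "\<dots> \<le> dst x y + dst y z"
    unfolding dst_def by (intro nrm_add diff_closed assms)
  finally show ?thesis .
qed

lemma dst_self: "x \<in> C \<Longrightarrow> dst x x = 0"
  by (simp add: dst_def nrm_def form_diff_right form_diff_left diff_closed)

lemma dst_sym: "x \<in> C \<Longrightarrow> y \<in> C \<Longrightarrow> dst x y = dst y x"
  by (simp add: dst_def nrm_def form_diff_right form_diff_left diff_closed algebra_simps)

lemma nrm_le_dst: 
  assumes "x \<in> C" "y \<in> C"
  shows "nrm x \<le> nrm y + dst x y"
proof -
  have "nrm x = nrm (add y (add x (act y (- 1))))"
    by (rule nrm_cong) (auto simp: assms diff_closed add_closed form_add_right form_diff_right)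
  also have "\<dots> \<le> nrm y + dst x y"
    unfolding dst_def by (intro nrm_add diff_closed assms)
  finally show ?thesis .
qed

lemma form_diff_le:
  assumes "x \<in> C" "y \<in> C" "x' \<in> C" "y' \<in> C"
  shows "norm (form x y - form x' y') \<le> nrm x * dst y y' + dst x x' * nrm y'"
proof -
  have "form x y - form x' y' = form x (add y (act y' (- 1))) + form (add x (act x' (- 1))) y'"
    by (simp add: form_diff_right form_diff_left assms)
  also have "norm \<dots> \<le> nrm x * dst y y' + dst x x' * nrm y'"
    unfolding dst_def by (intro norm_triangle_mono cauchy_schwarz diff_closed assms)
  finally show ?thesis .
qed

definition cauchy :: "(nat \<Rightarrow> 'x) \<Rightarrow> bool"
  where "cauchy X \<longleftrightarrow> (\<forall>n. X n \<in> C) \<and> (\<forall>e>0. \<exists>N. \<forall>m\<ge>N. \<forall>n\<ge>N. dst (X m) (X n) < e)"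

lemma cauchy_bounded:
  assumes "cauchy X"
  obtains B where "B > 0" "\<And>n. nrm (X n) \<le> B"
proof -
  obtain N where N: "\<And>m. m \<ge> N \<Longrightarrow> dst (X m) (X N) < 1"
    using assms by (auto simp: cauchy_def) (meson order_refl zero_less_one)
  define B where "B = Max ((\<lambda>n. nrm (X n)) ` {..N}) + 1"
  have XC: "X n \<in> C" for n using assms by (simp add: cauchy_def)
  have B: "nrm (X n) + 1 \<le> B" if "n \<le> N" for n using that by (auto simp: B_def)
  have "nrm (X n) \<le> B" for n
  proof (cases "n \<le> N")
    case False
    then show ?thesis using nrm_le_dst[OF XC[of n] XC[of N]] N[of n] B[of N] by simp
  qed (use B[of n] in auto)
  moreover have "B > 0" using B[of 0] nrm_ge_0[of "X 0"] by linarith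
  ultimately show thesis using that by blast
qed

lemma form_convergent:
  assumes X: "cauchy X" and Y: "cauchy Y"
  shows "convergent (\<lambda>n. form (X n) (Y n))"
proof -
  obtain B B' where B: "B > 0" "\<And>n. nrm (X n) \<le> B" and B': "B' > 0" "\<And>n. nrm (Y n) \<le> B'"
    using cauchy_bounded[OF X] cauchy_bounded[OF Y] by metis
  have C: "X n \<in> C" "Y n \<in> C" for n using X Y by (auto simp: cauchy_def)
  have "Cauchy (\<lambda>n. form (X n) (Y n))"
  proof (rule CauchyI)
    fix e :: real assume e: "e > 0"
    obtain N N' where N: "\<And>m n. m \<ge> N \<Longrightarrow> n \<ge> N \<Longrightarrow> dst (X m) (X n) < e / (2 * B')"
      and N': "\<And>m n. m \<ge> N' \<Longrightarrow> n \<ge> N' \<Longrightarrow> dst (Y m) (Y n) < e / (2 * B)"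
      using X Y e B(1) B'(1) unfolding cauchy_def
      by (metis divide_pos_pos mult_pos_pos zero_less_numeral)
    have "norm (form (X m) (Y m) - form (X n) (Y n)) < e" if "m \<ge> max N N'" "n \<ge> max N N'" for m n
    proof -
      have "norm (form (X m) (Y m) - form (X n) (Y n)) \<le> nrm (X m) * dst (Y m) (Y n) + dst (X m) (X n) * nrm (Y n)"
        by (rule form_diff_le) (auto simp: C)
      also have "\<dots> \<le> B * dst (Y m) (Y n) + dst (X m) (X n) * B'"
        by (intro add_mono mult_mono B B') (use B B' in auto)
      also have "\<dots> < B * (e / (2 * B)) + (e / (2 * B')) * B'"
        using N[of m n] N'[of m n] that B(1) B'(1)
        by (intro add_strict_mono mult_strict_left_mono mult_strict_right_mono) auto
      also have "\<dots> = e" using B B' by simp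
      finally show ?thesis .
    qed
    then show "\<exists>M. \<forall>m\<ge>M. \<forall>n\<ge>M. norm (form (X m) (Y m) - form (X n) (Y n)) < e" by blast
  qed
  then show ?thesis by (rule Cauchy_convergent)
qed

lemma form_diff_tendsto_0:
  assumes "cauchy X" "cauchy Y" "cauchy X'" "cauchy Y'"
    and "(\<lambda>n. dst (X n) (X' n)) \<longlonglongrightarrow> 0" "(\<lambda>n. dst (Y n) (Y' n)) \<longlonglongrightarrow> 0"
  shows "(\<lambda>n. form (X n) (Y n) - form (X' n) (Y' n)) \<longlonglongrightarrow> 0"
proof -
  obtain B B' where B: "B > 0" "\<And>n. nrm (X n) \<le> B" and B': "B' > 0" "\<And>n. nrm (Y' n) \<le> B'"
    using cauchy_bounded[OF assms(1)] cauchy_bounded[OF assms(4)] by metis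
  have C: "X n \<in> C" "Y n \<in> C" "X' n \<in> C" "Y' n \<in> C" for n using assms by (auto simp: cauchy_def)
  show ?thesis
  proof (rule tendsto_0_le[where K = 1])
    have "(\<lambda>n. B * dst (Y n) (Y' n) + dst (X n) (X' n) * B') \<longlonglongrightarrow> B * 0 + 0 * B'"
      by (intro tendsto_intros assms)
    then show "(\<lambda>n. B * dst (Y n) (Y' n) + dst (X n) (X' n) * B') \<longlonglongrightarrow> 0" by simp
    have "norm (form (X n) (Y n) - form (X' n) (Y' n)) \<le> B * dst (Y n) (Y' n) + dst (X n) (X' n) * B'" for n
      using form_diff_le[of "X n" "Y n" "X' n" "Y' n"] C B B' 
        mult_right_mono[OF B(2)[of n], of "dst (Y n) (Y' n)"]
        mult_left_mono[OF B'(2)[of n], of "dst (X n) (X' n)"] by fastforce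
    then show "\<forall>\<^sub>F n in sequentially. norm (form (X n) (Y n) - form (X' n) (Y' n)) \<le>
        norm (B * dst (Y n) (Y' n) + dst (X n) (X' n) * B') * 1"
      by (intro always_eventually allI) (smt (verit) real_norm_def mult_cancel_left2)
  qed
qed

end

section \<open>Hilbert modules and positivity of left actions\<close>

lemma hilbert_moduleD:
  assumes "hilbert_module M"
  shows "mzero M \<in> carrier M"
    "x \<in> carrier M \<Longrightarrow> y \<in> carrier M \<Longrightarrow> madd M x y \<in> carrier M"
    "x \<in> carrier M \<Longrightarrow> y \<in> carrier M \<Longrightarrow> z \<in> carrier M \<Longrightarrow> madd M (madd M x y) z = madd M x (madd M y z)"
    "x \<in> carrier M \<Longrightarrow> y \<in> carrier M \<Longrightarrow> madd M x y = madd M y x"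
    "x \<in> carrier M \<Longrightarrow> madd M x (mzero M) = x"
    "x \<in> carrier M \<Longrightarrow> ract M x b \<in> carrier M"
    "x \<in> carrier M \<Longrightarrow> y \<in> carrier M \<Longrightarrow> z \<in> carrier M \<Longrightarrow> ip M x (madd M y z) = ip M x y + ip M x z"
    "x \<in> carrier M \<Longrightarrow> y \<in> carrier M \<Longrightarrow> ip M x (ract M y b) = ip M x y * b"
    "x \<in> carrier M \<Longrightarrow> y \<in> carrier M \<Longrightarrow> star (ip M x y) = ip M y x"
    "x \<in> carrier M \<Longrightarrow> positive (ip M x x)"
    "x \<in> carrier M \<Longrightarrow> ip M x x = 0 \<Longrightarrow> x = mzero M"
    "x \<in> carrier M \<Longrightarrow> ract M x 1 = x"
  by (insert assms[unfolded hilbert_module_def]; elim conjE; metis)+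

lemma semi_ip_hilbert_module:
  assumes "hilbert_module M"
  shows "semi_ip (carrier M) (madd M) (ract M) (ip M)"
  by unfold_locales (simp_all add: hilbert_moduleD[OF assms] nonneg_if_positive)

lemma ip_mzero_right: "hilbert_module M \<Longrightarrow> x \<in> carrier M \<Longrightarrow> ip M x (mzero M) = 0"
  using hilbert_moduleD(7)[of M x x "mzero M"] hilbert_moduleD(5)[of M x] hilbert_moduleD(1)[of M]
  by simp

lemma msum_closed:
  "hilbert_module M \<Longrightarrow> set xs \<subseteq> carrier M \<Longrightarrow> msum M xs \<in> carrier M"
  by (induction xs) (auto simp: msum_def hilbert_moduleD)

lemma ip_msum_right:
  assumes "hilbert_module M" "x \<in> carrier M" "set xs \<subseteq> carrier M"
  shows "ip M x (msum M xs) = (\<Sum>z\<leftarrow>xs. ip M x z)"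
  using assms(3)
proof (induction xs)
  case (Cons z xs)
  then show ?case
    using hilbert_moduleD(7)[OF assms(1,2), of z "msum M xs"] msum_closed[OF assms(1), of xs]
    by (simp add: msum_def)
qed (use assms in \<open>auto simp: msum_def ip_mzero_right\<close>)

lemma star_sum_list: "star (\<Sum>z\<leftarrow>xs. f z :: 'b::cstar_algebra) = (\<Sum>z\<leftarrow>xs. star (f z))"
  by (induction xs) (auto simp: star_add)

lemma ip_msum_left:
  assumes "hilbert_module M" "x \<in> carrier M" "set xs \<subseteq> carrier M"
  shows "ip M (msum M xs) x = (\<Sum>z\<leftarrow>xs. ip M z x)"
proof -
  have "ip M (msum M xs) x = star (ip M x (msum M xs))"
    using hilbert_moduleD(9)[OF assms(1)] msum_closed[OF assms(1,3)] assms(2) by simp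
  also have "\<dots> = (\<Sum>z\<leftarrow>xs. star (ip M x z))"
    by (simp add: ip_msum_right[OF assms] star_sum_list)
  also have "\<dots> = (\<Sum>z\<leftarrow>xs. ip M z x)"
    using assms hilbert_moduleD(9)[OF assms(1)] by (intro arg_cong[of _ _ sum_list] map_cong) auto
  finally show ?thesis .
qed

lemma cstar_correspondenceD:
  assumes "cstar_correspondence M"
  shows "hilbert_module M"
    "x \<in> carrier M \<Longrightarrow> lact M a x \<in> carrier M"
    "x \<in> carrier M \<Longrightarrow> y \<in> carrier M \<Longrightarrow> ip M (lact M a x) y = ip M x (lact M (star a) y)"
    "x \<in> carrier M \<Longrightarrow> lact M (a + b) x = madd M (lact M a x) (lact M b x)"
    "x \<in> carrier M \<Longrightarrow> lact M (a * b) x = lact M a (lact M b x)"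
    "x \<in> carrier M \<Longrightarrow> lact M (c *\<^sub>C a) x = ract M (lact M a x) (c *\<^sub>C 1)"
  using assms unfolding cstar_correspondence_def by blast+

context
  fixes G :: "('a::cstar_algebra, 'b::cstar_algebra, 'y) corr"
  assumes G: "cstar_correspondence G"
begin

lemma ip_lact_add:
  "x \<in> carrier G \<Longrightarrow> y \<in> carrier G \<Longrightarrow> ip G x (lact G (a + b) y) = ip G x (lact G a y) + ip G x (lact G b y)"
  using cstar_correspondenceD[OF G] hilbert_moduleD(7)[OF cstar_correspondenceD(1)[OF G]] by simp

lemma ip_lact_diff:
  "x \<in> carrier G \<Longrightarrow> y \<in> carrier G \<Longrightarrow> ip G x (lact G (a - b) y) = ip G x (lact G a y) - ip G x (lact G b y)"
  using ip_lact_add[of x y "a - b" b] by simp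

lemma ip_lact_scaleR:
  "x \<in> carrier G \<Longrightarrow> y \<in> carrier G \<Longrightarrow> ip G x (lact G (r *\<^sub>R a) y) = r *\<^sub>R ip G x (lact G a y)"
  using cstar_correspondenceD[OF G] hilbert_moduleD(8)[OF cstar_correspondenceD(1)[OF G]]
  by (simp add: scaleR_scaleC scaleC_mult_right)

lemma ip_lact_madd:
  "x \<in> carrier G \<Longrightarrow> y \<in> carrier G \<Longrightarrow> z \<in> carrier G \<Longrightarrow>
    ip G x (lact G a (madd G y z)) = ip G x (lact G a y) + ip G x (lact G a z)"
  using cstar_correspondenceD(2,3)[OF G] hilbert_moduleD(2,7)[OF cstar_correspondenceD(1)[OF G]]
  by (metis star_star)

lemma ip_lact_ract:
  "x \<in> carrier G \<Longrightarrow> y \<in> carrier G \<Longrightarrow> ip G x (lact G a (ract G y b)) = ip G x (lact G a y) * b"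
  using cstar_correspondenceD(2,3)[OF G] hilbert_moduleD(6,8)[OF cstar_correspondenceD(1)[OF G]]
  by (metis star_star)

lemma ip_lact_nonneg:
  assumes c: "nonneg c" and z: "z \<in> carrier G"
  shows "nonneg (ip G z (lact G c z))"
proof (rule nonneg_eps)
  fix e :: real assume "e > 0"
  then obtain b where b: "star b = b" "b * b = c + e *\<^sub>R 1" using nonneg_sqrt[OF c] by metis
  have "nonneg (ip G (lact G b z) (lact G b z))"
    using cstar_correspondenceD[OF G] z by (intro nonneg_if_positive hilbert_moduleD(10)) auto
  also have "ip G (lact G b z) (lact G b z) = ip G z (lact G (b * b) z)"
    using cstar_correspondenceD(2,3,5)[OF G] z b(1) by metis
  also have "\<dots> = ip G z (lact G c z) + e *\<^sub>R ip G z (lact G 1 z)"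
    using z by (simp add: b ip_lact_add ip_lact_scaleR)
  finally show "nonneg (ip G z (lact G c z) + e *\<^sub>R ip G z (lact G 1 z))" .
qed

text \<open>Complete positivity of the left action, by induction with the Schur complement of the last
  diagonal entry of \<open>N\<close>.\<close>

lemma kernel_nonneg:
  fixes N :: "nat \<Rightarrow> nat \<Rightarrow> 'a" and y :: "nat \<Rightarrow> 'y"
  assumes "\<And>i. i < m \<Longrightarrow> y i \<in> carrier G"
    and "\<And>i j. star (N i j) = N j i"
    and "\<And>a. nonneg (\<Sum>i<m. \<Sum>j<m. star (a i) * N i j * a j)"
  shows "nonneg (\<Sum>i<m. \<Sum>j<m. ip G (y i) (lact G (N i j) (y j)))"
  using assms
proof (induction m arbitrary: N)
  case (Suc m N)
  note GD = cstar_correspondenceD[OF G]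
  note HD = hilbert_moduleD[OF GD(1)]
  have yc: "i \<le> m \<Longrightarrow> y i \<in> carrier G" for i using Suc.prems(1) by simp
  note sN = Suc.prems(2)
  have Nmm: "nonneg (N m m)"
    using Suc.prems(3)[of "\<lambda>i. if i = m then 1 else 0"]
    by (simp add: if_distrib[of star] if_distrib[of "\<lambda>x. x * _"] if_distrib[of "\<lambda>x. _ * x"] cong: if_cong)
  show ?case
  proof (rule nonneg_eps)
    fix e :: real assume e: "e > 0"
    define c where "c = N m m + e *\<^sub>R 1"
    obtain r where r: "star r = r" "c * r = 1"
      using nonneg_inverse[OF Nmm e] by (auto simp: c_def)
    have sc: "star c = c" by (simp add: c_def star_add star_scaleR sN)
    then have rc: "r * c = 1" using star_mult[of c r] r by simp
    define N' where "N' i j = N i j - N i m * r * N m j" for i j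
    have IH: "nonneg (\<Sum>i<m. \<Sum>j<m. ip G (y i) (lact G (N' i j) (y j)))"
    proof (rule Suc.IH)
      show "star (N' i j) = N' j i" for i j
        by (simp add: N'_def star_diff star_mult sN r mult.assoc)
      fix a :: "nat \<Rightarrow> 'a"
      define s where "s = (\<Sum>j<m. N m j * a j)"
      have ss: "star s = (\<Sum>i<m. star (a i) * N i m)" by (simp add: s_def star_sum star_mult sN)
      \<comment> \<open>The last coordinate minimises the form whose last diagonal entry is
        \<open>c\<close>: it completes the square and leaves exactly the kernel \<open>N'\<close> on
        the first \<open>m\<close> coordinates.\<close>
      define b where "b i = (if i = m then - (r * s) else a i)" for i
      define A where "A = (\<Sum>i<m. \<Sum>j<m. star (a i) * N i j * a j)"
      have bm: "b m = - (r * s)" and bi: "i < m \<Longrightarrow> b i = a i" for i by (auto simp: b_def)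
      have "(\<Sum>i<Suc m. \<Sum>j<Suc m. star (b i) * N i j * b j) =
          (\<Sum>i<m. \<Sum>j<m. star (b i) * N i j * b j) + (\<Sum>i<m. star (b i) * N i m) * b m
          + (star (b m) * (\<Sum>j<m. N m j * b j) + star (b m) * N m m * b m)"
        by (simp add: sum.distrib sum_distrib_left sum_distrib_right mult.assoc)
      also have "\<dots> = A + star s * b m + (star (b m) * s + star (b m) * N m m * b m)"
        by (simp add: A_def bi flip: s_def ss)
      finally have 1: "(\<Sum>i<Suc m. \<Sum>j<Suc m. star (b i) * N i j * b j) =
         A + star s * b m + (star (b m) * s + star (b m) * N m m * b m)" .
      have "nonneg ((\<Sum>i<Suc m. \<Sum>j<Suc m. star (b i) * N i j * b j) + e *\<^sub>R (star (b m) * b m))"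
        using e by (intro nonneg_add Suc.prems(3) nonneg_scaleR nonneg_star_mult_self) auto
      also have "(\<Sum>i<Suc m. \<Sum>j<Suc m. star (b i) * N i j * b j) + e *\<^sub>R (star (b m) * b m) =
          A + star s * b m + star (b m) * s + star (b m) * c * b m"
        unfolding 1 by (simp add: c_def algebra_simps)
      also have "star (b m) * c * b m = star s * (r * c) * r * s"
        by (simp add: bm star_minus star_mult r(1) mult.assoc)
      also have "A + star s * b m + star (b m) * s + star s * (r * c) * r * s = A - star s * r * s"
        by (simp add: bm star_minus star_mult r(1) rc) (simp add: mult.assoc)
      also have "star s * r * s = (\<Sum>i<m. \<Sum>j<m. star (a i) * (N i m * r * N m j) * a j)"
      proof -
        have "star s * r * s = (\<Sum>i<m. star (a i) * N i m) * r * (\<Sum>j<m. N m j * a j)"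
          by (simp only: ss) (simp only: s_def)
        also have "\<dots> = (\<Sum>i<m. \<Sum>j<m. star (a i) * (N i m * r * N m j) * a j)"
          by (simp only: sum_distrib_left sum_distrib_right mult.assoc) (rule sum.swap)
        finally show ?thesis .
      qed
      also have "A - \<dots> = (\<Sum>i<m. \<Sum>j<m. star (a i) * N' i j * a j)"
        by (simp add: A_def N'_def algebra_simps sum_subtractf)
      finally show "nonneg (\<Sum>i<m. \<Sum>j<m. star (a i) * N' i j * a j)" .
    qed (use yc in auto)
    define u where "u = msum G (map (\<lambda>j. lact G (N m j) (y j)) [0..<m])"
    have set_u: "set (map (\<lambda>j. lact G (N m j) (y j)) [0..<m]) \<subseteq> carrier G"
      using yc GD by auto
    have u: "u \<in> carrier G" unfolding u_def by (rule msum_closed[OF GD(1) set_u])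
    have wu: "ip G w u = (\<Sum>j<m. ip G w (lact G (N m j) (y j)))" if "w \<in> carrier G" for w
      unfolding u_def ip_msum_right[OF GD(1) that set_u]
      by (simp add: comp_def interv_sum_list_conv_sum_set_nat atLeast0LessThan)
    have uw: "ip G u w = (\<Sum>i<m. ip G (y i) (lact G (N i m) w))" if "w \<in> carrier G" for w
      unfolding u_def ip_msum_left[OF GD(1) that set_u]
      using that yc by (simp add: comp_def interv_sum_list_conv_sum_set_nat atLeast0LessThan GD(3) sN)
    \<comment> \<open>The same completion of the square, now in \<open>G\<close>: the form of
      \<open>z\<close> with weight \<open>c\<close> collects all terms of the double sum with index
      \<open>m\<close>, together with the correction that \<open>N'\<close> subtracts.\<close>
    define z where "z = madd G (y m) (lact G r u)"
    have ru: "lact G r u \<in> carrier G" using GD u by simp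
    have ym: "y m \<in> carrier G" using yc by simp
    have z: "z \<in> carrier G" unfolding z_def using HD(2) ym ru by blast
    have "nonneg c" using Nmm e by (auto simp: c_def intro!: nonneg_add nonneg_scaleR)
    then have zz: "nonneg (ip G z (lact G c z))" by (rule ip_lact_nonneg[OF _ z])
    have left: "ip G (madd G v w) x = ip G v x + ip G w x"
      if "v \<in> carrier G" "w \<in> carrier G" "x \<in> carrier G" for v w x
      using semi_ip.form_add_left[OF semi_ip_hilbert_module[OF GD(1)]] that by blast
    have "ip G z (lact G c z) = ip G (y m) (lact G c (y m)) + ip G (y m) (lact G c (lact G r u))
        + (ip G (lact G r u) (lact G c (y m)) + ip G (lact G r u) (lact G c (lact G r u)))"
      unfolding z_def by (simp add: left ip_lact_madd ym ru GD(2) HD(2))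
    also have "ip G (y m) (lact G c (lact G r u)) = (\<Sum>j<m. ip G (y m) (lact G (N m j) (y j)))"
    proof -
      have "ip G (y m) (lact G c (lact G r u)) = ip G (lact G 1 (y m)) u"
        by (simp add: GD(3,5)[symmetric] GD(3) ym u r(2) flip: GD(5))
      also have "\<dots> = (\<Sum>j<m. ip G (y m) (lact G (N m j) (y j)))"
        using ym yc by (simp add: wu GD(2) GD(3) flip: GD(5))
      finally show ?thesis .
    qed
    also have "ip G (lact G r u) (lact G c (y m)) = (\<Sum>i<m. ip G (y i) (lact G (N i m) (y m)))"
    proof -
      have "ip G (lact G r u) (lact G c (y m)) = ip G u (lact G 1 (y m))"
        by (simp add: GD(2,3) ym u r(1) rc flip: GD(5))
      also have "\<dots> = (\<Sum>i<m. ip G (y i) (lact G (N i m) (y m)))"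
        using ym yc by (simp add: uw GD(2) flip: GD(5))
      finally show ?thesis .
    qed
    also have "ip G (lact G r u) (lact G c (lact G r u)) = (\<Sum>i<m. \<Sum>j<m. ip G (y i) (lact G (N i m * r * N m j) (y j)))"
    proof -
      have "ip G (lact G r u) (lact G c (lact G r u)) = ip G u (lact G r u)"
        by (simp add: GD(2,3) ym u r flip: GD(5))
      also have "\<dots> = (\<Sum>i<m. ip G (lact G (star (N i m * r)) (y i)) u)"
        using yc by (simp add: uw ru GD(3) u star_star flip: GD(5))
      also have "\<dots> = (\<Sum>i<m. \<Sum>j<m. ip G (y i) (lact G (N i m * r * N m j) (y j)))"
        using yc by (intro sum.cong refl) (auto simp: wu GD(2) GD(3) star_star intro!: sum.cong simp flip: GD(5))
      finally show ?thesis .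
    qed
    finally have "ip G z (lact G c z) + (\<Sum>i<m. \<Sum>j<m. ip G (y i) (lact G (N' i j) (y j))) =
        (\<Sum>i<Suc m. \<Sum>j<Suc m. ip G (y i) (lact G (N i j) (y j))) + e *\<^sub>R ip G (y m) (lact G 1 (y m))"
      using yc ym by (simp add: N'_def ip_lact_diff sum_subtractf sum.distrib c_def ip_lact_add ip_lact_scaleR)
    then show "nonneg ((\<Sum>i<Suc m. \<Sum>j<Suc m. ip G (y i) (lact G (N i j) (y j))) + e *\<^sub>R ip G (y m) (lact G 1 (y m)))"
      using nonneg_add[OF zz IH] by simp
  qed
qed simp

end

subsection \<open>Interior tensor products of correspondences\<close>

context semi_ip
begin

lemma dst_add_le:
  assumes "x \<in> C" "y \<in> C" "x' \<in> C" "y' \<in> C"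
  shows "dst (add x y) (add x' y') \<le> dst x x' + dst y y'"
proof -
  have "dst (add x y) (add x' y') = nrm (add (add x (act x' (- 1))) (add y (act y' (- 1))))"
    unfolding dst_def
    by (rule nrm_cong)
      (auto simp: assms diff_closed add_closed act_closed form_add_right form_act_right)
  also have "\<dots> \<le> dst x x' + dst y y'"
    unfolding dst_def by (intro nrm_add diff_closed assms)
  finally show ?thesis .
qed

lemma dst_act_le:
  assumes "x \<in> C" "y \<in> C"
  shows "dst (act x b) (act y b) \<le> norm b * dst x y"
proof -
  have "dst (act x b) (act y b) = nrm (act (add x (act y (- 1))) b)"
    unfolding dst_def
    by (rule nrm_cong)
      (auto simp: assms diff_closed act_closed form_act_right form_diff_right algebra_simps)
  also have "\<dots> \<le> norm b * dst x y"
    unfolding dst_def by (intro nrm_act diff_closed assms)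
  finally show ?thesis .
qed

lemma cauchyD: "cauchy X \<Longrightarrow> X n \<in> C"
  by (simp add: cauchy_def)

lemma cauchy_dominated:
  assumes X: "cauchy X" and Y: "\<And>n. Y n \<in> C" and le: "\<And>m n. dst (Y m) (Y n) \<le> K * dst (X m) (X n)"
  shows "cauchy Y"
  unfolding cauchy_def
proof (intro conjI allI impI Y)
  fix e :: real assume e: "e > 0"
  have K: "\<bar>K\<bar> + 1 > 0" by simp
  then obtain N where N: "\<And>m n. m \<ge> N \<Longrightarrow> n \<ge> N \<Longrightarrow> dst (X m) (X n) < e / (\<bar>K\<bar> + 1)"
    using X e unfolding cauchy_def by (metis divide_pos_pos)
  have "dst (Y m) (Y n) < e" if "m \<ge> N" "n \<ge> N" for m n
  proof -
    have "K * dst (X m) (X n) \<le> (\<bar>K\<bar> + 1) * dst (X m) (X n)" by (intro mult_right_mono) auto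
    also have "\<dots> < (\<bar>K\<bar> + 1) * (e / (\<bar>K\<bar> + 1))" by (intro mult_strict_left_mono N that K)
    also have "\<dots> = e" using K by simp
    finally show ?thesis using le[of m n] by simp
  qed
  then show "\<exists>N. \<forall>m\<ge>N. \<forall>n\<ge>N. dst (Y m) (Y n) < e" by blast
qed

lemma cauchy_add:
  assumes X: "cauchy X" and Y: "cauchy Y"
  shows "cauchy (\<lambda>n. add (X n) (Y n))"
  unfolding cauchy_def
proof (intro conjI allI impI)
  fix e :: real assume e: "e > 0"
  obtain N N' where "\<And>m n. m \<ge> N \<Longrightarrow> n \<ge> N \<Longrightarrow> dst (X m) (X n) < e / 2"
    and "\<And>m n. m \<ge> N' \<Longrightarrow> n \<ge> N' \<Longrightarrow> dst (Y m) (Y n) < e / 2"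
    using X Y e unfolding cauchy_def by (meson half_gt_zero)
  then have "dst (add (X m) (Y m)) (add (X n) (Y n)) < e" if "m \<ge> max N N'" "n \<ge> max N N'" for m n
    using dst_add_le[OF cauchyD[OF X] cauchyD[OF Y] cauchyD[OF X] cauchyD[OF Y], of m m n n] that
    by (smt (verit) field_sum_of_halves max.bounded_iff)
  then show "\<exists>N. \<forall>m\<ge>N. \<forall>n\<ge>N. dst (add (X m) (Y m)) (add (X n) (Y n)) < e" by blast
qed (use X Y cauchyD add_closed in auto)

lemma cauchy_const: "x \<in> C \<Longrightarrow> cauchy (\<lambda>_. x)"
  by (auto simp: cauchy_def dst_self)

text \<open>Serves where the limit of \<open>X\<close> is known only through its distances:
  \<open>l n\<close> is then the distance of \<open>X n\<close> from the limit.\<close>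

lemma cauchy_dst_lim:
  assumes "cauchy X" "\<And>n. (\<lambda>m. dst (X n) (X m)) \<longlonglongrightarrow> l n"
  shows "l \<longlonglongrightarrow> 0"
proof (rule LIMSEQ_I)
  fix e :: real assume "e > 0"
  then obtain N where N: "\<And>m n. m \<ge> N \<Longrightarrow> n \<ge> N \<Longrightarrow> dst (X m) (X n) < e / 2"
    using assms(1) unfolding cauchy_def by (meson half_gt_zero)
  have "0 \<le> l n \<and> l n \<le> e / 2" if "n \<ge> N" for n
  proof
    show "0 \<le> l n" by (rule LIMSEQ_le_const[OF assms(2)]) auto
    show "l n \<le> e / 2"
      by (rule LIMSEQ_le_const2[OF assms(2)]) (use N that less_imp_le in blast)
  qed
  then show "\<exists>N. \<forall>n\<ge>N. norm (l n - 0) < e" using \<open>e > 0\<close> by (intro exI[of _ N]) fastforce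
qed

end

section \<open>Lists representing elements of an interior tensor product\<close>

definition tlists :: "('a, 'b, 'x) corr \<Rightarrow> ('c, 'd, 'y) corr \<Rightarrow> ('x \<times> 'y) list set"
  where "tlists F G = {u. set u \<subseteq> carrier F \<times> carrier G}"

definition lists_ract :: "('b, 'c, 'y) corr \<Rightarrow> ('x \<times> 'y) list \<Rightarrow> 'c \<Rightarrow> ('x \<times> 'y) list"
  where "lists_ract G u c = map (\<lambda>(x, y). (x, ract G y c)) u"

definition lists_lact :: "('a, 'b, 'x) corr \<Rightarrow> 'a \<Rightarrow> ('x \<times> 'y) list \<Rightarrow> ('x \<times> 'y) list"
  where "lists_lact F a u = map (\<lambda>(x, y). (lact F a x, y)) u"

lemma pre_ip_nth:
  "pre_ip F G u v = (\<Sum>i<length u. \<Sum>j<length v.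
    ip G (snd (u ! i)) (lact G (ip F (fst (u ! i)) (fst (v ! j))) (snd (v ! j))))"
  by (simp add: pre_ip_def sum_list_sum_nth atLeast0LessThan case_prod_beta)

lemma tlists_nth: "u \<in> tlists F G \<Longrightarrow> i < length u \<Longrightarrow> fst (u ! i) \<in> carrier F \<and> snd (u ! i) \<in> carrier G"
  unfolding tlists_def using nth_mem[of i u] by fastforce

lemma pre_ip_append_right: "pre_ip F G u (v @ w) = pre_ip F G u v + pre_ip F G u w"
  by (induction u) (auto simp: pre_ip_def algebra_simps)

locale tens =
  fixes F :: "('a::cstar_algebra, 'b::cstar_algebra, 'x) corr"
    and G :: "('b, 'c::cstar_algebra, 'y) corr"
  assumes F: "cstar_correspondence F" and G: "cstar_correspondence G"
begin

lemmas FD = cstar_correspondenceD[OF F] and GD = cstar_correspondenceD[OF G]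
lemmas FH = hilbert_moduleD[OF FD(1)] and GH = hilbert_moduleD[OF GD(1)]

lemma pre_ip_star:
  assumes u: "u \<in> tlists F G" and v: "v \<in> tlists F G"
  shows "star (pre_ip F G u v) = pre_ip F G v u"
proof -
  have "star (ip G (snd (u ! i)) (lact G (ip F (fst (u ! i)) (fst (v ! j))) (snd (v ! j)))) =
    ip G (snd (v ! j)) (lact G (ip F (fst (v ! j)) (fst (u ! i))) (snd (u ! i)))"
    if "i < length u" "j < length v" for i j
    using tlists_nth[OF u that(1)] tlists_nth[OF v that(2)]
    by (simp add: GH(9) FH(9) GD(2,3))
  then show ?thesis
    unfolding pre_ip_nth star_sum by (subst sum.swap) (intro sum.cong refl, auto)
qed

text \<open>The Gram kernel of the first components meets the hypothesis of
  \<open>kernel_nonneg\<close>, because its value at the coefficients \<open>a i\<close> is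
  \<open>ip F s s\<close> for \<open>s = \<Sum> x\<^sub>i a\<^sub>i\<close>.\<close>

lemma pre_ip_nonneg:
  assumes u: "u \<in> tlists F G"
  shows "nonneg (pre_ip F G u u)"
proof -
  \<comment> \<open>\<open>kernel_nonneg\<close> asks for hermitian symmetry at all indices, so the
    family is continued by zero past the end of the list.\<close>
  define x where "x i = (if i < length u then fst (u ! i) else mzero F)" for i
  have x: "x i \<in> carrier F" for i using tlists_nth[OF u] FH(1) by (auto simp: x_def)
  have "nonneg (\<Sum>i<length u. \<Sum>j<length u. ip G (snd (u ! i)) (lact G (ip F (x i) (x j)) (snd (u ! j))))"
  proof (rule kernel_nonneg[OF G])
    show "star (ip F (x i) (x j)) = ip F (x j) (x i)" for i j using x FH(9) by simp
    fix a :: "nat \<Rightarrow> 'b"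
    define s where "s = msum F (map (\<lambda>i. ract F (x i) (a i)) [0..<length u])"
    have set: "set (map (\<lambda>i. ract F (x i) (a i)) [0..<length u]) \<subseteq> carrier F" using x FH(6) by auto
    have s: "s \<in> carrier F" unfolding s_def by (rule msum_closed[OF FD(1) set])
    have "ip F s s = (\<Sum>i<length u. ip F (ract F (x i) (a i)) s)"
      by (subst (1) s_def, subst ip_msum_left[OF FD(1) s set])
        (simp add: comp_def interv_sum_list_conv_sum_set_nat atLeast0LessThan)
    also have "\<dots> = (\<Sum>i<length u. \<Sum>j<length u. ip F (ract F (x i) (a i)) (ract F (x j) (a j)))"
      by (intro sum.cong refl, subst s_def, subst ip_msum_right[OF FD(1) _ set])
        (auto simp: comp_def interv_sum_list_conv_sum_set_nat atLeast0LessThan FH(6) x)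
    also have "\<dots> = (\<Sum>i<length u. \<Sum>j<length u. star (a i) * ip F (x i) (x j) * a j)"
    proof (intro sum.cong refl)
      fix i j
      have "ip F (ract F (x i) (a i)) (x j) = star (ip F (x j) (ract F (x i) (a i)))"
        using x FH(6,9) by simp
      also have "\<dots> = star (a i) * ip F (x i) (x j)" using x by (simp add: star_mult FH(8,9))
      finally show "ip F (ract F (x i) (a i)) (ract F (x j) (a j)) = star (a i) * ip F (x i) (x j) * a j"
        using x FH(6,8) by simp
    qed
    finally show "nonneg (\<Sum>i<length u. \<Sum>j<length u. star (a i) * ip F (x i) (x j) * a j)"
      using FH(10)[OF s] nonneg_if_positive by metis
  qed (use tlists_nth[OF u] in auto)
  then show ?thesis by (simp add: pre_ip_nth x_def)
qed

lemma pre_ip_ract: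
  assumes "u \<in> tlists F G" "v \<in> tlists F G"
  shows "pre_ip F G u (lists_ract G v c) = pre_ip F G u v * c"
  unfolding pre_ip_nth sum_distrib_right
  using tlists_nth[OF assms(1)] tlists_nth[OF assms(2)]
  by (intro sum.cong) (auto simp: lists_ract_def case_prod_beta ip_lact_ract[OF G])

sublocale semi_ip "tlists F G" "(@)" "lists_ract G" "pre_ip F G"
proof
  show "lists_ract G u c \<in> tlists F G" if "u \<in> tlists F G" for u c
    using that GH(6) by (fastforce simp: tlists_def lists_ract_def)
qed (auto simp: pre_ip_append_right pre_ip_star pre_ip_nonneg pre_ip_ract, auto simp: tlists_def)

lemma pre_dist_eq: "pre_dist F G = dst"
  by (intro ext) (simp add: pre_dist_def dst_def nrm_def lists_ract_def Let_def)

lemma pre_cauchy_eq: "pre_cauchy F G = cauchy"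
  by (intro ext, unfold pre_cauchy_def cauchy_def pre_dist_eq) (simp add: tlists_def)

lemma tclass_iff: "Y \<in> tclass F G X \<longleftrightarrow> cauchy Y \<and> (\<lambda>n. dst (X n) (Y n)) \<longlonglongrightarrow> 0"
  by (simp add: tclass_def pre_cauchy_eq pre_dist_eq)

lemma tclass_self: "cauchy X \<Longrightarrow> X \<in> tclass F G X"
  by (simp add: tclass_iff dst_self cauchyD)

lemma tclass_carrier: "cauchy X \<Longrightarrow> tclass F G X \<in> carrier (tensor F G)"
  by (simp add: tensor_def pre_cauchy_eq)

lemma dst_tendsto_0_trans:
  assumes "cauchy X" "cauchy Y" "cauchy Z"
    "(\<lambda>n. dst (X n) (Y n)) \<longlonglongrightarrow> 0" "(\<lambda>n. dst (Y n) (Z n)) \<longlonglongrightarrow> 0"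
  shows "(\<lambda>n. dst (X n) (Z n)) \<longlonglongrightarrow> 0"
proof (rule tendsto_sandwich[of "\<lambda>_. 0" _ _ "\<lambda>n. dst (X n) (Y n) + dst (Y n) (Z n)"])
  show "(\<lambda>n. dst (X n) (Y n) + dst (Y n) (Z n)) \<longlonglongrightarrow> 0"
    using tendsto_add[OF assms(4,5)] by simp
  show "\<forall>\<^sub>F n in sequentially. dst (X n) (Z n) \<le> dst (X n) (Y n) + dst (Y n) (Z n)"
    using dst_triangle cauchyD assms(1-3) by (intro always_eventually allI) blast
qed auto

lemma carrierE:
  assumes "z \<in> carrier (tensor F G)"
  obtains X where "cauchy X" "z = tclass F G X"
  using assms by (auto simp: tensor_def pre_cauchy_eq)

lemma class_dst:
  assumes "z \<in> carrier (tensor F G)" "X \<in> z" "Y \<in> z"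
  shows "(\<lambda>n. dst (X n) (Y n)) \<longlonglongrightarrow> 0"
proof -
  obtain Z where Z: "cauchy Z" "z = tclass F G Z" using carrierE[OF assms(1)] by blast
  have X: "cauchy X" "(\<lambda>n. dst (Z n) (X n)) \<longlonglongrightarrow> 0" and Y: "cauchy Y" "(\<lambda>n. dst (Z n) (Y n)) \<longlonglongrightarrow> 0"
    using assms Z by (auto simp: tclass_iff)
  have "(\<lambda>n. dst (X n) (Z n)) \<longlonglongrightarrow> 0"
    using X(2) dst_sym[OF cauchyD[OF X(1)] cauchyD[OF Z(1)]] by simp
  then show ?thesis using dst_tendsto_0_trans X Y Z by blast
qed

lemma class_cauchy: "z \<in> carrier (tensor F G) \<Longrightarrow> X \<in> z \<Longrightarrow> cauchy X"
  by (metis carrierE tclass_iff)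

lemma class_eqI:
  assumes z: "z \<in> carrier (tensor F G)" and w: "w \<in> carrier (tensor F G)" and X: "X \<in> z" "X \<in> w"
  shows "z = w"
proof -
  have "z \<subseteq> w" if z: "z \<in> carrier (tensor F G)" and w: "w \<in> carrier (tensor F G)"
    and X: "X \<in> z" "X \<in> w" for z w
  proof
    fix Y assume Y: "Y \<in> z"
    obtain Z where Z: "cauchy Z" "w = tclass F G Z" using carrierE[OF w] by blast
    have "(\<lambda>n. dst (Z n) (X n)) \<longlonglongrightarrow> 0" "cauchy X" using X Z by (auto simp: tclass_iff)
    then show "Y \<in> w"
      using dst_tendsto_0_trans[OF Z(1), of X Y] class_dst[OF z X(1) Y] class_cauchy[OF z Y]
      by (simp add: Z tclass_iff)
  qed
  then show ?thesis using assms by blast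
qed

lemma trep_in:
  assumes "z \<in> carrier (tensor F G)"
  shows "trep z \<in> z"
proof -
  obtain X where "cauchy X" "z = tclass F G X" using carrierE[OF assms] by blast
  then have "X \<in> z" using tclass_self by simp
  then show ?thesis unfolding trep_def by (rule someI[of "\<lambda>X. X \<in> z"])
qed

lemma ip_tendsto:
  assumes "z \<in> carrier (tensor F G)" "w \<in> carrier (tensor F G)" "X \<in> z" "Y \<in> w"
  shows "(\<lambda>n. pre_ip F G (X n) (Y n)) \<longlonglongrightarrow> ip (tensor F G) z w"
proof -
  have c: "cauchy X" "cauchy Y" "cauchy (trep z)" "cauchy (trep w)"
    using assms class_cauchy trep_in by blast+
  have 1: "(\<lambda>n. pre_ip F G (trep z n) (trep w n)) \<longlonglongrightarrow> ip (tensor F G) z w"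
    using form_convergent[OF c(3,4)] by (simp add: tensor_def convergent_LIMSEQ_iff)
  have "(\<lambda>n. pre_ip F G (X n) (Y n) - pre_ip F G (trep z n) (trep w n)) \<longlonglongrightarrow> 0"
    using assms c class_dst trep_in by (intro form_diff_tendsto_0) blast+
  from tendsto_add[OF this 1] show ?thesis by simp
qed

lemma class_madd:
  assumes "z \<in> carrier (tensor F G)" "w \<in> carrier (tensor F G)" "X \<in> z" "Y \<in> w"
  shows "madd (tensor F G) z w \<in> carrier (tensor F G)" "(\<lambda>n. X n @ Y n) \<in> madd (tensor F G) z w"
proof -
  have c: "cauchy X" "cauchy Y" "cauchy (trep z)" "cauchy (trep w)"
    using assms class_cauchy trep_in by blast+
  have eq: "madd (tensor F G) z w = tclass F G (\<lambda>n. trep z n @ trep w n)" by (simp add: tensor_def)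
  show "madd (tensor F G) z w \<in> carrier (tensor F G)"
    unfolding eq by (intro tclass_carrier cauchy_add c)
  have "(\<lambda>n. dst (trep z n @ trep w n) (X n @ Y n)) \<longlonglongrightarrow> 0"
  proof (rule tendsto_sandwich[of "\<lambda>_. 0" _ _ "\<lambda>n. dst (trep z n) (X n) + dst (trep w n) (Y n)"])
    show "(\<lambda>n. dst (trep z n) (X n) + dst (trep w n) (Y n)) \<longlonglongrightarrow> 0"
      using tendsto_add[OF class_dst[OF assms(1) trep_in assms(3)] class_dst[OF assms(2) trep_in assms(4)]]
        assms by simp
  qed (use dst_add_le[OF cauchyD[OF c(3)] cauchyD[OF c(4)] cauchyD[OF c(1)] cauchyD[OF c(2)]] in auto)
  then show "(\<lambda>n. X n @ Y n) \<in> madd (tensor F G) z w"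
    unfolding eq tclass_iff by (simp add: cauchy_add c)
qed

lemma class_ract:
  assumes "z \<in> carrier (tensor F G)" "X \<in> z"
  shows "ract (tensor F G) z b \<in> carrier (tensor F G)" "(\<lambda>n. lists_ract G (X n) b) \<in> ract (tensor F G) z b"
proof -
  have c: "cauchy X" "cauchy (trep z)" using assms class_cauchy trep_in by blast+
  have eq: "ract (tensor F G) z b = tclass F G (\<lambda>n. lists_ract G (trep z n) b)"
    by (simp add: tensor_def lists_ract_def)
  have ca: "cauchy (\<lambda>n. lists_ract G (Z n) b)" if "cauchy Z" for Z
    by (rule cauchy_dominated[OF that, of _ "norm b"])
      (use that cauchyD act_closed dst_act_le in blast)+
  show "ract (tensor F G) z b \<in> carrier (tensor F G)"
    unfolding eq by (intro tclass_carrier ca c)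
  have "(\<lambda>n. dst (lists_ract G (trep z n) b) (lists_ract G (X n) b)) \<longlonglongrightarrow> 0"
  proof (rule tendsto_sandwich[of "\<lambda>_. 0" _ _ "\<lambda>n. norm b * dst (trep z n) (X n)"])
    show "(\<lambda>n. norm b * dst (trep z n) (X n)) \<longlonglongrightarrow> 0"
      using tendsto_mult[OF tendsto_const class_dst[OF assms(1) trep_in assms(2)]] assms by simp
  qed (use dst_act_le[OF cauchyD[OF c(2)] cauchyD[OF c(1)]] in auto)
  then show "(\<lambda>n. lists_ract G (X n) b) \<in> ract (tensor F G) z b"
    unfolding eq tclass_iff by (simp add: ca c)
qed

lemma lists_lact_closed: "u \<in> tlists F G \<Longrightarrow> lists_lact F a u \<in> tlists F G"
  using FD(2) by (fastforce simp: tlists_def lists_lact_def)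

lemma pre_ip_lact_left:
  assumes "u \<in> tlists F G" "v \<in> tlists F G"
  shows "pre_ip F G (lists_lact F a u) v = pre_ip F G u (lists_lact F (star a) v)"
  unfolding pre_ip_nth using tlists_nth[OF assms(1)] tlists_nth[OF assms(2)]
  by (auto simp: lists_lact_def case_prod_beta FD(3) intro!: sum.cong)

lemma lists_lact_mult: "u \<in> tlists F G \<Longrightarrow> lists_lact F a (lists_lact F b u) = lists_lact F (a * b) u"
  using FD(5) by (fastforce simp: lists_lact_def tlists_def)

lemma pre_ip_lact_add:
  assumes "u \<in> tlists F G" "v \<in> tlists F G"
  shows "pre_ip F G u (lists_lact F (a + b) v) = pre_ip F G u (lists_lact F a v) + pre_ip F G u (lists_lact F b v)"
  unfolding pre_ip_nth using tlists_nth[OF assms(1)] tlists_nth[OF assms(2)]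
  by (auto simp: lists_lact_def case_prod_beta ip_lact_add[OF F] ip_lact_add[OF G]
      simp flip: sum.distrib intro!: sum.cong)

lemma pre_ip_lact_scaleR:
  assumes "u \<in> tlists F G" "v \<in> tlists F G"
  shows "pre_ip F G u (lists_lact F (r *\<^sub>R a) v) = r *\<^sub>R pre_ip F G u (lists_lact F a v)"
  unfolding pre_ip_nth using tlists_nth[OF assms(1)] tlists_nth[OF assms(2)]
  by (auto simp: lists_lact_def case_prod_beta ip_lact_scaleR[OF F] ip_lact_scaleR[OF G] scaleR_sum_right
      intro!: sum.cong)

text \<open>With \<open>e\<^sup>2 = \<parallel>a\<parallel>\<^sup>2 + 1 - a\<^sup>* a\<close> the form of \<open>e u\<close> bounds that of \<open>a u\<close>. The left action need not be
  unital, hence the separate treatment of the projection \<open>1\<close>.\<close>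

lemma nrm_lact:
  assumes u: "u \<in> tlists F G"
  shows "nrm (lists_lact F a u) \<le> sqrt ((norm a)\<^sup>2 + 1) * nrm u"
proof -
  define r where "r = (norm a)\<^sup>2 + 1"
  have "nonneg (of_real ((norm a)\<^sup>2) - star a * a)"
    by (rule nonneg_norm_minus) (auto simp: star_mult star_star cstar_identity)
  then obtain e where e: "star e = e" "e * e = of_real ((norm a)\<^sup>2) - star a * a + 1 *\<^sub>R 1"
    using nonneg_sqrt zero_less_one by blast
  have lu: "lists_lact F b u \<in> tlists F G" for b by (rule lists_lact_closed[OF u])
  have sq: "pre_ip F G (lists_lact F b u) (lists_lact F b u) = pre_ip F G u (lists_lact F (star b * b) u)" for b
    by (simp add: pre_ip_lact_left u lu lists_lact_mult)
  define v where "v = u @ lists_ract G (lists_lact F 1 u) (- 1)"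
  have v: "v \<in> tlists F G" unfolding v_def by (intro diff_closed u lu)
  have vv: "pre_ip F G v v = pre_ip F G u u - pre_ip F G u (lists_lact F 1 u)"
    unfolding v_def
    by (simp add: form_diff_left form_diff_right u lu act_closed add_closed pre_ip_lact_left lists_lact_mult)
  have ee: "star a * a + e * e = r *\<^sub>R 1"
    by (simp add: e r_def of_real_def algebra_simps)
  have "pre_ip F G (lists_lact F a u) (lists_lact F a u) + pre_ip F G (lists_lact F e u) (lists_lact F e u)
      = r *\<^sub>R pre_ip F G u (lists_lact F 1 u)"
    unfolding sq e(1) by (simp add: pre_ip_lact_scaleR u ee flip: pre_ip_lact_add)
  then have "r *\<^sub>R pre_ip F G u u - pre_ip F G (lists_lact F a u) (lists_lact F a u)
      = pre_ip F G (lists_lact F e u) (lists_lact F e u) + r *\<^sub>R pre_ip F G v v"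
    unfolding vv by (simp add: algebra_simps)
  moreover have "nonneg (pre_ip F G (lists_lact F e u) (lists_lact F e u) + r *\<^sub>R pre_ip F G v v)"
    by (intro nonneg_add nonneg_scaleR form_nonneg lu v) (simp add: r_def)
  ultimately have "nonneg (r *\<^sub>R pre_ip F G u u - pre_ip F G (lists_lact F a u) (lists_lact F a u))"
    by metis
  then have "norm (pre_ip F G (lists_lact F a u) (lists_lact F a u)) \<le> norm (r *\<^sub>R pre_ip F G u u)"
    by (rule nonneg_norm_mono[OF form_nonneg[OF lu]])
  then have "norm (pre_ip F G (lists_lact F a u) (lists_lact F a u)) \<le> r * norm (pre_ip F G u u)"
    by (simp add: r_def)
  then show ?thesis unfolding nrm_def r_def[symmetric] by (simp flip: real_sqrt_mult)
qed

lemma class_lact: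
  assumes "z \<in> carrier (tensor F G)"
  shows "lact (tensor F G) a z \<in> carrier (tensor F G)"
    "(\<lambda>n. lists_lact F a (trep z n)) \<in> lact (tensor F G) a z"
proof -
  have c: "cauchy (trep z)" using assms class_cauchy trep_in by blast
  have eq: "lact (tensor F G) a z = tclass F G (\<lambda>n. lists_lact F a (trep z n))"
    by (simp add: tensor_def lists_lact_def)
  have ca: "cauchy (\<lambda>n. lists_lact F a (trep z n))"
  proof (rule cauchy_dominated[OF c])
    show "lists_lact F a (trep z n) \<in> tlists F G" for n by (rule lists_lact_closed[OF cauchyD[OF c]])
    fix m n
    have "lists_lact F a (trep z m) @ lists_ract G (lists_lact F a (trep z n)) (- 1) =
        lists_lact F a (trep z m @ lists_ract G (trep z n) (- 1))"
      by (simp add: lists_lact_def lists_ract_def case_prod_beta)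
    then show "dst (lists_lact F a (trep z m)) (lists_lact F a (trep z n)) \<le> sqrt ((norm a)\<^sup>2 + 1) * dst (trep z m) (trep z n)"
      unfolding dst_def by (metis nrm_lact diff_closed cauchyD[OF c])
  qed
  show "lact (tensor F G) a z \<in> carrier (tensor F G)"
    unfolding eq by (rule tclass_carrier[OF ca])
  show "(\<lambda>n. lists_lact F a (trep z n)) \<in> lact (tensor F G) a z"
    unfolding eq by (rule tclass_self[OF ca])
qed

lemma elem_tensor_class:
  assumes "x \<in> carrier F" "y \<in> carrier G"
  shows "elem_tensor F G x y \<in> carrier (tensor F G)" "(\<lambda>_. [(x, y)]) \<in> elem_tensor F G x y"
  using assms unfolding elem_tensor_def
  by (auto intro!: tclass_carrier tclass_self cauchy_const simp: tlists_def)

text \<open>A product system asserts that some isomorphism extends multiplication, whereas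
  \<open>mult_iso\<close> is defined by limits. The two agree because \<Phi> preserves inner
  products, hence the distances in which \<open>tensor_lift\<close> takes its limit.\<close>

lemma tensor_lift_eq_iso:
  assumes K: "hilbert_module K" and iso: "corr_iso (tensor F G) K \<Phi>"
    and m: "\<And>x y. x \<in> carrier F \<Longrightarrow> y \<in> carrier G \<Longrightarrow> \<Phi> (elem_tensor F G x y) = m x y"
    and t: "t \<in> carrier (tensor F G)"
  shows "tensor_lift K m t = \<Phi> t"
proof -
  interpret K: semi_ip "carrier K" "madd K" "ract K" "ip K" by (rule semi_ip_hilbert_module[OF K])
  note KH = hilbert_moduleD[OF K]
  have mdist: "mdist K = K.dst" by (intro ext) (simp add: mdist_def mnorm_def K.dst_def K.nrm_def)
  have iso: "bij_betw \<Phi> (carrier (tensor F G)) (carrier K)"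
    "\<And>x y. x \<in> carrier (tensor F G) \<Longrightarrow> y \<in> carrier (tensor F G) \<Longrightarrow> \<Phi> (madd (tensor F G) x y) = madd K (\<Phi> x) (\<Phi> y)"
    "\<And>x b. x \<in> carrier (tensor F G) \<Longrightarrow> \<Phi> (ract (tensor F G) x b) = ract K (\<Phi> x) b"
    "\<And>x y. x \<in> carrier (tensor F G) \<Longrightarrow> y \<in> carrier (tensor F G) \<Longrightarrow> ip K (\<Phi> x) (\<Phi> y) = ip (tensor F G) x y"
    using iso by (auto simp: corr_iso_def)
  have \<Phi>c: "\<Phi> z \<in> carrier K" if "z \<in> carrier (tensor F G)" for z
    using iso(1) that by (auto simp: bij_betw_def)
  have const: "tclass F G (\<lambda>_. u) \<in> carrier (tensor F G) \<and> \<Phi> (tclass F G (\<lambda>_. u)) = msum K (map (\<lambda>(x, y). m x y) u)"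
    if "u \<in> tlists F G" for u
    using that
  proof (induction u)
    case Nil
    have c: "tclass F G (\<lambda>_. []) \<in> carrier (tensor F G)" "(\<lambda>_. []) \<in> tclass F G (\<lambda>_. [])"
      using Nil by (auto intro!: tclass_carrier tclass_self cauchy_const)
    then have "(\<lambda>n. pre_ip F G [] []) \<longlonglongrightarrow> ip (tensor F G) (tclass F G (\<lambda>_. [])) (tclass F G (\<lambda>_. []))"
      by (intro ip_tendsto) auto
    then have "ip (tensor F G) (tclass F G (\<lambda>_. [])) (tclass F G (\<lambda>_. [])) = 0"
      by (simp add: pre_ip_def LIMSEQ_const_iff)
    then show ?case using c KH(11) iso(4) \<Phi>c by (simp add: msum_def)
  next
    case (Cons p u)
    obtain x y where p: "p = (x, y)" by (cases p)
    have u: "u \<in> tlists F G" and xy: "x \<in> carrier F" "y \<in> carrier G"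
      using Cons.prems by (auto simp: tlists_def p)
    have IH: "tclass F G (\<lambda>_. u) \<in> carrier (tensor F G)" "\<Phi> (tclass F G (\<lambda>_. u)) = msum K (map (\<lambda>(x, y). m x y) u)"
      using Cons.IH[OF u] by auto
    have c: "tclass F G (\<lambda>_. p # u) \<in> carrier (tensor F G)" "(\<lambda>_. p # u) \<in> tclass F G (\<lambda>_. p # u)"
      using Cons.prems by (auto intro!: tclass_carrier tclass_self cauchy_const)
    have "(\<lambda>_. p # u) \<in> madd (tensor F G) (elem_tensor F G x y) (tclass F G (\<lambda>_. u))"
      using class_madd(2)[OF elem_tensor_class(1)[OF xy] IH(1) elem_tensor_class(2)[OF xy] tclass_self[OF cauchy_const[OF u]]]
      by (simp add: p)
    then have "tclass F G (\<lambda>_. p # u) = madd (tensor F G) (elem_tensor F G x y) (tclass F G (\<lambda>_. u))"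
      using class_eqI[OF c(1)] c(2) class_madd(1)[OF elem_tensor_class(1)[OF xy] IH(1) elem_tensor_class(2)[OF xy] tclass_self[OF cauchy_const[OF u]]]
      by blast
    then show ?case
      using c(1) iso(2)[OF elem_tensor_class(1)[OF xy] IH(1)] IH(2) m[OF xy] by (simp add: p msum_def)
  qed
  have dist: "(\<lambda>k. dst (X k) (Y k)) \<longlonglongrightarrow> K.dst (\<Phi> s) (\<Phi> w)"
    if "s \<in> carrier (tensor F G)" "w \<in> carrier (tensor F G)" "X \<in> s" "Y \<in> w" for s w X Y
  proof -
    define d where "d = madd (tensor F G) s (ract (tensor F G) w (- 1))"
    have d: "d \<in> carrier (tensor F G)" "(\<lambda>k. X k @ lists_ract G (Y k) (- 1)) \<in> d"
      unfolding d_def by (rule class_madd[OF that(1) class_ract(1) that(3) class_ract(2)], fact+)+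
    have "\<Phi> d = madd K (\<Phi> s) (ract K (\<Phi> w) (- 1))"
      unfolding d_def using iso(2,3) that class_ract(1) by metis
    then have "K.dst (\<Phi> s) (\<Phi> w) = sqrt (norm (ip (tensor F G) d d))"
      using iso(4)[OF d(1) d(1)] by (simp add: K.dst_def K.nrm_def)
    then show ?thesis
      unfolding dst_def nrm_def using ip_tendsto[OF d(1) d(1) d(2) d(2)]
      by (auto intro!: tendsto_intros)
  qed
  show ?thesis
    unfolding tensor_lift_def
  proof (rule the_equality)
    \<comment> \<open>The distance of the \<open>n\<close>-th finite sum from
      \<open>\<Phi> t\<close> is the limit over \<open>k\<close> of the distances between
      \<open>X n\<close> and \<open>X k\<close>, and these are uniformly small for large
      \<open>n\<close> by the Cauchy property.\<close>
    have "(\<lambda>n. K.dst (msum K (map (\<lambda>(x, y). m x y) (X n))) (\<Phi> t)) \<longlonglongrightarrow> 0" if X: "X \<in> t" for X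
    proof (rule cauchy_dst_lim[OF class_cauchy[OF t X]])
      fix n
      have Xn: "X n \<in> tlists F G" using class_cauchy[OF t X] cauchyD by blast
      show "(\<lambda>k. dst (X n) (X k)) \<longlonglongrightarrow> K.dst (msum K (map (\<lambda>(x, y). m x y) (X n))) (\<Phi> t)"
        using dist[OF conjunct1[OF const[OF Xn]] t tclass_self[OF cauchy_const[OF Xn]] X] const[OF Xn] by simp
    qed
    then show *: "\<Phi> t \<in> carrier K \<and> (\<forall>X\<in>t. (\<lambda>n. mdist K (msum K (map (\<lambda>(x, y). m x y) (X n))) (\<Phi> t)) \<longlonglongrightarrow> 0)"
      using \<Phi>c[OF t] by (simp add: mdist)
    fix w assume w: "w \<in> carrier K \<and> (\<forall>X\<in>t. (\<lambda>n. mdist K (msum K (map (\<lambda>(x, y). m x y) (X n))) w) \<longlonglongrightarrow> 0)"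
    define X where "X = trep t"
    have X: "X \<in> t" unfolding X_def by (rule trep_in[OF t])
    define a where "a n = msum K (map (\<lambda>(x, y). m x y) (X n))" for n
    have a: "a n \<in> carrier K" for n
      using const[of "X n"] \<Phi>c class_cauchy[OF t X] cauchyD by (metis a_def)
    have "(\<lambda>n. K.dst (a n) w + K.dst (a n) (\<Phi> t)) \<longlonglongrightarrow> 0 + 0"
      using w * X by (intro tendsto_add) (auto simp: mdist a_def)
    moreover have "K.dst w (\<Phi> t) \<le> K.dst (a n) w + K.dst (a n) (\<Phi> t)" for n
      using K.dst_triangle[of w "a n" "\<Phi> t"] K.dst_sym[of w "a n"] a w \<Phi>c[OF t] by simp
    ultimately have "K.dst w (\<Phi> t) \<le> 0"
      by (intro LIMSEQ_le_const[of "\<lambda>n. K.dst (a n) w + K.dst (a n) (\<Phi> t)"]) auto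
    then have zero: "ip K (madd K w (ract K (\<Phi> t) (- 1))) (madd K w (ract K (\<Phi> t) (- 1))) = 0"
      by (simp add: K.dst_def K.nrm_def antisym)
    have \<Phi>t: "\<Phi> t \<in> carrier K" by (rule \<Phi>c[OF t])
    define n where "n = ract K (\<Phi> t) (- 1)"
    have n: "n \<in> carrier K" unfolding n_def using KH(6) \<Phi>t by blast
    have wn: "madd K w n = mzero K" using zero w KH(2,11) n unfolding n_def by blast
    have "ip K (madd K (\<Phi> t) n) (madd K (\<Phi> t) n) = 0"
      using K.dst_self[OF \<Phi>t] by (simp add: K.dst_def K.nrm_def n_def)
    then have tn: "madd K (\<Phi> t) n = mzero K" using KH(2,11) n \<Phi>t by blast
    have "w = madd K w (madd K n (\<Phi> t))" using tn KH(4,5) n \<Phi>t w by metis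
    also have "\<dots> = madd K (madd K w n) (\<Phi> t)" using KH(3) n \<Phi>t w by metis
    also have "\<dots> = \<Phi> t" using wn KH(1,4,5) \<Phi>t by metis
    finally show "w = \<Phi> t" .
  qed
qed

end

section \<open>The multiplication isomorphisms of a product system\<close>

lemma product_systemD:
  assumes "product_system E"
  shows "mult E (mult E x y) z = mult E x (mult E y z)"
    "cstar_correspondence (fibre E n)"
    "corr_iso algebra_corr (fibre E 0) (coeff E)"
    "x \<in> carrier (fibre E n) \<Longrightarrow> y \<in> carrier (fibre E m) \<Longrightarrow> mult E x y \<in> carrier (fibre E (n + m))"
    "\<exists>\<Phi>. corr_iso (tensor (fibre E n) (fibre E m)) (fibre E (n + m)) \<Phi> \<and>
       (\<forall>x\<in>carrier (fibre E n). \<forall>y\<in>carrier (fibre E m).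
          \<Phi> (elem_tensor (fibre E n) (fibre E m) x y) = mult E x y)"
  using assms by (auto simp: product_system_def)

lemma tens_fibre: "product_system E \<Longrightarrow> tens (fibre E n) (fibre E m)"
  by standard (auto simp: product_systemD)

lemma corr_iso_mult_iso:
  assumes E: "product_system E"
  shows "corr_iso (tensor (fibre E n) (fibre E m)) (fibre E (n + m)) (mult_iso E n m)"
proof -
  interpret tens "fibre E n" "fibre E m" by (rule tens_fibre[OF E])
  obtain \<Phi> where iso: "corr_iso (tensor (fibre E n) (fibre E m)) (fibre E (n + m)) \<Phi>"
    and \<Phi>: "\<And>x y. x \<in> carrier (fibre E n) \<Longrightarrow> y \<in> carrier (fibre E m) \<Longrightarrow>
          \<Phi> (elem_tensor (fibre E n) (fibre E m) x y) = mult E x y"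
    using product_systemD(5)[OF E] by blast
  have eq: "mult_iso E n m t = \<Phi> t" if "t \<in> carrier (tensor (fibre E n) (fibre E m))" for t
    unfolding mult_iso_def
    by (rule tensor_lift_eq_iso[OF _ iso \<Phi> that])
      (use product_systemD(2)[OF E] cstar_correspondenceD(1) in auto)
  have bij: "bij_betw (mult_iso E n m) (carrier (tensor (fibre E n) (fibre E m))) (carrier (fibre E (n + m)))"
    using iso bij_betw_cong[of _ "mult_iso E n m" \<Phi>] eq by (simp add: corr_iso_def)
  show ?thesis
    using iso bij unfolding corr_iso_def
    by (simp add: eq class_madd(1)[OF _ _ trep_in trep_in] class_ract(1)[OF _ trep_in] class_lact(1))
qed

lemma mult_iso_inv:
  assumes E: "product_system E" and x: "x \<in> carrier (fibre E (n + m))"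
  shows "mult_iso_inv E n m x \<in> carrier (tensor (fibre E n) (fibre E m))"
    "mult_iso E n m (mult_iso_inv E n m x) = x"
  using corr_iso_mult_iso[OF E, of n m] x unfolding mult_iso_inv_def corr_iso_def bij_betw_def
  by (auto intro: inv_into_into f_inv_into_f)

lemma mult_iso_inv_ip:
  assumes E: "product_system E" and "x \<in> carrier (fibre E (n + m))" "y \<in> carrier (fibre E (n + m))"
  shows "ip (tensor (fibre E n) (fibre E m)) (mult_iso_inv E n m x) (mult_iso_inv E n m y) = ip (fibre E (n + m)) x y"
  using corr_iso_mult_iso[OF E, of n m] mult_iso_inv[OF E assms(2)] mult_iso_inv[OF E assms(3)]
  unfolding corr_iso_def by metis

lemma mult_iso_inv_lact:
  assumes E: "product_system E" and x: "x \<in> carrier (fibre E (n + m))"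
  shows "mult_iso_inv E n m (lact (fibre E (n + m)) a x) =
    lact (tensor (fibre E n) (fibre E m)) a (mult_iso_inv E n m x)"
proof -
  interpret tens "fibre E n" "fibre E m" by (rule tens_fibre[OF E])
  note i = mult_iso_inv[OF E x]
  have "mult_iso E n m (lact (tensor (fibre E n) (fibre E m)) a (mult_iso_inv E n m x)) =
      lact (fibre E (n + m)) a x"
    using corr_iso_mult_iso[OF E, of n m] i unfolding corr_iso_def by metis
  then show ?thesis
    using corr_iso_mult_iso[OF E, of n m] class_lact(1)[OF i(1), of a]
    unfolding mult_iso_inv_def corr_iso_def bij_betw_def by (metis inv_into_f_f)
qed

subsection \<open>Tensor products realised inside a Hilbert space\<close>

text \<open>The maps \<open>tilde\<close>, \<open>id_tensor\<close>, \<open>tensor_id\<close> and \<open>tensor_assoc\<close> commute with embeddings \<open>J\<close> of the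
  modules involved onto closed subspaces of the represented Hilbert space. Since \<open>J\<close> is injective,
  this determines them.\<close>

definition hmodel :: "('a, complex, 'z) corr \<Rightarrow> ('z \<Rightarrow> 'h::complex_hilbert) \<Rightarrow> bool"
  where "hmodel M J \<longleftrightarrow>
    mzero M \<in> carrier M \<and> J (mzero M) = 0 \<and>
    (\<forall>x\<in>carrier M. \<forall>y\<in>carrier M. madd M x y \<in> carrier M \<and> J (madd M x y) = J x + J y) \<and>
    (\<forall>x\<in>carrier M. \<forall>c. ract M x c \<in> carrier M \<and> J (ract M x c) = c *\<^sub>C J x) \<and>
    (\<forall>x\<in>carrier M. \<forall>y\<in>carrier M. ip M x y = cinner (J x) (J y)) \<and>
    inj_on J (carrier M) \<and> closed (J ` carrier M)"

definition lsum :: "('x \<Rightarrow> 'y \<Rightarrow> 'h::monoid_add) \<Rightarrow> ('x \<times> 'y) list \<Rightarrow> 'h"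
  where "lsum f u = (\<Sum>(x, y)\<leftarrow>u. f x y)"

definition tval :: "('x \<Rightarrow> 'y \<Rightarrow> 'h::complex_hilbert) \<Rightarrow> ('x, 'y) tens \<Rightarrow> 'h"
  where "tval f z = lim (\<lambda>n. lsum f (trep z n))"

text \<open>Here \<open>f x y\<close> stands for the elementary tensor. The first condition makes
  summation over lists isometric for \<open>pre_ip\<close>; the second accounts for the scalar -1 in
  \<open>pre_dist\<close>.\<close>

definition fmodel :: "('a, 'b, 'x) corr \<Rightarrow> ('b, complex, 'y) corr \<Rightarrow> ('x \<Rightarrow> 'y \<Rightarrow> 'h::complex_hilbert) \<Rightarrow> bool"
  where "fmodel F G f \<longleftrightarrow>
    (\<forall>x1\<in>carrier F. \<forall>x2\<in>carrier F. \<forall>y1\<in>carrier G. \<forall>y2\<in>carrier G.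
      ip G y1 (lact G (ip F x1 x2) y2) = cinner (f x1 y1) (f x2 y2)) \<and>
    (\<forall>x\<in>carrier F. \<forall>y\<in>carrier G. \<forall>c. ract G y c \<in> carrier G \<and> f x (ract G y c) = c *\<^sub>C f x y)"

lemma lsum_simps [simp]: "lsum f [] = 0" "lsum f ((x, y) # u) = f x y + lsum f u"
  by (auto simp: lsum_def)

lemma lsum_append: "lsum f (u @ v) = lsum f u + lsum f v"
  by (simp add: lsum_def)

lemma lsum_closed:
  assumes "csubspace V" "\<And>x y. (x, y) \<in> set u \<Longrightarrow> f x y \<in> V"
  shows "lsum f u \<in> V"
  using assms(2) by (induction u) (auto simp: csubspaceD[OF assms(1)])

lemma hmodel_mdist:
  assumes M: "hmodel M J" and xy: "x \<in> carrier M" "y \<in> carrier M"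
  shows "mdist M x y = norm (J x - J y)"
proof -
  have r: "ract M y (- 1) \<in> carrier M" "J (ract M y (- 1)) = - J y"
    using M xy by (auto simp: hmodel_def scaleC_minus1_left)
  then have "madd M x (ract M y (- 1)) \<in> carrier M" "J (madd M x (ract M y (- 1))) = J x - J y"
    using M xy by (auto simp: hmodel_def)
  then have "ip M (madd M x (ract M y (- 1))) (madd M x (ract M y (- 1))) = cinner (J x - J y) (J x - J y)"
    using M by (simp add: hmodel_def)
  then show ?thesis by (simp add: mdist_def mnorm_def cinner_same norm_power)
qed

lemma hmodel_msum:
  assumes M: "hmodel M J" and "set u \<subseteq> A \<times> B"
    and "\<And>x y. x \<in> A \<Longrightarrow> y \<in> B \<Longrightarrow> g x y \<in> carrier M"
  shows "msum M (map (\<lambda>(x, y). g x y) u) \<in> carrier M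
    \<and> J (msum M (map (\<lambda>(x, y). g x y) u)) = lsum (\<lambda>x y. J (g x y)) u"
  using assms(2)
proof (induction u)
  case Nil
  then show ?case using M by (simp add: hmodel_def msum_def)
next
  case (Cons p u)
  obtain x y where p: "p = (x, y)" by (cases p)
  have "g x y \<in> carrier M" using Cons.prems assms(3) by (auto simp: p)
  then show ?case using Cons M by (simp add: hmodel_def msum_def p)
qed

text \<open>Through \<open>J\<close> the distances of \<open>M\<close> are norms. A preimage of
  \<open>l\<close> exists because the range of \<open>J\<close> is closed, and it is the only limit
  because \<open>J\<close> is injective. The limit must be \<open>l\<close> for every
  representative, as \<open>tensor_lift\<close> quantifies over the whole class.\<close>

lemma tensor_lift_hmodel:
  assumes M: "hmodel M J" and z: "Z \<in> z" "\<And>X n. X \<in> z \<Longrightarrow> set (X n) \<subseteq> A \<times> B"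
    and g: "\<And>x y. x \<in> A \<Longrightarrow> y \<in> B \<Longrightarrow> g x y \<in> carrier M"
    and lim: "\<And>X. X \<in> z \<Longrightarrow> (\<lambda>n. lsum (\<lambda>x y. J (g x y)) (X n)) \<longlonglongrightarrow> l"
  shows "tensor_lift M g z \<in> carrier M \<and> J (tensor_lift M g z) = l"
proof -
  define s where "s X n = msum M (map (\<lambda>(x, y). g x y) (X n))" for X :: "nat \<Rightarrow> _" and n
  have s: "s X n \<in> carrier M" "J (s X n) = lsum (\<lambda>x y. J (g x y)) (X n)" if "X \<in> z" for X n
    using hmodel_msum[OF M z(2)[OF that] g] by (auto simp: s_def)
  have "l \<in> J ` carrier M"
  proof (rule closed_sequentially)
    show "closed (J ` carrier M)" using M by (simp add: hmodel_def)
    show "(\<lambda>n. J (s Z n)) \<longlonglongrightarrow> l" using lim[OF z(1)] s[OF z(1)] by simp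
    show "J (s Z n) \<in> J ` carrier M" for n by (rule imageI[OF s(1)[OF z(1)]])
  qed
  then obtain w where w: "w \<in> carrier M" "J w = l" by auto
  have "tensor_lift M g z = w"
    unfolding tensor_lift_def
  proof (rule the_equality)
    show "w \<in> carrier M \<and> (\<forall>X\<in>z. (\<lambda>n. mdist M (msum M (map (\<lambda>(x, y). g x y) (X n))) w) \<longlonglongrightarrow> 0)"
    proof (intro conjI ballI)
      fix X assume X: "X \<in> z"
      have "(\<lambda>n. norm (J (s X n) - l)) \<longlonglongrightarrow> 0"
        using lim[OF X] s[OF X] by (simp add: tendsto_norm_zero LIM_zero)
      then show "(\<lambda>n. mdist M (msum M (map (\<lambda>(x, y). g x y) (X n))) w) \<longlonglongrightarrow> 0"
        using hmodel_mdist[OF M s(1)[OF X] w(1)] w(2) by (simp add: s_def)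
    qed (rule w)
    fix v assume v: "v \<in> carrier M \<and> (\<forall>X\<in>z. (\<lambda>n. mdist M (msum M (map (\<lambda>(x, y). g x y) (X n))) v) \<longlonglongrightarrow> 0)"
    then have "(\<lambda>n. mdist M (s Z n) v) \<longlonglongrightarrow> 0" using z(1) by (simp add: s_def)
    then have "(\<lambda>n. norm (J (s Z n) - J v)) \<longlonglongrightarrow> 0"
      using hmodel_mdist[OF M s(1)[OF z(1)]] v by simp
    then have "(\<lambda>n. J (s Z n)) \<longlonglongrightarrow> J v" by (simp add: tendsto_norm_zero_iff LIM_zero_iff)
    then have "J v = l" using lim[OF z(1)] s[OF z(1)] LIMSEQ_unique by simp
    then show "v = w" using M v w by (auto simp: hmodel_def inj_on_def)
  qed
  then show ?thesis using w by simp
qed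

lemma hmodel_hilbert_corr:
  assumes "closed_csubspace V"
  shows "hmodel (hilbert_corr V \<sigma>) (\<lambda>x. x)"
  using closed_csubspaceD[OF assms] by (auto simp: hmodel_def hilbert_corr_def inj_on_def)

lemma pre_ip_lsum:
  assumes f: "fmodel F G f" and u: "set u \<subseteq> carrier F \<times> carrier G" and v: "set v \<subseteq> carrier F \<times> carrier G"
  shows "pre_ip F G u v = cinner (lsum f u) (lsum f v)"
proof -
  have "(\<Sum>(x2, y2)\<leftarrow>v. ip G y1 (lact G (ip F x1 x2) y2)) = cinner (f x1 y1) (lsum f v)"
    if "x1 \<in> carrier F" "y1 \<in> carrier G" for x1 y1
    using v
  proof (induction v)
    case (Cons p v)
    then show ?case using f that by (cases p) (simp add: fmodel_def cinner_simps)
  qed simp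
  then show ?thesis using u
    by (induction u) (auto simp: pre_ip_def cinner_simps)
qed

context
  fixes F :: "('a, 'b, 'x) corr" and G :: "('b, complex, 'y) corr" and f :: "'x \<Rightarrow> 'y \<Rightarrow> 'h::complex_hilbert"
  assumes f: "fmodel F G f"
begin

lemma lsum_ract:
  assumes "set u \<subseteq> carrier F \<times> carrier G"
  shows "set (map (\<lambda>(x, y). (x, ract G y c)) u) \<subseteq> carrier F \<times> carrier G \<and>
    lsum f (map (\<lambda>(x, y). (x, ract G y c)) u) = c *\<^sub>C lsum f u"
  using assms f by (induction u) (auto simp: fmodel_def scaleC_add_right)

lemma pre_dist_lsum:
  assumes u: "set u \<subseteq> carrier F \<times> carrier G" and v: "set v \<subseteq> carrier F \<times> carrier G"
  shows "pre_dist F G u v = norm (lsum f u - lsum f v)"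
proof -
  define w where "w = u @ map (\<lambda>(x, y). (x, ract G y (- 1))) v"
  have w: "set w \<subseteq> carrier F \<times> carrier G" "lsum f w = lsum f u - lsum f v"
    using u lsum_ract[OF v, of "- 1"] by (auto simp: w_def lsum_append scaleC_minus1_left)
  show ?thesis
    unfolding pre_dist_def Let_def w_def[symmetric] pre_ip_lsum[OF f w(1) w(1)] w(2)
    by (simp add: cinner_same norm_power)
qed

lemma pre_cauchy_lsum:
  "pre_cauchy F G X \<longleftrightarrow> (\<forall>n. set (X n) \<subseteq> carrier F \<times> carrier G) \<and> Cauchy (\<lambda>n. lsum f (X n))"
  unfolding pre_cauchy_def Cauchy_iff by (auto simp: pre_dist_lsum)

lemma tclass_lsum:
  assumes "pre_cauchy F G X"
  shows "Y \<in> tclass F G X \<longleftrightarrow> pre_cauchy F G Y \<and> lim (\<lambda>n. lsum f (X n)) = lim (\<lambda>n. lsum f (Y n))"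
proof -
  have "(\<lambda>n. pre_dist F G (X n) (Y n)) \<longlonglongrightarrow> 0 \<longleftrightarrow> lim (\<lambda>n. lsum f (X n)) = lim (\<lambda>n. lsum f (Y n))"
    if Y: "pre_cauchy F G Y"
  proof -
    obtain l m where l: "(\<lambda>n. lsum f (X n)) \<longlonglongrightarrow> l" and m: "(\<lambda>n. lsum f (Y n)) \<longlonglongrightarrow> m"
      using assms Y by (auto simp: pre_cauchy_lsum Cauchy_convergent_iff convergent_def)
    have "(\<lambda>n. pre_dist F G (X n) (Y n)) = (\<lambda>n. norm (lsum f (X n) - lsum f (Y n)))"
      using assms Y by (auto simp: pre_cauchy_lsum pre_dist_lsum)
    moreover have "(\<lambda>n. norm (lsum f (X n) - lsum f (Y n))) \<longlonglongrightarrow> norm (l - m)"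
      by (intro tendsto_intros l m)
    ultimately have "(\<lambda>n. pre_dist F G (X n) (Y n)) \<longlonglongrightarrow> 0 \<longleftrightarrow> norm (l - m) = 0"
      by (metis LIMSEQ_unique)
    then show ?thesis using limI[OF l] limI[OF m] by simp
  qed
  then show ?thesis by (auto simp: tclass_def)
qed

lemma tensor_carrierE:
  assumes "z \<in> carrier (tensor F G)"
  obtains X where "pre_cauchy F G X" "z = tclass F G X"
  using assms by (auto simp: tensor_def)

lemma tclass_in_tensor: "pre_cauchy F G X \<Longrightarrow> tclass F G X \<in> carrier (tensor F G)"
  by (simp add: tensor_def)

lemma trep_tensor: 
  assumes "z \<in> carrier (tensor F G)"
  shows "trep z \<in> z"
proof -
  obtain X where X: "pre_cauchy F G X" "z = tclass F G X" using tensor_carrierE[OF assms] by blast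
  then have "X \<in> z" by (simp add: tclass_lsum)
  then show ?thesis unfolding trep_def by (rule someI[of "\<lambda>X. X \<in> z"])
qed

lemma tensor_memD:
  assumes "z \<in> carrier (tensor F G)" "X \<in> z"
  shows "pre_cauchy F G X" "set (X n) \<subseteq> carrier F \<times> carrier G" "(\<lambda>n. lsum f (X n)) \<longlonglongrightarrow> tval f z"
proof -
  obtain Z where Z: "pre_cauchy F G Z" "z = tclass F G Z" using tensor_carrierE[OF assms(1)] by blast
  show X: "pre_cauchy F G X" using assms(2) Z by (simp add: tclass_lsum)
  then show "set (X n) \<subseteq> carrier F \<times> carrier G" by (simp add: pre_cauchy_lsum)
  have "lim (\<lambda>n. lsum f (X n)) = tval f z"
    using assms(2) trep_tensor[OF assms(1)] Z by (simp add: tclass_lsum tval_def)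
  then show "(\<lambda>n. lsum f (X n)) \<longlonglongrightarrow> tval f z"
    using X by (metis pre_cauchy_lsum Cauchy_convergent_iff convergent_LIMSEQ_iff)
qed

lemma tval_tclass: "pre_cauchy F G X \<Longrightarrow> (\<lambda>n. lsum f (X n)) \<longlonglongrightarrow> l \<Longrightarrow> tval f (tclass F G X) = l"
  using tensor_memD(3)[OF tclass_in_tensor, of X X] tclass_lsum[of X X] LIMSEQ_unique by blast

lemma pre_cauchyI:
  "(\<And>n. set (X n) \<subseteq> carrier F \<times> carrier G) \<Longrightarrow> (\<lambda>n. lsum f (X n)) \<longlonglongrightarrow> l \<Longrightarrow> pre_cauchy F G X"
  unfolding pre_cauchy_lsum using convergent_Cauchy convergentI by blast

lemma elem_tensor_tval:
  assumes "x \<in> carrier F" "y \<in> carrier G"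
  shows "elem_tensor F G x y \<in> carrier (tensor F G)" "tval f (elem_tensor F G x y) = f x y"
proof -
  have lim: "(\<lambda>n. lsum f [(x, y)]) \<longlonglongrightarrow> f x y" by simp
  then have "pre_cauchy F G (\<lambda>n. [(x, y)])" using assms by (intro pre_cauchyI) auto
  then show "elem_tensor F G x y \<in> carrier (tensor F G)" "tval f (elem_tensor F G x y) = f x y"
    unfolding elem_tensor_def using tclass_in_tensor tval_tclass lim by blast+
qed

text \<open>The tensor product is again a model inside the Hilbert space, so nested tensor products
  can be evaluated by iteration.\<close>

lemma hmodel_tensor: "hmodel (tensor F G) (tval f)"
  unfolding hmodel_def
proof (intro conjI ballI allI)
  have c: "pre_cauchy F G (\<lambda>n. [])" by (rule pre_cauchyI[of _ 0]) auto
  then show "mzero (tensor F G) \<in> carrier (tensor F G)" "tval f (mzero (tensor F G)) = 0"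
    using tclass_in_tensor[OF c] tval_tclass[OF c] by (auto simp: tensor_def)
next
  fix z w assume z: "z \<in> carrier (tensor F G)" and w: "w \<in> carrier (tensor F G)"
  have lim: "(\<lambda>n. lsum f (trep z n @ trep w n)) \<longlonglongrightarrow> tval f z + tval f w"
    unfolding lsum_append
    by (intro tendsto_add tensor_memD(3)[OF z trep_tensor[OF z]] tensor_memD(3)[OF w trep_tensor[OF w]])
  then have c: "pre_cauchy F G (\<lambda>n. trep z n @ trep w n)"
    using tensor_memD(2)[OF z trep_tensor[OF z]] tensor_memD(2)[OF w trep_tensor[OF w]]
    by (intro pre_cauchyI) auto
  show "madd (tensor F G) z w \<in> carrier (tensor F G)" "tval f (madd (tensor F G) z w) = tval f z + tval f w"
    using tclass_in_tensor[OF c] tval_tclass[OF c lim] by (auto simp: tensor_def)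
  have "(\<lambda>n. cinner (lsum f (trep z n)) (lsum f (trep w n))) \<longlonglongrightarrow> cinner (tval f z) (tval f w)"
    by (intro tendsto_cinner tensor_memD(3)[OF z trep_tensor[OF z]] tensor_memD(3)[OF w trep_tensor[OF w]])
  then have "(\<lambda>n. pre_ip F G (trep z n) (trep w n)) \<longlonglongrightarrow> cinner (tval f z) (tval f w)"
    using tensor_memD(2)[OF z trep_tensor[OF z]] tensor_memD(2)[OF w trep_tensor[OF w]]
    by (simp add: pre_ip_lsum[OF f])
  then show "ip (tensor F G) z w = cinner (tval f z) (tval f w)"
    by (simp add: tensor_def limI)
next
  fix z c assume z: "z \<in> carrier (tensor F G)"
  note r = lsum_ract[OF tensor_memD(2)[OF z trep_tensor[OF z]], of c]
  have lim: "(\<lambda>n. lsum f (map (\<lambda>(x, y). (x, ract G y c)) (trep z n))) \<longlonglongrightarrow> c *\<^sub>C tval f z"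
    using tendsto_scaleC[OF tensor_memD(3)[OF z trep_tensor[OF z]]] r by simp
  then have c: "pre_cauchy F G (\<lambda>n. map (\<lambda>(x, y). (x, ract G y c)) (trep z n))"
    using r by (intro pre_cauchyI) auto
  show "ract (tensor F G) z c \<in> carrier (tensor F G)" "tval f (ract (tensor F G) z c) = c *\<^sub>C tval f z"
    using tclass_in_tensor[OF c] tval_tclass[OF c lim] by (auto simp: tensor_def)
next
  show "inj_on (tval f) (carrier (tensor F G))"
  proof (rule inj_onI)
    fix z w assume *: "z \<in> carrier (tensor F G)" "w \<in> carrier (tensor F G)" "tval f z = tval f w"
    obtain X where X: "pre_cauchy F G X" "z = tclass F G X" using tensor_carrierE[OF *(1)] by blast
    obtain Y where Y: "pre_cauchy F G Y" "w = tclass F G Y" using tensor_carrierE[OF *(2)] by blast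
    have "lim (\<lambda>n. lsum f (X n)) = lim (\<lambda>n. lsum f (Y n))"
      using *(3) tensor_memD(3)[OF *(1), of X] tensor_memD(3)[OF *(2), of Y] X Y
      by (simp add: tclass_lsum limI)
    then show "z = w" using X Y by (auto simp: tclass_lsum)
  qed
  show "closed (tval f ` carrier (tensor F G))"
    unfolding closed_sequential_limits
  proof (intro allI impI)
    fix Y l assume Y: "(\<forall>n. Y n \<in> tval f ` carrier (tensor F G)) \<and> Y \<longlonglongrightarrow> l"
    \<comment> \<open>Diagonal choice: one list within \<open>1 / (n + 1)\<close> of each
      \<open>Y n\<close>. The chosen lists form a Cauchy sequence whose class is mapped to
      \<open>l\<close>.\<close>
    have "\<exists>u. set u \<subseteq> carrier F \<times> carrier G \<and> norm (lsum f u - Y n) < 1 / real (Suc n)" for n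
    proof -
      obtain z where z: "z \<in> carrier (tensor F G)" "Y n = tval f z" using Y by blast
      have "\<exists>k. norm (lsum f (trep z k) - tval f z) < 1 / real (Suc n)"
        using LIMSEQ_D[OF tensor_memD(3)[OF z(1) trep_tensor[OF z(1)]], of "1 / real (Suc n)"] by auto
      then show ?thesis using tensor_memD(2)[OF z(1) trep_tensor[OF z(1)]] z(2) by metis
    qed
    then obtain X where X: "\<And>n. set (X n) \<subseteq> carrier F \<times> carrier G"
      "\<And>n. norm (lsum f (X n) - Y n) < 1 / real (Suc n)" by metis
    have "(\<lambda>n. lsum f (X n) - Y n) \<longlonglongrightarrow> 0"
      by (rule tendsto_norm_zero_cancel, rule tendsto_sandwich[of "\<lambda>_. 0" _ _ "\<lambda>n. 1 / real (Suc n)"])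
        (use X(2) less_imp_le LIMSEQ_Suc[OF lim_1_over_n] in \<open>auto intro!: always_eventually\<close>)
    then have lim: "(\<lambda>n. lsum f (X n)) \<longlonglongrightarrow> l" using tendsto_add[of _ 0 _ Y l] Y by fastforce
    then have "pre_cauchy F G X" using X(1) pre_cauchyI by blast
    then show "l \<in> tval f ` carrier (tensor F G)" using tval_tclass[OF _ lim] tclass_in_tensor by blast
  qed
qed

text \<open>The evaluation rule behind \<open>tilde\<close>, \<open>id_tensor\<close>,
  \<open>tensor_id\<close> and the outer lift of \<open>tensor_assoc\<close>: it suffices to compare
  with \<open>f\<close> on elementary tensors.\<close>

lemma tensor_lift_tval:
  assumes "hmodel M J" "\<And>x y. x \<in> carrier F \<Longrightarrow> y \<in> carrier G \<Longrightarrow> g x y \<in> carrier M \<and> J (g x y) = f x y"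
    and z: "z \<in> carrier (tensor F G)"
  shows "tensor_lift M g z \<in> carrier M \<and> J (tensor_lift M g z) = tval f z"
proof (rule tensor_lift_hmodel[OF assms(1) trep_tensor[OF z], where A = "carrier F" and B = "carrier G"])
  fix X assume X: "X \<in> z"
  have "lsum (\<lambda>x y. J (g x y)) (X n) = lsum f (X n)" for n
    unfolding lsum_def using tensor_memD(2)[OF z X] assms(2)
    by (intro arg_cong[of _ _ sum_list] map_cong) auto
  then show "(\<lambda>n. lsum (\<lambda>x y. J (g x y)) (X n)) \<longlonglongrightarrow> tval f z"
    using tensor_memD(3)[OF z X] by simp
qed (use assms(2) tensor_memD(2)[OF z] in auto)

end

subsection \<open>Isometric representations\<close>

lemma unital_representationD:
  assumes "unital_representation UNIV \<sigma>"
  shows "bounded_op UNIV (\<sigma> a)" "\<sigma> (a + b) h = \<sigma> a h + \<sigma> b h" "\<sigma> (c *\<^sub>C a) h = c *\<^sub>C \<sigma> a h"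
    "\<sigma> (a * b) h = \<sigma> a (\<sigma> b h)" "cinner (\<sigma> a h) g = cinner h (\<sigma> (star a) g)" "\<sigma> 1 h = h"
  using assms by (auto simp: unital_representation_def)

text \<open>Only continuity in \<open>a\<close> is wanted, so the constant is not optimal. For
  \<open>norm b \<le> 1\<close> the available root \<open>e\<close> solves
  \<open>star b * b + e * e = 2\<close> rather than 1; this gives the factor \<open>sqrt 2\<close>,
  rounded up to 2.\<close>

lemma norm_representation_le:
  fixes \<sigma> :: "'a::cstar_algebra \<Rightarrow> 'h::complex_hilbert \<Rightarrow> 'h"
  assumes \<sigma>: "unital_representation UNIV \<sigma>"
  shows "norm (\<sigma> a h) \<le> 2 * norm a * norm h"
proof -
  note D = unital_representationD[OF \<sigma>]
  have 1: "norm (\<sigma> b h) \<le> 2 * norm h" if b: "norm b \<le> 1" for b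
  proof -
    have "nonneg (of_real 1 - star b * b)"
      by (rule nonneg_norm_minus) (use b in \<open>auto simp: star_mult star_star cstar_identity power_le_one\<close>)
    then obtain e where e: "star e = e" "e * e = of_real 1 - star b * b + 1 *\<^sub>R 1"
      using nonneg_sqrt zero_less_one by blast
    have "star b * b + e * e = 2 *\<^sub>R 1"
      unfolding e by (simp add: scaleR_2)
    then have *: "star b * b + e * e = complex_of_real 2 *\<^sub>C 1" by (simp only: scaleR_scaleC)
    have sq: "cinner (\<sigma> c h) (\<sigma> c h) = cinner h (\<sigma> (star c * c) h)" for c by (simp add: D)
    have "cinner (\<sigma> b h) (\<sigma> b h) + cinner (\<sigma> e h) (\<sigma> e h) = 2 * cinner h h"
      unfolding sq e(1) cinner_add_right[symmetric] D(2)[symmetric] * by (simp add: D(3,6) cinner_simps)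
    then have "(norm (\<sigma> b h))\<^sup>2 + (norm (\<sigma> e h))\<^sup>2 = 2 * (norm h)\<^sup>2"
      unfolding norm_square_eq by (metis Re_complex_of_real cinner_same of_real_numeral plus_complex.sel(1) of_real_mult)
    then have "(norm (\<sigma> b h))\<^sup>2 \<le> 2 * (norm h)\<^sup>2" by (smt (verit) zero_le_power2)
    also have "\<dots> \<le> (2 * norm h)\<^sup>2" by (simp add: power_mult_distrib)
    finally show ?thesis by (rule power2_le_imp_le) simp
  qed
  show ?thesis
  proof (cases "a = 0")
    case True
    then show ?thesis using D(3)[of 0 a h] by simp
  next
    case False
    define b where "b = complex_of_real (1 / norm a) *\<^sub>C a"
    have "norm b \<le> 1" using False by (simp add: b_def norm_scaleC norm_divide)
    moreover have "a = complex_of_real (norm a) *\<^sub>C b"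
      using False by (simp add: b_def scaleC_scaleC)
    then have "norm (\<sigma> a h) = norm a * norm (\<sigma> b h)"
      using D(3) by (metis norm_scaleC_hilbert norm_of_real abs_norm_cancel)
    ultimately show ?thesis using 1[of b] by (simp add: mult_left_mono mult.assoc mult.left_commute)
  qed
qed

lemma bounded_linear_representation:
  fixes \<sigma> :: "'a::cstar_algebra \<Rightarrow> 'h::complex_hilbert \<Rightarrow> 'h"
  assumes \<sigma>: "unital_representation UNIV \<sigma>"
  shows "bounded_linear (\<lambda>a. \<sigma> a h)"
  by (rule bounded_linear_intro[of _ "2 * norm h"])
    (use norm_representation_le[OF \<sigma>, of _ h] in
      \<open>auto simp: unital_representationD[OF \<sigma>] scaleR_scaleC mult_ac\<close>)

lemma representation_zero:
  assumes "unital_representation UNIV \<sigma>"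
  shows "\<sigma> 0 h = 0"
  using unital_representationD(3)[OF assms, of 0 0 h] by simp

text \<open>The part of an isometric representation that is stable under tensor products
  (\<open>irep_rep_tensor\<close>) and under pulling back along isometric left module maps
  (\<open>irep_comp\<close>); it is meaningful on carriers of any type, in particular on
  \<open>tensor F G\<close>.\<close>

definition irep ::
    "('a::cstar_algebra, 'a, 'x) corr \<Rightarrow> ('a \<Rightarrow> 'h::complex_hilbert \<Rightarrow> 'h) \<Rightarrow> ('x \<Rightarrow> 'h \<Rightarrow> 'h) \<Rightarrow> bool"
  where "irep F \<sigma> B \<longleftrightarrow>
    (\<forall>x\<in>carrier F. \<forall>c h. B x (c *\<^sub>C h) = c *\<^sub>C B x h) \<and>
    (\<forall>x\<in>carrier F. \<forall>y\<in>carrier F. \<forall>h g. cinner (B x h) (B y g) = cinner h (\<sigma> (ip F x y) g)) \<and>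
    (\<forall>x\<in>carrier F. \<forall>a h. B (lact F a x) h = \<sigma> a (B x h))"

lemma irepD:
  assumes "irep F \<sigma> B"
  shows "x \<in> carrier F \<Longrightarrow> B x (c *\<^sub>C h) = c *\<^sub>C B x h"
    "x \<in> carrier F \<Longrightarrow> y \<in> carrier F \<Longrightarrow> cinner (B x h) (B y g) = cinner h (\<sigma> (ip F x y) g)"
    "x \<in> carrier F \<Longrightarrow> B (lact F a x) h = \<sigma> a (B x h)"
  using assms by (auto simp: irep_def)

lemma fmodel_irep:
  "irep F \<sigma> B \<Longrightarrow> csubspace V \<Longrightarrow> fmodel F (hilbert_corr V \<sigma>) B"
  by (auto simp: fmodel_def hilbert_corr_def irepD csubspaceD)

lemma csubspace_UNIV [simp]: "csubspace UNIV"
  by (simp add: csubspace_def)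

lemma carrier_hilbert_corr [simp]: "carrier (hilbert_corr V \<sigma>) = V"
  by (simp add: hilbert_corr_def)

lemma irep_comp:
  assumes "irep G \<sigma> B" and "\<And>x. x \<in> carrier F \<Longrightarrow> \<psi> x \<in> carrier G"
    and "\<And>x y. x \<in> carrier F \<Longrightarrow> y \<in> carrier F \<Longrightarrow> ip G (\<psi> x) (\<psi> y) = ip F x y"
    and "\<And>x a. x \<in> carrier F \<Longrightarrow> \<psi> (lact F a x) = lact G a (\<psi> x)"
  shows "irep F \<sigma> (\<lambda>x. B (\<psi> x))"
  using assms by (auto simp: irep_def)

definition rep_tensor :: "('x \<Rightarrow> 'h::complex_hilbert \<Rightarrow> 'h) \<Rightarrow> ('y \<Rightarrow> 'h \<Rightarrow> 'h) \<Rightarrow> ('x, 'y) tens \<Rightarrow> 'h \<Rightarrow> 'h"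
  where "rep_tensor B C t h = tval (\<lambda>x y. B x (C y h)) t"

locale irep_pair = tens F G
  for F :: "('a::cstar_algebra, 'a, 'x) corr" and G :: "('a, 'a, 'y) corr" +
  fixes \<sigma> :: "'a \<Rightarrow> 'h::complex_hilbert \<Rightarrow> 'h" and B :: "'x \<Rightarrow> 'h \<Rightarrow> 'h" and C :: "'y \<Rightarrow> 'h \<Rightarrow> 'h"
  assumes \<sigma>: "unital_representation UNIV \<sigma>" and B: "irep F \<sigma> B" and C: "irep G \<sigma> C"
begin

abbreviation (input) BC :: "'h \<Rightarrow> ('x \<times> 'y) list \<Rightarrow> 'h"
  where "BC h \<equiv> lsum (\<lambda>x y. B x (C y h))"

lemma cinner_lsum:
  assumes u: "u \<in> tlists F G" and v: "v \<in> tlists F G"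
  shows "cinner (BC h u) (BC g v) = cinner h (\<sigma> (pre_ip F G u v) g)"
proof -
  note D = unital_representationD[OF \<sigma>]
  have inner: "cinner (B x1 (C y1 h)) (BC g v) =
      cinner h (\<sigma> (\<Sum>(x2, y2)\<leftarrow>v. ip G y1 (lact G (ip F x1 x2) y2)) g)"
    if "x1 \<in> carrier F" "y1 \<in> carrier G" for x1 y1
    using v
  proof (induction v)
    case (Cons p v)
    obtain x2 y2 where p: "p = (x2, y2)" by (cases p)
    have xy: "x2 \<in> carrier F" "y2 \<in> carrier G" "v \<in> tlists F G"
      using Cons.prems by (auto simp: p tlists_def)
    have "cinner (B x1 (C y1 h)) (B x2 (C y2 g)) = cinner h (\<sigma> (ip G y1 (lact G (ip F x1 x2) y2)) g)"
      using that xy GD(2) by (simp add: irepD(2)[OF B] irepD(2)[OF C] flip: irepD(3)[OF C])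
    then show ?case using Cons.IH[OF xy(3)] by (simp add: p cinner_simps D(2))
  qed (simp add: representation_zero[OF \<sigma>])
  show ?thesis
    using u
  proof (induction u)
    case (Cons p u)
    obtain x y where p: "p = (x, y)" by (cases p)
    have xy: "x \<in> carrier F" "y \<in> carrier G" "u \<in> tlists F G"
      using Cons.prems by (auto simp: p tlists_def)
    then show ?case using inner[OF xy(1,2)] Cons.IH[OF xy(3)]
      by (simp add: p pre_ip_def cinner_simps D(2))
  qed (simp add: pre_ip_def representation_zero[OF \<sigma>])
qed

text \<open>For fixed \<open>h\<close> the sums over lists are Lipschitz for the seminorm, so they
  converge along every representative of a tensor to the same vector. The 2 comes from
  \<open>norm_representation_le\<close>.\<close>

lemma norm_lsum_diff_le:
  assumes u: "u \<in> tlists F G" and v: "v \<in> tlists F G"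
  shows "norm (BC h u - BC h v) \<le> 2 * dst u v * norm h"
proof (rule power2_le_imp_le)
  note D = unital_representationD[OF \<sigma>]
  note sub = bounded_linear.linear[OF bounded_linear_representation[OF \<sigma>], THEN linear_diff]
  define w where "w = u @ lists_ract G v (- 1)"
  have w: "w \<in> tlists F G" unfolding w_def by (rule diff_closed[OF u v])
  have ww: "pre_ip F G w w = pre_ip F G u u - pre_ip F G u v - (pre_ip F G v u - pre_ip F G v v)"
    unfolding w_def by (simp add: form_diff_left form_diff_right u v diff_closed)
  have "cinner (BC h u - BC h v) (BC h u - BC h v) = cinner h (\<sigma> (pre_ip F G w w) h)"
    unfolding ww by (simp add: cinner_diff_left cinner_diff_right cinner_lsum u v sub)
  moreover have "(norm (BC h u - BC h v))\<^sup>2 = cmod (cinner (BC h u - BC h v) (BC h u - BC h v))"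
    by (simp add: cinner_same norm_power)
  ultimately have "(norm (BC h u - BC h v))\<^sup>2 = cmod (cinner h (\<sigma> (pre_ip F G w w) h))"
    by (simp only:)
  also have "\<dots> \<le> norm h * (2 * norm (pre_ip F G w w) * norm h)"
    by (intro order_trans[OF norm_cinner_le] mult_left_mono norm_representation_le[OF \<sigma>]) simp
  also have "\<dots> = 2 * (dst u v)\<^sup>2 * (norm h)\<^sup>2"
    by (simp add: dst_def nrm_square w_def power2_eq_square[of "norm h"])
  also have "\<dots> \<le> (2 * dst u v * norm h)\<^sup>2" by (simp add: power_mult_distrib)
  finally show "(norm (BC h u - BC h v))\<^sup>2 \<le> (2 * dst u v * norm h)\<^sup>2" .
qed simp

lemma rep_tensor_tendsto:
  assumes t: "t \<in> carrier (tensor F G)" and X: "X \<in> t"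
  shows "(\<lambda>n. BC h (X n)) \<longlonglongrightarrow> rep_tensor B C t h"
proof -
  have c: "cauchy X" "cauchy (trep t)" using class_cauchy[OF t] X trep_in[OF t] by auto
  have "Cauchy (\<lambda>n. BC h (trep t n))"
  proof (rule CauchyI)
    fix e :: real assume e: "e > 0"
    have h: "2 * (norm h + 1) > 0" by (simp add: add_nonneg_pos)
    then obtain N where N: "\<And>m n. m \<ge> N \<Longrightarrow> n \<ge> N \<Longrightarrow> dst (trep t m) (trep t n) < e / (2 * (norm h + 1))"
      using c(2) e unfolding cauchy_def by (metis divide_pos_pos)
    have "norm (BC h (trep t m) - BC h (trep t n)) < e" if "m \<ge> N" "n \<ge> N" for m n
    proof -
      have "norm (BC h (trep t m) - BC h (trep t n)) \<le> 2 * dst (trep t m) (trep t n) * norm h"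
        by (intro norm_lsum_diff_le cauchyD[OF c(2)])
      also have "\<dots> \<le> dst (trep t m) (trep t n) * (2 * (norm h + 1))" by (simp add: algebra_simps)
      also have "\<dots> < e / (2 * (norm h + 1)) * (2 * (norm h + 1))"
        by (intro mult_strict_right_mono N that h)
      also have "\<dots> = e" using h by simp
      finally show ?thesis .
    qed
    then show "\<exists>M. \<forall>m\<ge>M. \<forall>n\<ge>M. norm (BC h (trep t m) - BC h (trep t n)) < e" by blast
  qed
  then have 1: "(\<lambda>n. BC h (trep t n)) \<longlonglongrightarrow> rep_tensor B C t h"
    by (simp add: rep_tensor_def tval_def Cauchy_convergent_iff convergent_LIMSEQ_iff)
  have "(\<lambda>n. BC h (X n) - BC h (trep t n)) \<longlonglongrightarrow> 0"
  proof (rule tendsto_0_le[where K = 1])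
    have "(\<lambda>n. 2 * dst (X n) (trep t n) * norm h) \<longlonglongrightarrow> 2 * 0 * norm h"
      by (intro tendsto_intros class_dst[OF t X trep_in[OF t]])
    then show "(\<lambda>n. 2 * dst (X n) (trep t n) * norm h) \<longlonglongrightarrow> 0" by simp
  qed (use norm_lsum_diff_le[OF cauchyD[OF c(1)] cauchyD[OF c(2)]] in \<open>auto intro!: always_eventually\<close>)
  from tendsto_add[OF this 1] show ?thesis by simp
qed

lemma rep_tensor_elem:
  "x \<in> carrier F \<Longrightarrow> y \<in> carrier G \<Longrightarrow> rep_tensor B C (elem_tensor F G x y) h = B x (C y h)"
  using rep_tensor_tendsto[OF elem_tensor_class, of x y h] by (simp add: LIMSEQ_const_iff)

lemma irep_rep_tensor: "irep (tensor F G) \<sigma> (rep_tensor B C)"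
  unfolding irep_def
proof (intro conjI ballI allI)
  fix t assume t: "t \<in> carrier (tensor F G)"
  note Xt = class_cauchy[OF t trep_in[OF t], THEN cauchyD]
  fix h
  note lim = rep_tensor_tendsto[OF t trep_in[OF t]]
  show "rep_tensor B C t (c *\<^sub>C h) = c *\<^sub>C rep_tensor B C t h" for c
  proof -
    have "BC (c *\<^sub>C h) u = c *\<^sub>C BC h u" if "u \<in> tlists F G" for u
      using that by (induction u) (auto simp: tlists_def irepD(1)[OF B] irepD(1)[OF C] scaleC_add_right)
    then have "(\<lambda>n. BC (c *\<^sub>C h) (trep t n)) = (\<lambda>n. c *\<^sub>C BC h (trep t n))" using Xt by simp
    then show ?thesis
      using lim[of "c *\<^sub>C h"] tendsto_scaleC[OF lim[of h]] LIMSEQ_unique by metis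
  qed
  show "cinner (rep_tensor B C t h) (rep_tensor B C s g) = cinner h (\<sigma> (ip (tensor F G) t s) g)"
    if s: "s \<in> carrier (tensor F G)" for s g
  proof -
    note Xs = class_cauchy[OF s trep_in[OF s], THEN cauchyD]
    have "(\<lambda>n. cinner (BC h (trep t n)) (BC g (trep s n))) \<longlonglongrightarrow> cinner (rep_tensor B C t h) (rep_tensor B C s g)"
      by (intro tendsto_cinner lim rep_tensor_tendsto[OF s trep_in[OF s]])
    moreover have "(\<lambda>n. cinner h (\<sigma> (pre_ip F G (trep t n) (trep s n)) g)) \<longlonglongrightarrow> cinner h (\<sigma> (ip (tensor F G) t s) g)"
      by (intro tendsto_cinner tendsto_const
          bounded_linear.tendsto[OF bounded_linear_representation[OF \<sigma>]]
          ip_tendsto[OF t s trep_in[OF t] trep_in[OF s]])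
    ultimately show ?thesis using LIMSEQ_unique by (simp add: cinner_lsum Xt Xs)
  qed
  show "rep_tensor B C (lact (tensor F G) a t) h = \<sigma> a (rep_tensor B C t h)" for a
  proof -
    note D = unital_representationD[OF \<sigma>]
    have "BC h (lists_lact F a u) = \<sigma> a (BC h u)" if "u \<in> tlists F G" for u
      using that by (induction u)
        (auto simp: tlists_def lists_lact_def irepD(3)[OF B] bounded_opD[OF D(1)])
    then have "(\<lambda>n. BC h (lists_lact F a (trep t n))) = (\<lambda>n. \<sigma> a (BC h (trep t n)))" using Xt by simp
    then show ?thesis
      using rep_tensor_tendsto[OF class_lact(1)[OF t, of a] class_lact(2)[OF t, of a], of h]
        bounded_linear.tendsto[OF bounded_opD(5)[OF D(1)] lim[of h]] LIMSEQ_unique by metis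
  qed
qed

lemma rep_tensor_closed:
  assumes L: "closed_csubspace L" and t: "t \<in> carrier (tensor F G)"
    and "\<And>x h. x \<in> carrier F \<Longrightarrow> h \<in> L \<Longrightarrow> B x h \<in> L" "\<And>y h. y \<in> carrier G \<Longrightarrow> h \<in> L \<Longrightarrow> C y h \<in> L"
    and h: "h \<in> L"
  shows "rep_tensor B C t h \<in> L"
proof (rule closed_csubspace_limit[OF L rep_tensor_tendsto[OF t trep_in[OF t]]])
  show "BC h (trep t n) \<in> L" for n
    using class_cauchy[OF t trep_in[OF t], THEN cauchyD, of n] assms
    by (intro lsum_closed closed_csubspaceD(2)[OF L]) (auto simp: tlists_def)
qed

abbreviation (input) H\<sigma> :: "('a, complex, 'h) corr"
  where "H\<sigma> \<equiv> hilbert_corr UNIV \<sigma>"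

lemma lact_tval:
  assumes z: "z \<in> carrier (tensor G H\<sigma>)"
  shows "lact (tensor G H\<sigma>) a z \<in> carrier (tensor G H\<sigma>)"
    "tval C (lact (tensor G H\<sigma>) a z) = \<sigma> a (tval C z)"
proof -
  note D = unital_representationD[OF \<sigma>]
  note f = fmodel_irep[OF C csubspace_UNIV]
  note X = tensor_memD[OF f z trep_tensor[OF f z]]
  have "set (lists_lact G a u) \<subseteq> carrier G \<times> UNIV \<and> lsum C (lists_lact G a u) = \<sigma> a (lsum C u)"
    if "set u \<subseteq> carrier G \<times> UNIV" for u
    using that by (induction u) (auto simp: lists_lact_def irepD(3)[OF C] GD(2) bounded_opD[OF D(1)])
  then have l: "set (lists_lact G a (trep z n)) \<subseteq> carrier G \<times> UNIV"
    "lsum C (lists_lact G a (trep z n)) = \<sigma> a (lsum C (trep z n))" for n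
    using X(2) by auto
  have lim: "(\<lambda>n. lsum C (lists_lact G a (trep z n))) \<longlonglongrightarrow> \<sigma> a (tval C z)"
    unfolding l(2) by (rule bounded_linear.tendsto[OF bounded_opD(5)[OF D(1)] X(3)])
  have c: "pre_cauchy G H\<sigma> (\<lambda>n. lists_lact G a (trep z n))"
    by (rule pre_cauchyI[OF f _ lim]) (use l(1) in simp)
  have eq: "lact (tensor G H\<sigma>) a z = tclass G H\<sigma> (\<lambda>n. lists_lact G a (trep z n))"
    by (simp add: tensor_def lists_lact_def)
  show "lact (tensor G H\<sigma>) a z \<in> carrier (tensor G H\<sigma>)"
    "tval C (lact (tensor G H\<sigma>) a z) = \<sigma> a (tval C z)"
    unfolding eq using tclass_in_tensor[OF f c] tval_tclass[OF f c lim] by auto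
qed

lemma fmodel_nested:
  "fmodel F (tensor G H\<sigma>) (\<lambda>x z. B x (tval C z))"
  using hmodel_tensor[OF fmodel_irep[OF C csubspace_UNIV]] lact_tval
  unfolding fmodel_def hmodel_def by (simp add: irepD[OF B])

text \<open>Both bracketings evaluate an elementary tensor of \<open>x\<close>, \<open>y\<close> and
  \<open>h\<close> to \<open>B x (C y h)\<close>; after evaluation the associator is therefore the
  identity.\<close>

lemma tensor_assoc_tval:
  assumes z: "z \<in> carrier (tensor (tensor F G) H\<sigma>)"
  shows "tensor_assoc F G H\<sigma> z \<in> carrier (tensor F (tensor G H\<sigma>))"
    "tval (\<lambda>x z. B x (tval C z)) (tensor_assoc F G H\<sigma> z) = tval (rep_tensor B C) z"
proof -
  note fC = fmodel_irep[OF C csubspace_UNIV]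
  define M where "M = tensor F (tensor G H\<sigma>)"
  have M: "hmodel M (tval (\<lambda>x z. B x (tval C z)))"
    unfolding M_def by (rule hmodel_tensor[OF fmodel_nested])
  let ?e = "\<lambda>x y h. elem_tensor F (tensor G H\<sigma>) x (elem_tensor G H\<sigma> y h)"
  let ?J = "tval (\<lambda>x z. B x (tval C z))"
  have elem: "?e x y h \<in> carrier M
    \<and> ?J (?e x y h) = B x (C y h)"
    if "x \<in> carrier F" "y \<in> carrier G" for x y h
    using elem_tensor_tval[OF fC that(2), of h]
      elem_tensor_tval[OF fmodel_nested that(1), of "elem_tensor G H\<sigma> y h"]
    by (simp add: M_def)
  \<comment> \<open>The inner lift runs over \<open>tensor F G\<close>, whose inner product takes
    values in \<A> and not in the scalars. \<open>fmodel\<close> does not apply there, and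
    convergence comes from \<open>rep_tensor_tendsto\<close>.\<close>
  have inner: "tensor_lift M (\<lambda>x y. ?e x y h) t \<in> carrier M
    \<and> ?J (tensor_lift M (\<lambda>x y. ?e x y h) t) = rep_tensor B C t h"
    if t: "t \<in> carrier (tensor F G)" for t h
  proof (rule tensor_lift_hmodel[OF M trep_in[OF t], where A = "carrier F" and B = "carrier G"])
    show X: "set (X n) \<subseteq> carrier F \<times> carrier G" if "X \<in> t" for X n
      using class_cauchy[OF t that, THEN cauchyD, of n] by (simp add: tlists_def)
    fix X assume Xt: "X \<in> t"
    have "lsum (\<lambda>x y. ?J (?e x y h)) (X n)
      = BC h (X n)" for n
      unfolding lsum_def using X[OF Xt, of n] elem
      by (intro arg_cong[of _ _ sum_list] map_cong) (auto dest!: subsetD)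
    then show "(\<lambda>n. lsum (\<lambda>x y. ?J (?e x y h)) (X n))
        \<longlonglongrightarrow> rep_tensor B C t h"
      using rep_tensor_tendsto[OF t Xt] by simp
  qed (use elem in auto)
  have "tensor_lift M (\<lambda>t h. tensor_lift M (\<lambda>x y. ?e x y h) t) z \<in> carrier M \<and>
    ?J (tensor_lift M (\<lambda>t h. tensor_lift M (\<lambda>x y. ?e x y h) t) z)
    = tval (rep_tensor B C) z"
    by (rule tensor_lift_tval[OF fmodel_irep[OF irep_rep_tensor csubspace_UNIV] M _ z]) (rule inner)
  then show "tensor_assoc F G H\<sigma> z \<in> carrier (tensor F (tensor G H\<sigma>))"
    "tval (\<lambda>x z. B x (tval C z)) (tensor_assoc F G H\<sigma> z) = tval (rep_tensor B C) z"
    unfolding tensor_assoc_def Let_def M_def[symmetric] by blast+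
qed

end

section \<open>Evaluating \<open>tilde\<close>, \<open>id_tensor\<close> and
  \<open>tensor_id\<close>\<close>

lemma tilde_tval:
  assumes "irep F \<sigma> B" "z \<in> carrier (tensor F (hilbert_corr UNIV \<sigma>))"
  shows "tilde UNIV \<sigma> B z = tval B z"
  using tensor_lift_tval[OF fmodel_irep[OF assms(1) csubspace_UNIV]
      hmodel_hilbert_corr[OF closed_csubspace_UNIV] _ assms(2), of B \<sigma>]
  by (simp add: tilde_def)

lemma id_tensor_tval:
  assumes B: "irep F \<sigma> B" and f: "fmodel F Y f"
    and "\<And>x y. x \<in> carrier F \<Longrightarrow> y \<in> carrier Y \<Longrightarrow> B x (g y) = f x y"
    and z: "z \<in> carrier (tensor F Y)"
  shows "id_tensor F UNIV \<sigma> g z \<in> carrier (tensor F (hilbert_corr UNIV \<sigma>))"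
    "tval B (id_tensor F UNIV \<sigma> g z) = tval f z"
  using tensor_lift_tval[OF f hmodel_tensor[OF fmodel_irep[OF B csubspace_UNIV]] _ z,
      of "\<lambda>x y. elem_tensor F (hilbert_corr UNIV \<sigma>) (id x) (g y)"]
    elem_tensor_tval[OF fmodel_irep[OF B csubspace_UNIV]] assms(3)
  unfolding id_tensor_def tensor_map_def by auto

text \<open>Asking of \<open>g\<close> only that it evaluate like \<open>C\<close> lets the lemma
  serve both the commutation relation, with \<open>g\<close> a \<open>tilde\<close>, and the
  recursion of \<open>tilde_word\<close>.\<close>

lemma (in irep_pair) tilde_id_tensor_assoc:
  assumes z: "z \<in> carrier (tensor (tensor F G) (hilbert_corr UNIV \<sigma>))"
    and g: "\<And>z. z \<in> carrier (tensor G (hilbert_corr UNIV \<sigma>)) \<Longrightarrow> g z = tval C z"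
  shows "tilde UNIV \<sigma> B (id_tensor F UNIV \<sigma> g (tensor_assoc F G (hilbert_corr UNIV \<sigma>) z)) =
    tval (rep_tensor B C) z"
  using id_tensor_tval[OF B fmodel_nested _ tensor_assoc_tval(1)[OF z], of g] g
    tilde_tval[OF B] tensor_assoc_tval(2)[OF z] by simp

lemma tensor_id_tval:
  assumes B: "irep F \<sigma> B" and B': "irep F' \<sigma> (\<lambda>x. B (\<psi> x))"
    and "\<And>x. x \<in> carrier F' \<Longrightarrow> \<psi> x \<in> carrier F"
    and z: "z \<in> carrier (tensor F' (hilbert_corr UNIV \<sigma>))"
  shows "tensor_id F UNIV \<sigma> \<psi> z \<in> carrier (tensor F (hilbert_corr UNIV \<sigma>))"
    "tval B (tensor_id F UNIV \<sigma> \<psi> z) = tval (\<lambda>x. B (\<psi> x)) z"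
  using tensor_lift_tval[OF fmodel_irep[OF B' csubspace_UNIV] hmodel_tensor[OF fmodel_irep[OF B csubspace_UNIV]] _ z,
      of "\<lambda>x y. elem_tensor F (hilbert_corr UNIV \<sigma>) (\<psi> x) (id y)"]
    elem_tensor_tval[OF fmodel_irep[OF B csubspace_UNIV]] assms(3)
  unfolding tensor_id_def tensor_map_def by auto

subsection \<open>Isometric representations of product systems\<close>

text \<open>If \<open>h\<close> is orthogonal to the range, the defining property of the adjoint of
  \<open>tilde\<close> at \<open>h\<close> is solved by zero, and uniquely so. Then
  \<open>h\<close>, being \<open>tilde\<close> of that adjoint vector, is zero.\<close>

lemma fully_coisometric_dense:
  assumes B: "irep F \<sigma> B" and co: "corr_fully_coisometric F UNIV B \<sigma>"
    and orth: "\<And>x g. x \<in> carrier F \<Longrightarrow> cinner (B x g) h = 0"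
  shows "h = 0"
proof -
  note f = fmodel_irep[OF B csubspace_UNIV]
  define T where "T = tensor F (hilbert_corr UNIV \<sigma>)"
  have M: "hmodel T (tval B)" unfolding T_def by (rule hmodel_tensor[OF f])
  have tilde: "tilde UNIV \<sigma> B z = tval B z" if "z \<in> carrier T" for z
    using that tilde_tval[OF B] by (simp add: T_def)
  have zero: "cinner (tilde UNIV \<sigma> B z) h = 0" if z: "z \<in> carrier T" for z
  proof -
    have z': "z \<in> carrier (tensor F (hilbert_corr UNIV \<sigma>))" using z by (simp add: T_def)
    note X = tensor_memD[OF f z' trep_tensor[OF f z']]
    have "cinner (lsum B u) h = 0" if "set u \<subseteq> carrier F \<times> UNIV" for u
      using that by (induction u) (auto simp: cinner_simps orth)
    then have "cinner (lsum B (trep z n)) h = 0" for n using X(2) by simp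
    moreover have "(\<lambda>n. cinner (lsum B (trep z n)) h) \<longlonglongrightarrow> cinner (tval B z) h"
      by (intro tendsto_cinner X(3) tendsto_const)
    ultimately show ?thesis by (simp add: LIMSEQ_const_iff tilde z)
  qed
  have "madjoint T (hilbert_corr UNIV \<sigma>) (tilde UNIV \<sigma> B) h = mzero T"
    unfolding madjoint_def
  proof (rule the_equality)
    show "mzero T \<in> carrier T \<and> (\<forall>z\<in>carrier T. ip T z (mzero T) = ip (hilbert_corr UNIV \<sigma>) (tilde UNIV \<sigma> B z) h)"
      using M zero by (simp add: hmodel_def hilbert_corr_def)
    fix x assume x: "x \<in> carrier T \<and> (\<forall>z\<in>carrier T. ip T z x = ip (hilbert_corr UNIV \<sigma>) (tilde UNIV \<sigma> B z) h)"
    then have "ip T x x = cinner (tilde UNIV \<sigma> B x) h" by (simp add: hilbert_corr_def)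
    also have "\<dots> = 0" using x zero by blast
    also have "ip T x x = cinner (tval B x) (tval B x)" using x M unfolding hmodel_def by blast
    finally have "tval B x = 0" by simp
    then show "x = mzero T" using x M by (auto simp: hmodel_def inj_on_def)
  qed
  then have "tilde UNIV \<sigma> B (mzero T) = h"
    using co unfolding corr_fully_coisometric_def T_def by (metis UNIV_I)
  then show ?thesis using M tilde by (simp add: hmodel_def)
qed

locale isometric_rep =
  fixes E :: "('a::cstar_algebra, 'e, 'k::{finite, linorder}) product_sys"
    and S :: "'k \<Rightarrow> 'e \<Rightarrow> 'h::complex_hilbert \<Rightarrow> 'h" and \<sigma> :: "'a \<Rightarrow> 'h \<Rightarrow> 'h"
  assumes E: "product_system E" and rep: "representation E UNIV S \<sigma>" and iso: "isometric E UNIV S \<sigma>"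
begin

lemma corr_rep: "corr_representation (gen E i) UNIV (S i) \<sigma>"
  using rep by (simp add: representation_def)

lemma \<sigma>: "unital_representation UNIV \<sigma>"
  using corr_rep by (simp add: corr_representation_def)

lemma bounded_op_S: "\<xi> \<in> carrier (gen E i) \<Longrightarrow> bounded_op UNIV (S i \<xi>)"
  using corr_rep by (simp add: corr_representation_def)

lemma gen_correspondence: "cstar_correspondence (gen E i)"
  unfolding gen_def by (rule product_systemD(2)[OF E])

lemma irep_S: "irep (gen E i) \<sigma> (S i)"
  unfolding irep_def
proof (intro conjI ballI allI)
  fix x assume x: "x \<in> carrier (gen E i)"
  show "S i x (c *\<^sub>C h) = c *\<^sub>C S i x h" for c h
    by (rule bounded_opD(2)[OF bounded_op_S[OF x]])
  show "cinner (S i x h) (S i y g) = cinner h (\<sigma> (ip (gen E i) x y) g)" if "y \<in> carrier (gen E i)" for y h g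
    using iso x that by (simp add: isometric_def corr_isometric_def)
  show "S i (lact (gen E i) a x) h = \<sigma> a (S i x h)" for a h
  proof -
    have "S i (lact (gen E i) a (ract (gen E i) x 1)) h = \<sigma> a (S i x (\<sigma> 1 h))"
      using corr_rep x by (simp add: corr_representation_def)
    then show ?thesis
      using hilbert_moduleD(12)[OF cstar_correspondenceD(1)[OF gen_correspondence] x]
      by (simp add: unital_representationD(6)[OF \<sigma>])
  qed
qed

lemma irep_pair_S: "irep_pair (gen E i) (gen E j) \<sigma> (S i) (S j)"
  by (intro irep_pair.intro tens.intro irep_pair_axioms.intro gen_correspondence \<sigma> irep_S)

text \<open>The flip of an elementary tensor need not be elementary, only a limit of finite sums;
  these are the sums. They depend on \<open>E\<close> alone, so the same lists serve both
  representations and their direct sum.\<close>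

definition flip_lists :: "'k \<Rightarrow> 'k \<Rightarrow> 'e \<Rightarrow> 'e \<Rightarrow> nat \<Rightarrow> ('e \<times> 'e) list"
  where "flip_lists i j x y = trep (flip_iso E i j (elem_tensor (gen E i) (gen E j) x y))"

lemma flip_iso:
  assumes t: "t \<in> carrier (tensor (gen E i) (gen E j))"
  shows "flip_iso E i j t \<in> carrier (tensor (gen E j) (gen E i))"
    "s \<in> carrier (tensor (gen E i) (gen E j)) \<Longrightarrow>
      ip (tensor (gen E j) (gen E i)) (flip_iso E i j t) (flip_iso E i j s) = ip (tensor (gen E i) (gen E j)) t s"
    "flip_iso E i j (lact (tensor (gen E i) (gen E j)) a t) = lact (tensor (gen E j) (gen E i)) a (flip_iso E i j t)"
proof -
  define n m where "n = (axis i 1 :: (nat, 'k) vec)" and "m = (axis j 1 :: (nat, 'k) vec)"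
  have g: "gen E i = fibre E n" "gen E j = fibre E m" by (simp_all add: gen_def n_def m_def)
  have f: "flip_iso E i j s = mult_iso_inv E m n (mult_iso E n m s)" for s
    by (simp add: flip_iso_def n_def m_def)
  have iso: "corr_iso (tensor (fibre E n) (fibre E m)) (fibre E (m + n)) (mult_iso E n m)"
    using corr_iso_mult_iso[OF E, of n m] by (simp add: add.commute)
  have mt: "mult_iso E n m s \<in> carrier (fibre E (m + n))"
    if "s \<in> carrier (tensor (fibre E n) (fibre E m))" for s
    using iso that by (auto simp: corr_iso_def bij_betw_def)
  note t = t[unfolded g]
  show "flip_iso E i j t \<in> carrier (tensor (gen E j) (gen E i))"
    unfolding f g by (rule mult_iso_inv(1)[OF E mt[OF t]])
  show "ip (tensor (gen E j) (gen E i)) (flip_iso E i j t) (flip_iso E i j s) = ip (tensor (gen E i) (gen E j)) t s"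
    if s: "s \<in> carrier (tensor (gen E i) (gen E j))"
    unfolding f g mult_iso_inv_ip[OF E mt[OF t] mt[OF s[unfolded g]]]
    using iso t s[unfolded g] unfolding corr_iso_def by blast
  have "mult_iso E n m (lact (tensor (fibre E n) (fibre E m)) a t) = lact (fibre E (m + n)) a (mult_iso E n m t)"
    using iso t unfolding corr_iso_def by blast
  then show "flip_iso E i j (lact (tensor (gen E i) (gen E j)) a t) = lact (tensor (gen E j) (gen E i)) a (flip_iso E i j t)"
    unfolding f g by (simp add: mult_iso_inv_lact[OF E mt[OF t]])
qed

lemma flip_lists_closed:
  assumes "x \<in> carrier (gen E i)" "y \<in> carrier (gen E j)"
  shows "set (flip_lists i j x y n) \<subseteq> carrier (gen E j) \<times> carrier (gen E i)"
proof -
  interpret p: irep_pair "gen E i" "gen E j" \<sigma> "S i" "S j" by (rule irep_pair_S)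
  interpret q: irep_pair "gen E j" "gen E i" \<sigma> "S j" "S i" by (rule irep_pair_S)
  have "flip_iso E i j (elem_tensor (gen E i) (gen E j) x y) \<in> carrier (tensor (gen E j) (gen E i))"
    by (rule flip_iso(1)[OF p.elem_tensor_class(1)[OF assms]])
  then show ?thesis
    using q.class_cauchy[OF _ q.trep_in, THEN q.cauchyD] by (auto simp: flip_lists_def tlists_def)
qed

text \<open>The commutation relation of the representation, evaluated at the elementary tensor of
  \<open>x\<close>, \<open>y\<close> and \<open>h\<close>. The left side evaluates to
  \<open>S i x (S j y h)\<close>, the right side to \<open>rep_tensor\<close> of the flipped tensor,
  which is the limit of its lists.\<close>

lemma flip_lists_tendsto:
  assumes xy: "x \<in> carrier (gen E i)" "y \<in> carrier (gen E j)"
  shows "(\<lambda>n. lsum (\<lambda>y' x'. S j y' (S i x' h)) (flip_lists i j x y n)) \<longlonglongrightarrow> S i x (S j y h)"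
proof -
  interpret p: irep_pair "gen E i" "gen E j" \<sigma> "S i" "S j" by (rule irep_pair_S)
  interpret q: irep_pair "gen E j" "gen E i" \<sigma> "S j" "S i" by (rule irep_pair_S)
  define t where "t = elem_tensor (gen E i) (gen E j) x y"
  have t: "t \<in> carrier (tensor (gen E i) (gen E j))"
    unfolding t_def by (rule p.elem_tensor_class(1)[OF xy])
  define z where "z = elem_tensor (tensor (gen E i) (gen E j)) (hilbert_corr UNIV \<sigma>) t h"
  have z: "z \<in> carrier (tensor (tensor (gen E i) (gen E j)) (hilbert_corr UNIV \<sigma>))"
    and zval: "tval (rep_tensor (S i) (S j)) z = S i x (S j y h)"
    using elem_tensor_tval[OF fmodel_irep[OF p.irep_rep_tensor csubspace_UNIV] t, of h]
    by (auto simp: z_def t_def p.rep_tensor_elem[OF xy])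
  have r: "irep (tensor (gen E i) (gen E j)) \<sigma> (\<lambda>t. rep_tensor (S j) (S i) (flip_iso E i j t))"
    by (rule irep_comp[OF q.irep_rep_tensor]) (use flip_iso in auto)
  have "S i x (S j y h) = tilde UNIV \<sigma> (S i) (id_tensor (gen E i) UNIV \<sigma> (tilde UNIV \<sigma> (S j))
         (tensor_assoc (gen E i) (gen E j) (hilbert_corr UNIV \<sigma>) z))"
    using p.tilde_id_tensor_assoc[OF z tilde_tval[OF irep_S]] zval by simp
  also have "\<dots> = tilde UNIV \<sigma> (S j) (id_tensor (gen E j) UNIV \<sigma> (tilde UNIV \<sigma> (S i))
         (tensor_assoc (gen E j) (gen E i) (hilbert_corr UNIV \<sigma>)
           (tensor_id (tensor (gen E j) (gen E i)) UNIV \<sigma> (flip_iso E i j) z)))"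
    using rep z by (simp add: representation_def)
  also have "\<dots> = tval (\<lambda>t. rep_tensor (S j) (S i) (flip_iso E i j t)) z"
    using tensor_id_tval[OF q.irep_rep_tensor r flip_iso(1) z]
      q.tilde_id_tensor_assoc[OF _ tilde_tval[OF irep_S]] by simp
  also have "\<dots> = rep_tensor (S j) (S i) (flip_iso E i j t) h"
    unfolding z_def using elem_tensor_tval(2)[OF fmodel_irep[OF r csubspace_UNIV] t, of h] by simp
  finally show ?thesis
    using q.rep_tensor_tendsto[OF flip_iso(1)[OF t] q.trep_in[OF flip_iso(1)[OF t]], of h]
    by (simp add: flip_lists_def t_def)
qed

lemma coeff:
  "coeff E a \<in> carrier (fibre E 0)" "x \<in> carrier (fibre E 0) \<Longrightarrow> coeff E (inv (coeff E) x) = x"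
  "inv (coeff E) (coeff E a) = a" "ip (fibre E 0) (coeff E a) (coeff E b) = star a * b"
  "lact (fibre E 0) a (coeff E b) = coeff E (a * b)"
proof -
  note c = product_systemD(3)[OF E, unfolded corr_iso_def algebra_corr_def, simplified]
  show "coeff E a \<in> carrier (fibre E 0)" "x \<in> carrier (fibre E 0) \<Longrightarrow> coeff E (inv (coeff E) x) = x"
    "inv (coeff E) (coeff E a) = a"
    using c by (auto simp: bij_betw_def f_inv_into_f)
  show "ip (fibre E 0) (coeff E a) (coeff E b) = star a * b"
    "lact (fibre E 0) a (coeff E b) = coeff E (a * b)"
    using c by auto
qed

lemma irep_coeff: "irep (fibre E 0) \<sigma> (\<lambda>x. \<sigma> (inv (coeff E) x))"
proof -
  note D = unital_representationD[OF \<sigma>]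
  have "\<exists>a. x = coeff E a" if "x \<in> carrier (fibre E 0)" for x using coeff(2)[OF that] by metis
  then show ?thesis
    unfolding irep_def by (auto simp: coeff bounded_opD[OF D(1)] D(4,5)) (metis D(4) D(5) coeff(3,4) coeff(5))+
qed

text \<open>Each fibre is represented by some \<open>B\<close> built from products of the
  \<open>S i\<close>. It is left existential because only two facts about it matter: it evaluates
  \<open>tilde_word\<close>, and it preserves every closed subspace that the generators
  preserve.\<close>

lemma tilde_word_irep:
  assumes L: "closed_csubspace L"
    and inv: "\<And>i x h. x \<in> carrier (gen E i) \<Longrightarrow> h \<in> L \<Longrightarrow> S i x h \<in> L" "\<And>a h. h \<in> L \<Longrightarrow> \<sigma> a h \<in> L"
  shows "\<exists>B. irep (fibre E (word_degree w)) \<sigma> B \<and>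
    (\<forall>x\<in>carrier (fibre E (word_degree w)). \<forall>h\<in>L. B x h \<in> L) \<and>
    (\<forall>z\<in>carrier (tensor (fibre E (word_degree w)) (hilbert_corr UNIV \<sigma>)). tilde_word E UNIV S \<sigma> w z = tval B z)"
proof (induction w)
  case Nil
  show ?case
    using irep_coeff inv(2) tilde_tval[OF irep_coeff]
    by (intro exI[of _ "\<lambda>x. \<sigma> (inv (coeff E) x)"]) (auto simp: word_degree_def)
next
  case (Cons i w)
  define n where "n = word_degree w"
  obtain B where Bw: "irep (fibre E n) \<sigma> B" "\<And>x h. x \<in> carrier (fibre E n) \<Longrightarrow> h \<in> L \<Longrightarrow> B x h \<in> L"
    "\<And>z. z \<in> carrier (tensor (fibre E n) (hilbert_corr UNIV \<sigma>)) \<Longrightarrow> tilde_word E UNIV S \<sigma> w z = tval B z"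
    using Cons unfolding n_def by blast
  interpret irep_pair "gen E i" "fibre E n" \<sigma> "S i" B
    by (intro irep_pair.intro tens.intro irep_pair_axioms.intro gen_correspondence product_systemD(2)[OF E] \<sigma> irep_S Bw)
  define \<psi> where "\<psi> = mult_iso_inv E (axis i 1) n"
  have deg: "word_degree (i # w) = axis i 1 + n" by (simp add: word_degree_def n_def)
  have \<psi>: "\<psi> x \<in> carrier (tensor (gen E i) (fibre E n))" if "x \<in> carrier (fibre E (axis i 1 + n))" for x
    unfolding \<psi>_def gen_def by (rule mult_iso_inv(1)[OF E that])
  have r: "irep (fibre E (axis i 1 + n)) \<sigma> (\<lambda>x. rep_tensor (S i) B (\<psi> x))"
    by (rule irep_comp[OF irep_rep_tensor \<psi>])
      (auto simp: \<psi>_def gen_def mult_iso_inv_ip[OF E] mult_iso_inv_lact[OF E])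
  show ?case
    unfolding deg
  proof (intro exI conjI ballI)
    show "irep (fibre E (axis i 1 + n)) \<sigma> (\<lambda>x. rep_tensor (S i) B (\<psi> x))" by (rule r)
    show "rep_tensor (S i) B (\<psi> x) h \<in> L" if "x \<in> carrier (fibre E (axis i 1 + n))" "h \<in> L" for x h
      by (rule rep_tensor_closed[OF L \<psi>[OF that(1)]]) (use inv Bw that in auto)
    fix z assume z: "z \<in> carrier (tensor (fibre E (axis i 1 + n)) (hilbert_corr UNIV \<sigma>))"
    show "tilde_word E UNIV S \<sigma> (i # w) z = tval (\<lambda>x. rep_tensor (S i) B (\<psi> x)) z"
      using tensor_id_tval[OF irep_rep_tensor r \<psi> z] tilde_id_tensor_assoc[of _ "tilde_word E UNIV S \<sigma> w"] Bw(3)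
      by (simp del: One_nat_def flip: n_def \<psi>_def)
  qed
qed

lemma word_degree_count: "word_degree w $ j = count_list w j"
  by (induction w) (auto simp: word_degree_def axis_def)

lemma word_degree_sorted_word: "word_degree (sorted_word n) = n"
proof -
  have rep: "count_list (replicate m i) j = (if i = j then m else 0)" for m i j
    by (induction m) auto
  have "count_list (concat (map (\<lambda>i. replicate (n $ i) i) xs)) j = (\<Sum>i\<leftarrow>xs. if i = j then n $ i else 0)" for xs j
    by (induction xs) (auto simp: rep)
  then have "count_list (sorted_word n) j = (\<Sum>i\<in>UNIV. if i = j then n $ i else 0)" for j
    unfolding sorted_word_def by (simp add: sum_list_distinct_conv_sum_set)
  then show ?thesis by (simp add: vec_eq_iff word_degree_count)
qed

text \<open>Elements of the spanning set are limits of sums of vectors \<open>B x v\<close> with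
  \<open>v\<close> in \<open>V\<close>, so they remain in \<open>L\<close>. Minimality of the
  dilation thereby becomes cyclicity of \<open>V\<close>.\<close>

lemma minimal_dilation_cyclic:
  assumes min: "minimal_dilation E UNIV S \<sigma> V" and V: "csubspace V" "V \<subseteq> L" and L: "closed_csubspace L"
    and inv: "\<And>i x h. x \<in> carrier (gen E i) \<Longrightarrow> h \<in> L \<Longrightarrow> S i x h \<in> L" "\<And>a h. h \<in> L \<Longrightarrow> \<sigma> a h \<in> L"
  shows "L = UNIV"
proof -
  have "tilde_n E UNIV S \<sigma> n (id_tensor (fibre E n) UNIV \<sigma> id z) \<in> L"
    if z: "z \<in> carrier (tensor (fibre E n) (hilbert_corr V \<sigma>))" for n z
  proof -
    obtain B where B: "irep (fibre E n) \<sigma> B" "\<And>x h. x \<in> carrier (fibre E n) \<Longrightarrow> h \<in> L \<Longrightarrow> B x h \<in> L"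
      "\<And>z. z \<in> carrier (tensor (fibre E n) (hilbert_corr UNIV \<sigma>)) \<Longrightarrow> tilde_n E UNIV S \<sigma> n z = tval B z"
      using tilde_word_irep[OF L inv, of "sorted_word n"] unfolding word_degree_sorted_word tilde_n_def by blast
    note f = fmodel_irep[OF B(1) V(1)]
    note X = tensor_memD[OF f z trep_tensor[OF f z]]
    have "tilde_n E UNIV S \<sigma> n (id_tensor (fibre E n) UNIV \<sigma> id z) = tval B z"
      using id_tensor_tval[OF B(1) f _ z, of id] B(3) by simp
    moreover have "tval B z \<in> L"
    proof (rule closed_csubspace_limit[OF L X(3)])
      show "lsum B (trep z n) \<in> L" for n
        using X(2)[of n] V(2) B(2) by (intro lsum_closed closed_csubspaceD(2)[OF L]) auto
    qed
    ultimately show ?thesis by simp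
  qed
  then have "closed_span (\<Union>n. tilde_n E UNIV S \<sigma> n ` id_tensor (fibre E n) UNIV \<sigma> id `
      carrier (tensor (fibre E n) (hilbert_corr V \<sigma>))) \<subseteq> L"
    by (intro closed_span_minimal[OF _ L]) auto
  then show ?thesis using min by (auto simp: minimal_dilation_def)
qed

end

subsection \<open>Coinvariant subspaces\<close>

lemma closed_csubspace_vimage:
  assumes T: "bounded_op UNIV T" and L: "closed_csubspace L"
  shows "closed_csubspace {h. T h \<in> L}"
proof -
  note D = bounded_opD[OF T]
  have "closed {h. T h \<in> L}"
    using closed_vimage[OF closed_csubspaceD(1)[OF L] linear_continuous_on[OF D(5)]]
    by (simp add: vimage_def)
  then show ?thesis
    by (auto simp: closed_csubspace_def csubspace_def D closed_csubspaceD[OF L])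
qed

text \<open>The factor \<open>K\<close> is beaten by unbounded exponents. In the angle estimate this
  removes a constant that depends on the vector.\<close>

lemma power_growth_le:
  fixes p b K :: real
  assumes "0 \<le> b" "0 \<le> p" and le: "\<And>r. p ^ (2 ^ r) \<le> K * b ^ (2 ^ r)"
  shows "p \<le> b"
proof (rule ccontr)
  assume "\<not> p \<le> b"
  then have pb: "p > b" by simp
  show False
  proof (cases "b = 0")
    case True
    then show ?thesis using le[of 0] pb by simp
  next
    case False
    then have b: "b > 0" using assms by simp
    then obtain n where n: "K < (p / b) ^ n" using real_arch_pow[of "p / b" K] pb by auto
    also have "\<dots> \<le> (p / b) ^ (2 ^ n)" using b pb by (intro power_increasing) (auto simp: less_imp_le)
    finally show ?thesis using le[of n] b by (simp add: power_divide field_simps)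
  qed
qed

text \<open>All that the geometric part needs: operators with the inner products of an isometric
  representation, and commutation in the form of convergent sums. Carriers, inner products, left
  actions and flip sums are parameters independent of \<open>S\<close>, so two representations of
  one product system can share them.\<close>

locale commuting_rep =
  fixes C :: "'k \<Rightarrow> 'e set" and ipA :: "'k \<Rightarrow> 'e \<Rightarrow> 'e \<Rightarrow> 'a::cstar_algebra" and la :: "'k \<Rightarrow> 'a \<Rightarrow> 'e \<Rightarrow> 'e"
    and fl :: "'k \<Rightarrow> 'k \<Rightarrow> 'e \<Rightarrow> 'e \<Rightarrow> nat \<Rightarrow> ('e \<times> 'e) list"
    and S :: "'k \<Rightarrow> 'e \<Rightarrow> 'h::complex_hilbert \<Rightarrow> 'h" and \<sigma> :: "'a \<Rightarrow> 'h \<Rightarrow> 'h"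
  assumes rep_\<sigma>: "unital_representation UNIV \<sigma>"
    and S_bounded: "x \<in> C i \<Longrightarrow> bounded_op UNIV (S i x)"
    and S_isometric: "x \<in> C i \<Longrightarrow> y \<in> C i \<Longrightarrow> cinner (S i x h) (S i y g) = cinner h (\<sigma> (ipA i x y) g)"
    and la_closed: "x \<in> C i \<Longrightarrow> la i a x \<in> C i"
    and S_la: "x \<in> C i \<Longrightarrow> S i (la i a x) h = \<sigma> a (S i x h)"
    and fl_closed: "x \<in> C i \<Longrightarrow> y \<in> C j \<Longrightarrow> set (fl i j x y n) \<subseteq> C j \<times> C i"
    and fl_tendsto: "x \<in> C i \<Longrightarrow> y \<in> C j \<Longrightarrow>
      (\<lambda>n. lsum (\<lambda>y' x'. S j y' (S i x' h)) (fl i j x y n)) \<longlonglongrightarrow> S i x (S j y h)"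
begin

lemmas \<sigma>D = unital_representationD[OF rep_\<sigma>]
lemmas \<sigma>L = bounded_opD[OF \<sigma>D(1)]
lemmas SL = bounded_opD[OF S_bounded]

definition \<sigma>inv :: "'h set \<Rightarrow> bool"
  where "\<sigma>inv M \<longleftrightarrow> (\<forall>a. \<forall>h\<in>M. \<sigma> a h \<in> M)"

definition Theta :: "'k \<Rightarrow> 'h set \<Rightarrow> 'h set"
  where "Theta i M = closed_span {S i x h |x h. x \<in> C i \<and> h \<in> M}"

definition invariant :: "'h set \<Rightarrow> bool"
  where "invariant L \<longleftrightarrow> (\<forall>i. \<forall>x\<in>C i. \<forall>h\<in>L. S i x h \<in> L) \<and> \<sigma>inv L"

text \<open>Stated through the complement, so that no adjoint operator occurs;
  \<open>coinv_iff_adjoint\<close> gives the usual form.\<close>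

definition coinv :: "'h set \<Rightarrow> bool"
  where "coinv W \<longleftrightarrow> closed_csubspace W \<and> invariant (orth_compl W)"

text \<open>The cyclic subspace generated by \<open>X\<close>. That it agrees with the closed span
  under the WOT-closed algebra is part of the proof of
  \<open>cyclic_coinvariant_iff\<close>.\<close>

definition reach :: "'h set \<Rightarrow> 'h set"
  where "reach X = (\<lambda>L. closed_csubspace L \<and> invariant L) hull X"

definition dense_range :: bool
  where "dense_range \<longleftrightarrow> (\<forall>i h. (\<forall>x\<in>C i. \<forall>g. cinner (S i x g) h = 0) \<longrightarrow> h = 0)"

lemma invariantD:
  assumes "invariant L"
  shows "x \<in> C i \<Longrightarrow> h \<in> L \<Longrightarrow> S i x h \<in> L" "h \<in> L \<Longrightarrow> \<sigma> a h \<in> L" "\<sigma>inv L"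
  using assms by (auto simp: invariant_def \<sigma>inv_def)

lemma Theta_closed: "closed_csubspace (Theta i M)"
  unfolding Theta_def by (rule closed_csubspace_closed_span)

lemma Theta_in: "x \<in> C i \<Longrightarrow> h \<in> M \<Longrightarrow> S i x h \<in> Theta i M"
  unfolding Theta_def by (rule subsetD[OF closed_span_superset]) blast

lemma Theta_mono: "M \<subseteq> N \<Longrightarrow> Theta i M \<subseteq> Theta i N"
  unfolding Theta_def by (rule closed_span_mono) blast

lemma Theta_minimal:
  "(\<And>x h. x \<in> C i \<Longrightarrow> h \<in> M \<Longrightarrow> S i x h \<in> L) \<Longrightarrow> closed_csubspace L \<Longrightarrow> Theta i M \<subseteq> L"
  unfolding Theta_def by (rule closed_span_minimal) blast+

lemma Theta_\<sigma>inv: "\<sigma>inv (Theta i M)"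
  unfolding \<sigma>inv_def
proof (intro allI)
  fix a
  have "Theta i M \<subseteq> {h. \<sigma> a h \<in> Theta i M}"
    by (rule Theta_minimal)
      (auto simp: S_la[symmetric] la_closed Theta_in closed_csubspace_vimage[OF \<sigma>D(1) Theta_closed])
  then show "\<forall>h\<in>Theta i M. \<sigma> a h \<in> Theta i M" by blast
qed

text \<open>Each \<open>S i x (S j y m)\<close> is a limit of sums of vectors
  \<open>S j y' (S i x' m)\<close>. Exchanging \<open>i\<close> and \<open>j\<close> shows that the
  inclusion is in fact an equality.\<close>

lemma Theta_commute: "Theta i (Theta j M) \<subseteq> Theta j (Theta i M)"
proof (rule Theta_minimal[OF _ Theta_closed])
  fix x h assume x: "x \<in> C i" and h: "h \<in> Theta j M"
  have "Theta j M \<subseteq> {h. S i x h \<in> Theta j (Theta i M)}"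
  proof (rule Theta_minimal)
    fix y m assume y: "y \<in> C j" and m: "m \<in> M"
    have "S i x (S j y m) \<in> Theta j (Theta i M)"
      by (rule closed_csubspace_limit[OF Theta_closed fl_tendsto[OF x y]])
        (use fl_closed[OF x y] m in \<open>auto intro!: lsum_closed Theta_in closed_csubspaceD(2)[OF Theta_closed]\<close>)
    then show "S j y m \<in> {h. S i x h \<in> Theta j (Theta i M)}" by simp
  qed (rule closed_csubspace_vimage[OF S_bounded[OF x] Theta_closed])
  then show "S i x h \<in> Theta j (Theta i M)" using h by blast
qed

lemma Theta_closure:
  assumes M: "csubspace M"
  shows "Theta i M = closure (lsum (S i) ` {u. set u \<subseteq> C i \<times> M})"
proof
  let ?X = "lsum (S i) ` {u. set u \<subseteq> C i \<times> M}"
  have "csubspace ?X"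
  proof (rule csubspaceI)
    show "0 \<in> ?X" by (rule image_eqI[of _ _ "[]"]) auto
    show "a + b \<in> ?X" if "a \<in> ?X" "b \<in> ?X" for a b
    proof -
      obtain u v where "a = lsum (S i) u" "b = lsum (S i) v" "set u \<subseteq> C i \<times> M" "set v \<subseteq> C i \<times> M"
        using \<open>a \<in> ?X\<close> \<open>b \<in> ?X\<close> by blast
      then show ?thesis by (intro image_eqI[of _ _ "u @ v"]) (auto simp: lsum_append)
    qed
    show "c *\<^sub>C a \<in> ?X" if a: "a \<in> ?X" for c a
    proof -
      obtain u where u: "a = lsum (S i) u" "set u \<subseteq> C i \<times> M" using a by blast
      have "c *\<^sub>C lsum (S i) u = lsum (S i) (map (\<lambda>(x, h). (x, c *\<^sub>C h)) u)"
        using u(2) by (induction u) (auto simp: scaleC_add_right SL)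
      then show ?thesis using u csubspaceD(3)[OF M]
        by (intro image_eqI[of _ _ "map (\<lambda>(x, h). (x, c *\<^sub>C h)) u"]) auto
    qed
  qed
  then have cl: "closed_csubspace (closure ?X)" by (rule closed_csubspace_closure)
  show "Theta i M \<subseteq> closure ?X"
  proof (rule Theta_minimal[OF _ cl])
    fix x h assume "x \<in> C i" "h \<in> M"
    then have "S i x h \<in> ?X" by (intro image_eqI[of _ _ "[(x, h)]"]) auto
    then show "S i x h \<in> closure ?X" by (rule subsetD[OF closure_subset])
  qed
  have "?X \<subseteq> Theta i M"
    by (auto intro!: lsum_closed Theta_in closed_csubspaceD(2)[OF Theta_closed])
  then show "closure ?X \<subseteq> Theta i M" by (rule closure_minimal[OF _ closed_csubspaceD(1)[OF Theta_closed]])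
qed

lemma orth_compl_\<sigma>inv:
  assumes "\<sigma>inv M"
  shows "\<sigma>inv (orth_compl M)"
  unfolding \<sigma>inv_def
proof (intro allI ballI)
  fix a h assume h: "h \<in> orth_compl M"
  have "cinner v (\<sigma> a h) = 0" if "v \<in> M" for v
    using assms that orth_complD[OF h, of "\<sigma> (star a) v"] by (simp add: \<sigma>inv_def \<sigma>D(5) star_star)
  then show "\<sigma> a h \<in> orth_compl M" by (simp add: orth_compl_def)
qed

lemma coinvD:
  assumes "coinv W"
  shows "closed_csubspace W" "x \<in> C i \<Longrightarrow> h \<in> orth_compl W \<Longrightarrow> S i x h \<in> orth_compl W"
    "h \<in> orth_compl W \<Longrightarrow> \<sigma> a h \<in> orth_compl W" "\<sigma>inv W"
proof -
  show 1: "closed_csubspace W" "x \<in> C i \<Longrightarrow> h \<in> orth_compl W \<Longrightarrow> S i x h \<in> orth_compl W"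
    "h \<in> orth_compl W \<Longrightarrow> \<sigma> a h \<in> orth_compl W"
    using assms by (auto simp: coinv_def invariant_def \<sigma>inv_def)
  show "\<sigma>inv W"
    using orth_compl_\<sigma>inv[of "orth_compl W"] assms orth_compl_orth_compl[OF 1(1)]
    by (simp add: coinv_def invariant_def)
qed

text \<open>The inner product of \<open>S i y m\<close> with \<open>S i x h\<close> is that of
  \<open>m\<close> with \<open>\<sigma> (ipA i y x) h\<close>; this is why the whole \<sigma>-orbit
  of \<open>h\<close> has to be orthogonal to \<open>M\<close>.\<close>

lemma S_orth_Theta:
  assumes "x \<in> C i" "\<And>a. \<sigma> a h \<in> orth_compl M"
  shows "S i x h \<in> orth_compl (Theta i M)"
  unfolding Theta_def orth_compl_closed_span
  using assms orth_complD[OF assms(2)] by (auto simp: orth_compl_def[of "Collect _"] S_isometric)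

text \<open>Let \<open>Q = Theta i W\<close> and split \<open>h\<close> along \<open>W\<close>. The
  image of the part in \<open>W\<close> lies in \<open>Q\<close>; the image of the other part is
  orthogonal to \<open>W\<close> by coinvariance and to \<open>Q\<close> by
  \<open>S_orth_Theta\<close>. Hence \<open>v - proj Q v\<close> is orthogonal to every
  \<open>S i x h\<close>, and \<open>dense_range\<close> makes it zero.\<close>

lemma coinv_le_Theta:
  assumes W: "coinv W" and d: dense_range
  shows "W \<subseteq> Theta i W"
proof
  fix v assume v: "v \<in> W"
  define Q where "Q = Theta i W"
  have Q: "closed_csubspace Q" unfolding Q_def by (rule Theta_closed)
  note Wc = coinvD(1)[OF W]
  have "cinner (S i x h) (v - proj Q v) = 0" if x: "x \<in> C i" for x h
  proof -
    define k where "k = h - proj W h"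
    have k: "k \<in> orth_compl W" unfolding k_def by (rule proj_orth[OF Wc])
    have "S i x (proj W h) \<in> Q" unfolding Q_def by (intro Theta_in x proj_in[OF Wc])
    then have 1: "cinner (S i x (proj W h)) (v - proj Q v) = 0"
      using orth_complD[OF proj_orth[OF Q]] by blast
    have 2: "cinner (S i x k) v = 0" using orth_complD[OF coinvD(2)[OF W x k] v] by blast
    have "S i x k \<in> orth_compl Q" unfolding Q_def by (rule S_orth_Theta[OF x coinvD(3)[OF W k]])
    then have 3: "cinner (S i x k) (proj Q v) = 0" using orth_complD proj_in[OF Q] by blast
    have "S i x h = S i x (proj W h) + S i x k" by (simp add: k_def SL(4)[OF x])
    then show ?thesis using 1 2 3 by (simp add: cinner_add_left cinner_diff_right)
  qed
  then have "v - proj Q v = 0" using d unfolding dense_range_def by blast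
  then show "v \<in> Theta i W" using proj_in[OF Q, of v] by (simp add: Q_def)
qed

lemma reach:
  "closed_csubspace (reach X)" "invariant (reach X)" "X \<subseteq> reach X"
  "X \<subseteq> L \<Longrightarrow> closed_csubspace L \<Longrightarrow> invariant L \<Longrightarrow> reach X \<subseteq> L"
proof -
  have "closed_csubspace (reach X) \<and> invariant (reach X)"
    unfolding reach_def
    by (rule hull_in) (auto simp: closed_csubspace_def csubspace_def invariant_def \<sigma>inv_def)
  then show "closed_csubspace (reach X)" "invariant (reach X)" by auto
  show "X \<subseteq> reach X" unfolding reach_def by (rule hull_subset)
  show "X \<subseteq> L \<Longrightarrow> closed_csubspace L \<Longrightarrow> invariant L \<Longrightarrow> reach X \<subseteq> L"
    unfolding reach_def by (rule hull_minimal) auto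
qed

section \<open>Words in the operations \<open>Theta i\<close> and the subspace they exhaust\<close>

definition Thetas :: "'k list \<Rightarrow> 'h set \<Rightarrow> 'h set"
  where "Thetas w M = foldr Theta w M"

lemma Thetas_simps [simp]: "Thetas [] M = M" "Thetas (i # w) M = Theta i (Thetas w M)"
  "Thetas (w @ w') M = Thetas w (Thetas w' M)"
  by (auto simp: Thetas_def)

lemma Thetas_mono: "M \<subseteq> N \<Longrightarrow> Thetas w M \<subseteq> Thetas w N"
  by (induction w) (auto dest: Theta_mono)

lemma Theta_Thetas: "Theta i (Thetas w M) \<subseteq> Thetas w (Theta i M)"
proof (induction w)
  case (Cons j w)
  show ?case using order_trans[OF Theta_commute[of i j "Thetas w M"] Theta_mono[OF Cons, of j]] by simp
qed simp

lemma Thetas_commute: "Thetas w' (Thetas w M) \<subseteq> Thetas w (Thetas w' M)"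
proof (induction w')
  case (Cons i w')
  then show ?case using Theta_mono[OF Cons, of i] Theta_Thetas[of i w "Thetas w' M"] by simp
qed simp

lemma Thetas_closed: "closed_csubspace W \<Longrightarrow> closed_csubspace (Thetas w W)"
  by (cases w) (auto simp: Theta_closed)

lemma Thetas_\<sigma>inv: "\<sigma>inv W \<Longrightarrow> \<sigma>inv (Thetas w W)"
  by (cases w) (auto simp: Theta_\<sigma>inv)

lemma le_Thetas:
  assumes "\<And>i. W \<subseteq> Theta i W"
  shows "W \<subseteq> Thetas w W"
proof (induction w)
  case (Cons i w)
  show ?case using assms[of i] Theta_mono[OF Cons, of i] by auto
qed simp

text \<open>Adding letters on the inside enlarges the space because \<open>W\<close> lies in every
  \<open>Thetas w' W\<close>; commutation reduces the second inclusion to the same fact.\<close>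

lemma Thetas_directed:
  assumes "\<And>i. W \<subseteq> Theta i W"
  shows "Thetas w W \<subseteq> Thetas (w @ w') W" "Thetas w' W \<subseteq> Thetas (w @ w') W"
  using Thetas_mono[OF le_Thetas[OF assms, of w'], of w]
    order_trans[OF Thetas_mono[OF le_Thetas[OF assms, of w], of w'] Thetas_commute[of w' w W]]
  by auto

lemma reach_le_closure:
  assumes W: "closed_csubspace W" "\<sigma>inv W" and le: "\<And>i. W \<subseteq> Theta i W"
  shows "reach W \<subseteq> closure (\<Union>w. Thetas w W)"
proof (rule reach(4))
  let ?U = "\<Union>w. Thetas w W"
  have "csubspace ?U"
  proof (rule csubspaceI)
    show "0 \<in> ?U" using closed_csubspaceD(3)[OF W(1)] by (auto intro!: exI[of _ "[]"])
    show "x + y \<in> ?U" if "x \<in> ?U" "y \<in> ?U" for x y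
    proof -
      obtain w w' where w: "x \<in> Thetas w W" "y \<in> Thetas w' W" using \<open>x \<in> ?U\<close> \<open>y \<in> ?U\<close> by blast
      then have "x \<in> Thetas (w @ w') W" "y \<in> Thetas (w @ w') W" using Thetas_directed[OF le] by blast+
      then have "x + y \<in> Thetas (w @ w') W" using closed_csubspaceD(4)[OF Thetas_closed[OF W(1)]] by blast
      then show ?thesis by blast
    qed
    show "c *\<^sub>C x \<in> ?U" if "x \<in> ?U" for c x
      using that closed_csubspaceD(5)[OF Thetas_closed[OF W(1)]] by blast
  qed
  then show cl: "closed_csubspace (closure ?U)" by (rule closed_csubspace_closure)
  show "W \<subseteq> closure ?U"
    using closure_subset[of ?U] by (auto intro!: subsetD[OF closure_subset] exI[of _ "[]"])
  have closure_min: "closure ?U \<subseteq> {h. T h \<in> closure ?U}"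
    if "bounded_op UNIV T" "\<And>w h. h \<in> Thetas w W \<Longrightarrow> T h \<in> ?U" for T
    using that closure_subset[of ?U] closed_csubspaceD(1)[OF closed_csubspace_vimage[OF that(1) cl]]
    by (intro closure_minimal) blast+
  show "invariant (closure ?U)"
    unfolding invariant_def \<sigma>inv_def
  proof (intro conjI allI ballI)
    fix i x h assume x: "x \<in> C i" and h: "h \<in> closure ?U"
    have "S i x g \<in> ?U" if "g \<in> Thetas w W" for w g
      using Theta_in[OF x that] Thetas_simps(2)[of i w W] by blast
    then show "S i x h \<in> closure ?U" using closure_min[OF S_bounded[OF x]] h by blast
  next
    fix a h assume h: "h \<in> closure ?U"
    have "\<sigma> a g \<in> ?U" if "g \<in> Thetas w W" for w g
      using Thetas_\<sigma>inv[OF W(2), of w] that unfolding \<sigma>inv_def by blast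
    then show "\<sigma> a h \<in> closure ?U" using closure_min[OF \<sigma>D(1)] h by blast
  qed
qed

text \<open>Together with invariance of \<open>L = reach X\<close> this makes \<open>L\<close>
  reducing. The intersection of all \<open>Theta i L\<close> is closed, invariant by commutation,
  and contains \<open>X\<close>; so \<open>L\<close> lies in each \<open>Theta i L\<close>. Since
  \<open>S i x\<close> sends the complement of \<open>L\<close> into that of
  \<open>Theta i L\<close>, it preserves the complement of \<open>L\<close>.\<close>

lemma invariant_orth_reach:
  assumes "coinv X" dense_range
  shows "invariant (orth_compl (reach X))"
proof -
  define L where "L = reach X"
  note L = reach[of X, folded L_def]
  have le: "L \<subseteq> Theta i L" for i
  proof -
    have "L \<subseteq> (\<Inter>i. Theta i L)"
      unfolding L_def
    proof (rule reach(4); fold L_def)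
      show "X \<subseteq> (\<Inter>i. Theta i L)" using coinv_le_Theta[OF assms] Theta_mono[OF L(3)] by blast
      show "closed_csubspace (\<Inter>i. Theta i L)"
        using Theta_closed by (auto simp: closed_csubspace_def csubspace_def intro!: closed_INT)
      show "invariant (\<Inter>i. Theta i L)"
        unfolding invariant_def \<sigma>inv_def
      proof (intro conjI allI ballI INT_I)
        fix j x h i assume x: "x \<in> C j" and h: "h \<in> (\<Inter>i. Theta i L)"
        have "S j x h \<in> Theta j (Theta i L)" using h by (intro Theta_in x) blast
        also have "\<dots> \<subseteq> Theta i (Theta j L)" by (rule Theta_commute)
        also have "\<dots> \<subseteq> Theta i L"
          by (intro Theta_mono Theta_minimal L(1)) (use invariantD(1)[OF L(2)] in blast)
        finally show "S j x h \<in> Theta i L" .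
      next
        fix a h i assume "h \<in> (\<Inter>i. Theta i L)"
        then show "\<sigma> a h \<in> Theta i L" using Theta_\<sigma>inv[of i L] unfolding \<sigma>inv_def by blast
      qed
    qed
    then show ?thesis by blast
  qed
  have s: "\<sigma>inv (orth_compl L)" by (rule orth_compl_\<sigma>inv[OF invariantD(3)[OF L(2)]])
  have "S i x h \<in> orth_compl L" if x: "x \<in> C i" and h: "h \<in> orth_compl L" for i x h
  proof -
    have "S i x h \<in> orth_compl (Theta i L)"
      by (rule S_orth_Theta[OF x]) (use s h in \<open>auto simp: \<sigma>inv_def\<close>)
    then show ?thesis using le[of i] by (auto simp: orth_compl_def)
  qed
  with s show ?thesis by (auto simp: invariant_def L_def)
qed

subsection \<open>Angles between subspaces\<close>

text \<open>For \<gamma> \<ge> 0 this says that the product of the two projections has norm at most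
  \<gamma>, a bound for the cosine of the minimal angle.\<close>

definition Angle :: "real \<Rightarrow> 'h set \<Rightarrow> 'h set \<Rightarrow> bool"
  where "Angle \<gamma> N M \<longleftrightarrow> (\<forall>n\<in>N. \<forall>m\<in>M. cmod (cinner n m) \<le> \<gamma> * norm n * norm m)"

text \<open>A substitute for computing with operators \<open>I \<otimes> A\<close>: inner products
  of such sums depend only on the numbers \<open>cinner (f h) (\<sigma> a (f' k))\<close>, so
  operators commuting with \<sigma> can be moved from one side to the other.\<close>

lemma cinner_lsum_cong:
  assumes u: "set u \<subseteq> C i \<times> N" and v: "set v \<subseteq> C i \<times> M"
    and eq: "\<And>h k a. h \<in> N \<Longrightarrow> k \<in> M \<Longrightarrow> cinner (f h) (\<sigma> a (f' k)) = cinner (g h) (\<sigma> a (g' k))"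
  shows "cinner (lsum (\<lambda>x h. S i x (f h)) u) (lsum (\<lambda>x h. S i x (f' h)) v) =
    cinner (lsum (\<lambda>x h. S i x (g h)) u) (lsum (\<lambda>x h. S i x (g' h)) v)"
proof -
  have "cinner (S i x (f h)) (lsum (\<lambda>x h. S i x (f' h)) v) = cinner (S i x (g h)) (lsum (\<lambda>x h. S i x (g' h)) v)"
    if "x \<in> C i" "h \<in> N" for x h
    using v by (induction v) (auto simp: cinner_add_right S_isometric that eq)
  then show ?thesis using u by (induction u) (auto simp: cinner_add_left)
qed

lemma proj_\<sigma>:
  assumes M: "closed_csubspace M" "\<sigma>inv M"
  shows "\<sigma> a (proj M h) = proj M (\<sigma> a h)"
proof (rule sym, rule proj_eqI[OF M(1)])
  show "\<sigma> a (proj M h) \<in> M" using M(2) proj_in[OF M(1)] by (simp add: \<sigma>inv_def)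
  show "\<sigma> a h - \<sigma> a (proj M h) \<in> orth_compl M"
    using orth_compl_\<sigma>inv[OF M(2)] proj_orth[OF M(1)] by (metis \<sigma>L(4) \<sigma>inv_def)
qed

text \<open>Tensoring with the identity does not increase the norm of \<open>P\<^sub>N P\<^sub>M\<close>: the moments
  \<open>p k = \<langle>u, (I \<otimes> T\<^sup>k) u\<rangle>\<close> of \<open>T = P\<^sub>N P\<^sub>M P\<^sub>N\<close> satisfy \<open>(p k)\<^sup>2 \<le> p 0 p (2k)\<close> and grow at most
  like \<open>\<gamma>\<^bsup>2k\<^esup>\<close>.\<close>

lemma Angle_lsum:
  assumes N: "closed_csubspace N" "\<sigma>inv N" and M: "closed_csubspace M" "\<sigma>inv M"
    and \<gamma>: "\<gamma> \<ge> 0" and A: "Angle \<gamma> N M"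
    and u: "set u \<subseteq> C i \<times> N" and v: "set v \<subseteq> C i \<times> M"
  shows "cmod (cinner (lsum (S i) u) (lsum (S i) v)) \<le> \<gamma> * norm (lsum (S i) u) * norm (lsum (S i) v)"
proof -
  define T where "T h = proj N (proj M h)" for h
  define z where "z k = lsum (\<lambda>x h. S i x ((T ^^ k) h)) u" for k
  define p where "p k = cinner (z 0) (z k)" for k
  have TN: "(T ^^ k) h \<in> N" if "h \<in> N" for k h
    using that by (induction k) (auto simp: T_def proj_in[OF N(1)])
  have T_sa: "cinner (T h) g = cinner h (T g)" if "h \<in> N" "g \<in> N" for h g
    using that by (simp add: T_def cinner_proj_left[OF N(1)] cinner_proj_right[OF N(1)])
      (metis cinner_proj_left[OF M(1) proj_in[OF M(1)]] cinner_proj_right[OF M(1) proj_in[OF M(1)]])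
  have Tk_sa: "cinner ((T ^^ k) h) g = cinner h ((T ^^ k) g)" if "h \<in> N" "g \<in> N" for h g k
    using that
  proof (induction k arbitrary: g)
    case (Suc k)
    have "cinner ((T ^^ Suc k) h) g = cinner ((T ^^ k) h) (T g)" using Suc.prems by (simp add: T_sa TN)
    also have "\<dots> = cinner h ((T ^^ k) (T g))"
      using Suc.prems by (intro Suc.IH) (auto simp: T_def proj_in[OF N(1)])
    finally show ?case by (simp add: funpow_swap1)
  qed simp
  have T\<sigma>: "(T ^^ k) (\<sigma> a h) = \<sigma> a ((T ^^ k) h)" for k a h
    by (induction k) (auto simp: T_def proj_\<sigma>[OF N] proj_\<sigma>[OF M])
  have Nsig: "\<sigma> a h \<in> N" if "h \<in> N" for a h using N(2) that by (simp add: \<sigma>inv_def)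
  have pz: "cinner (z j) (z k) = p (j + k)" for j k
    unfolding p_def z_def
  proof (rule cinner_lsum_cong[OF u u])
    fix h g a assume h: "h \<in> N" and g: "g \<in> N"
    have "cinner ((T ^^ j) h) (\<sigma> a ((T ^^ k) g)) = cinner h ((T ^^ j) (\<sigma> a ((T ^^ k) g)))"
      by (rule Tk_sa[OF h Nsig[OF TN[OF g]]])
    then show "cinner ((T ^^ j) h) (\<sigma> a ((T ^^ k) g)) = cinner ((T ^^ 0) h) (\<sigma> a ((T ^^ (j + k)) g))"
      by (simp add: T\<sigma> funpow_add)
  qed
  have z0: "z 0 = lsum (S i) u" by (simp add: z_def)
  have p0: "p 0 = of_real ((norm (z 0))\<^sup>2)" by (simp add: p_def cinner_same)
  have pk: "(cmod (p k))\<^sup>2 \<le> (norm (z 0))\<^sup>2 * cmod (p (2 * k))" for k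
  proof -
    have "p (2 * k) = of_real ((norm (z k))\<^sup>2)" using pz[of k k] by (simp add: cinner_same mult_2)
    then have "cmod (p (2 * k)) = (norm (z k))\<^sup>2" by (simp add: norm_power)
    moreover have "(cmod (p k))\<^sup>2 \<le> (norm (z 0) * norm (z k))\<^sup>2"
      unfolding p_def by (intro power_mono norm_cinner_le) simp
    ultimately show ?thesis by (simp add: power_mult_distrib)
  qed
  have norm_T: "norm (T h) \<le> \<gamma>\<^sup>2 * norm h" if h: "h \<in> N" for h
  proof -
    have PM: "norm (proj M n) \<le> \<gamma> * norm n" if "n \<in> N" for n
    proof (cases "proj M n = 0")
      case False
      have "(norm (proj M n))\<^sup>2 = cmod (cinner n (proj M n))"
        using cinner_proj_left[OF M(1) proj_in[OF M(1), of n], of n]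
        by (metis cinner_same norm_of_real abs_power2)
      also have "\<dots> \<le> \<gamma> * norm n * norm (proj M n)"
        using A that proj_in[OF M(1)] by (simp add: Angle_def)
      finally show ?thesis using False by (simp add: power2_eq_square)
    qed (use \<gamma> in simp)
    have "norm (proj N m) \<le> \<gamma> * norm m" if "m \<in> M" for m
    proof (cases "proj N m = 0")
      case False
      have "(norm (proj N m))\<^sup>2 = cmod (cinner (proj N m) m)"
        using cinner_proj_right[OF N(1) proj_in[OF N(1), of m], of m]
        by (metis cinner_same norm_of_real abs_power2)
      also have "\<dots> \<le> \<gamma> * norm (proj N m) * norm m"
        using A that proj_in[OF N(1)] by (simp add: Angle_def)
      finally show ?thesis using False by (simp add: power2_eq_square mult_ac)
    qed (use \<gamma> in simp)
    then have "norm (T h) \<le> \<gamma> * norm (proj M h)" unfolding T_def by (simp add: proj_in[OF M(1)])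
    also have "\<dots> \<le> \<gamma> * (\<gamma> * norm h)" using \<gamma> by (intro mult_left_mono PM h)
    finally show ?thesis by (simp add: power2_eq_square mult.assoc)
  qed
  have norm_Tk: "norm ((T ^^ k) h) \<le> (\<gamma>\<^sup>2) ^ k * norm h" if h: "h \<in> N" for k h
  proof (induction k)
    case (Suc k)
    have "norm ((T ^^ Suc k) h) \<le> \<gamma>\<^sup>2 * norm ((T ^^ k) h)" using norm_T[OF TN[OF h]] by simp
    also have "\<dots> \<le> \<gamma>\<^sup>2 * ((\<gamma>\<^sup>2) ^ k * norm h)" by (intro mult_left_mono Suc) simp
    finally show ?case by (simp add: mult.assoc)
  qed simp
  \<comment> \<open>\<open>K\<close> depends on \<open>u\<close> through bounds for the operators
    \<open>S i x\<close>. Only the rate in \<open>k\<close> matters, since the bound for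
    \<open>p 1\<close> uses exponents \<open>2 ^ r\<close> of arbitrary size.\<close>
  have "\<exists>K\<ge>0. \<forall>k. norm (z k) \<le> K * (\<gamma>\<^sup>2) ^ k"
    unfolding z_def using u
  proof (induction u)
    case Nil
    show ?case by (intro exI[of _ 0]) auto
  next
    case (Cons q u)
    obtain x h where q: "q = (x, h)" by (cases q)
    have xh: "x \<in> C i" "h \<in> N" using Cons.prems by (auto simp: q)
    obtain K where K: "K \<ge> 0" "\<And>k. norm (lsum (\<lambda>x h. S i x ((T ^^ k) h)) u) \<le> K * (\<gamma>\<^sup>2) ^ k"
      using Cons by auto
    obtain B where B: "B > 0" "\<And>g. norm (S i x g) \<le> norm g * B"
      using bounded_linear.pos_bounded[OF SL(5)[OF xh(1)]] by blast
    have "norm (S i x ((T ^^ k) h) + lsum (\<lambda>x h. S i x ((T ^^ k) h)) u) \<le> (norm h * B + K) * (\<gamma>\<^sup>2) ^ k" for k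
    proof -
      have "norm (S i x ((T ^^ k) h)) \<le> ((\<gamma>\<^sup>2) ^ k * norm h) * B"
        using B(2)[of "(T ^^ k) h"] mult_right_mono[OF norm_Tk[OF xh(2), of k], of B] B(1) by linarith
      then show ?thesis
        using norm_triangle_ineq[of "S i x ((T ^^ k) h)" "lsum (\<lambda>x h. S i x ((T ^^ k) h)) u"] K(2)[of k]
        by (simp add: algebra_simps)
    qed
    then show ?case using K(1) B(1) by (intro exI[of _ "norm h * B + K"]) (auto simp: q)
  qed
  then obtain K where K: "K \<ge> 0" "\<And>k. norm (z k) \<le> K * (\<gamma>\<^sup>2) ^ k" by blast
  have p1: "cmod (p 1) \<le> (norm (z 0))\<^sup>2 * \<gamma>\<^sup>2"
  proof (cases "z 0 = 0")
    case False
    define c where "c = (norm (z 0))\<^sup>2"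
    have c: "c > 0" using False by (simp add: c_def)
    \<comment> \<open>The estimate \<open>pk\<close> iterated along powers of two; divided by powers
      of \<open>c\<close> it says that the normalised first moment to the power \<open>2 ^ r\<close>
      is at most the normalised moment of order \<open>2 ^ r\<close>.\<close>
    have pow: "cmod (p 1) ^ (2 ^ r) * c \<le> c ^ (2 ^ r) * cmod (p (2 ^ r))" for r
    proof (induction r)
      case (Suc r)
      have "(cmod (p 1) ^ (2 ^ r) * c)\<^sup>2 \<le> (c ^ (2 ^ r) * cmod (p (2 ^ r)))\<^sup>2"
        using Suc c by (intro power_mono) auto
      also have "\<dots> \<le> (c ^ (2 ^ r))\<^sup>2 * (c * cmod (p (2 * 2 ^ r)))"
        unfolding power_mult_distrib c_def by (intro mult_left_mono pk) simp
      finally have "((cmod (p 1) ^ (2 ^ r))\<^sup>2 * c) * c \<le> ((c ^ (2 ^ r))\<^sup>2 * cmod (p (2 * 2 ^ r))) * c"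
        by (simp add: power_mult_distrib power2_eq_square[of c] mult_ac)
      then have "(cmod (p 1) ^ (2 ^ r))\<^sup>2 * c \<le> (c ^ (2 ^ r))\<^sup>2 * cmod (p (2 * 2 ^ r))"
        using c by (simp only: mult_le_cancel_right_pos)
      then show ?case by (simp flip: power_mult add: mult.commute)
    qed simp
    show ?thesis
      unfolding c_def[symmetric]
    proof (rule power_growth_le)
      fix r :: nat
      have "cmod (p (2 ^ r)) \<le> norm (z 0) * norm (z (2 ^ r))" unfolding p_def by (rule norm_cinner_le)
      also have "\<dots> \<le> norm (z 0) * (K * (\<gamma>\<^sup>2) ^ (2 ^ r))" by (intro mult_left_mono K) simp
      finally have "c ^ (2 ^ r) * cmod (p (2 ^ r)) \<le> c ^ (2 ^ r) * (norm (z 0) * (K * (\<gamma>\<^sup>2) ^ (2 ^ r)))"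
        using c by (intro mult_left_mono) auto
      then have "cmod (p 1) ^ (2 ^ r) * c \<le> (norm (z 0) * K) * (c * \<gamma>\<^sup>2) ^ (2 ^ r)"
        using pow[of r] by (simp add: power_mult_distrib mult_ac)
      then show "cmod (p 1) ^ (2 ^ r) \<le> (norm (z 0) * K / c) * (c * \<gamma>\<^sup>2) ^ (2 ^ r)"
        using c by (simp add: field_simps)
    qed (use c in auto)
  qed (simp add: p_def)
  \<comment> \<open>\<open>y\<close> is \<open>u\<close> with the projection onto \<open>M\<close>
    applied in the second leg. Its squared norm is the first moment, and the sum over
    \<open>v\<close>, having second legs in \<open>M\<close>, has the same inner product with
    \<open>y\<close> as with the original sum.\<close>
  define y where "y = lsum (\<lambda>x h. S i x (proj M h)) u"
  have "cinner y y = p 1"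
    unfolding y_def p_def z_def
  proof (rule cinner_lsum_cong[OF u u])
    fix h g a assume h: "h \<in> N" and g: "g \<in> N"
    have "cinner (proj M h) (\<sigma> a (proj M g)) = cinner h (\<sigma> a (proj M g))"
      by (rule cinner_proj_left[OF M(1)]) (simp add: proj_\<sigma>[OF M] proj_in[OF M(1)])
    also have "\<dots> = cinner h (proj N (\<sigma> a (proj M g)))" using cinner_proj_right[OF N(1) h] by simp
    finally show "cinner (proj M h) (\<sigma> a (proj M g)) = cinner ((T ^^ 0) h) (\<sigma> a ((T ^^ 1) g))"
      by (simp add: T_def proj_\<sigma>[OF N])
  qed
  then have "(norm y)\<^sup>2 \<le> (\<gamma> * norm (z 0))\<^sup>2"
    using p1 by (metis cinner_same norm_of_real abs_power2 power_mult_distrib mult.commute)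
  then have y: "norm y \<le> \<gamma> * norm (z 0)" by (rule power2_le_imp_le) (use \<gamma> in simp)
  have "cinner (lsum (\<lambda>x h. S i x h) u) (lsum (\<lambda>x h. S i x h) v) = cinner y (lsum (\<lambda>x h. S i x h) v)"
    unfolding y_def
  proof (rule cinner_lsum_cong[OF u v])
    fix h k a assume "h \<in> N" "k \<in> M"
    then have "\<sigma> a k \<in> M" using M(2) by (simp add: \<sigma>inv_def)
    then show "cinner h (\<sigma> a k) = cinner (proj M h) (\<sigma> a k)" by (simp add: cinner_proj_left[OF M(1)])
  qed
  then have "cmod (cinner (lsum (S i) u) (lsum (S i) v)) \<le> norm y * norm (lsum (S i) v)"
    using norm_cinner_le by simp
  also have "\<dots> \<le> \<gamma> * norm (z 0) * norm (lsum (S i) v)" by (intro mult_right_mono y) simp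
  finally show ?thesis by (simp add: z0)
qed

lemma Angle_Theta:
  assumes N: "closed_csubspace N" "\<sigma>inv N" and M: "closed_csubspace M" "\<sigma>inv M"
    and \<gamma>: "\<gamma> \<ge> 0" and A: "Angle \<gamma> N M"
  shows "Angle \<gamma> (Theta i N) (Theta i M)"
  unfolding Angle_def
proof (intro ballI)
  fix n m assume "n \<in> Theta i N" "m \<in> Theta i M"
  then obtain X Y where X: "\<And>k. X k \<in> lsum (S i) ` {u. set u \<subseteq> C i \<times> N}" "X \<longlonglongrightarrow> n"
    and Y: "\<And>k. Y k \<in> lsum (S i) ` {u. set u \<subseteq> C i \<times> M}" "Y \<longlonglongrightarrow> m"
    unfolding Theta_closure[OF closed_csubspaceD(2)[OF N(1)]] Theta_closure[OF closed_csubspaceD(2)[OF M(1)]]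
      closure_sequential by blast
  have "cmod (cinner (X k) (Y k)) \<le> \<gamma> * norm (X k) * norm (Y k)" for k
    using X(1)[of k] Y(1)[of k] Angle_lsum[OF N M \<gamma> A] by auto
  then show "cmod (cinner n m) \<le> \<gamma> * norm n * norm m"
    by (intro LIMSEQ_le[of "\<lambda>k. cmod (cinner (X k) (Y k))" _ "\<lambda>k. \<gamma> * norm (X k) * norm (Y k)"])
      (auto intro!: tendsto_intros tendsto_cinner X Y)
qed

lemma Angle_Thetas:
  assumes "closed_csubspace N" "\<sigma>inv N" "closed_csubspace M" "\<sigma>inv M" "\<gamma> \<ge> 0" "Angle \<gamma> N M"
  shows "Angle \<gamma> (Thetas w N) (Thetas w M)"
  by (induction w) (use assms in \<open>auto intro!: Angle_Theta Thetas_closed Thetas_\<sigma>inv\<close>)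

text \<open>On the compact unit sphere of \<open>N\<close> the norm of the projection to
  \<open>M\<close> attains its maximum, and the value 1 would place the maximiser in
  \<open>M\<close>. Compactness is what finite dimension is for.\<close>

lemma Angle_less_1:
  assumes N: "closed_csubspace N" "finite_dimensional N" and M: "closed_csubspace M" and int: "N \<inter> M = {0}"
  obtains \<gamma> where "0 \<le> \<gamma>" "\<gamma> < 1" "Angle \<gamma> N M"
proof (cases "N = {0}")
  case True
  then have "Angle 0 N M" by (simp add: Angle_def)
  then show ?thesis using that[of 0] by simp
next
  case False
  define Q where "Q = N \<inter> sphere 0 1"
  have unit: "(1 / norm n) *\<^sub>R n \<in> Q" if "n \<in> N" "n \<noteq> 0" for n
    using that closed_csubspaceD(5)[OF N(1)]
    by (auto simp: Q_def scaleR_scaleC norm_scaleC_hilbert norm_divide)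
  have Q_eq: "Q = (N \<inter> cball 0 1) \<inter> {x. norm x = 1}" by (auto simp: Q_def)
  have "compact (N \<inter> cball 0 1)"
    by (rule compact_unit_ball_finite_dimensional[OF N(2) closed_csubspaceD(1)[OF N(1)]])
  then have "compact Q" unfolding Q_eq
    by (rule compact_Int_closed) (intro closed_Collect_eq continuous_intros)
  moreover have "Q \<noteq> {}" using False unit closed_csubspaceD(3)[OF N(1)] by blast
  moreover have "continuous_on Q (\<lambda>n. norm (proj M n))"
    by (intro continuous_on_norm linear_continuous_on bounded_linear_proj M)
  ultimately obtain n0 where n0: "n0 \<in> Q" "\<And>n. n \<in> Q \<Longrightarrow> norm (proj M n) \<le> norm (proj M n0)"
    using continuous_attains_sup by metis
  define \<gamma> where "\<gamma> = norm (proj M n0)"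
  have n01: "norm n0 = 1" "n0 \<in> N" using n0(1) by (auto simp: Q_def)
  have "\<gamma> \<noteq> 1"
  proof
    assume "\<gamma> = 1"
    then have "n0 = proj M n0" using norm_proj_square[OF M, of n0] n01 by (simp add: \<gamma>_def)
    then have "n0 \<in> N \<inter> M" using proj_in[OF M, of n0] n01 by simp
    then show False using int n01 by auto
  qed
  moreover have "\<gamma> \<le> 1" using norm_proj_le[OF M, of n0] n01 by (simp add: \<gamma>_def)
  moreover have "Angle \<gamma> N M"
    unfolding Angle_def
  proof (intro ballI)
    fix n m assume n: "n \<in> N" and m: "m \<in> M"
    have "norm (proj M n) \<le> \<gamma> * norm n"
    proof (cases "n = 0")
      case True
      then show ?thesis using norm_proj_le[OF M, of 0] by simp
    next
      case False
      have "proj M ((1 / norm n) *\<^sub>R n) = (1 / norm n) *\<^sub>R proj M n"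
        by (simp only: scaleR_scaleC proj_scaleC[OF M])
      then have "(1 / norm n) * norm (proj M n) \<le> \<gamma>"
        using n0(2)[OF unit[OF n False]] by (simp add: \<gamma>_def)
      then show ?thesis using False by (simp add: field_simps)
    qed
    then have "norm (proj M n) * norm m \<le> \<gamma> * norm n * norm m" by (intro mult_right_mono) auto
    then show "cmod (cinner n m) \<le> \<gamma> * norm n * norm m"
      using norm_cinner_le[of "proj M n" m] by (simp add: cinner_proj_left[OF M m])
  qed
  ultimately show ?thesis using that[of \<gamma>] by (simp add: \<gamma>_def)
qed

lemma coinv_Int_cyclic:
  assumes N: "coinv N" "finite_dimensional N" and W: "coinv W" "reach W = UNIV" and d: dense_range
    and int: "N \<inter> W = {0}"
  shows "N = {0}"
proof -
  obtain \<gamma> where \<gamma>: "0 \<le> \<gamma>" "\<gamma> < 1" "Angle \<gamma> N W"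
    using Angle_less_1[OF coinvD(1)[OF N(1)] N(2) coinvD(1)[OF W(1)] int] by blast
  have "n = 0" if n: "n \<in> N" for n
  proof -
    have "n \<in> closure (\<Union>w. Thetas w W)"
      using reach_le_closure[OF coinvD(1,4)[OF W(1)] coinv_le_Theta[OF W(1) d]] W(2) by blast
    then obtain X where X: "\<And>k. X k \<in> (\<Union>w. Thetas w W)" "X \<longlonglongrightarrow> n" unfolding closure_sequential by blast
    have "cmod (cinner n (X k)) \<le> \<gamma> * norm n * norm (X k)" for k
    proof -
      \<comment> \<open>The same word is applied to both spaces: \<open>n\<close> belongs to every
        \<open>Thetas w N\<close>, so the bound by \<gamma> holds against each approximant, whatever
        its word.\<close>
      obtain w where w: "X k \<in> Thetas w W" using X(1) by blast
      have "Angle \<gamma> (Thetas w N) (Thetas w W)"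
        by (rule Angle_Thetas[OF coinvD(1,4)[OF N(1)] coinvD(1,4)[OF W(1)] \<gamma>(1,3)])
      moreover have "n \<in> Thetas w N" using le_Thetas[OF coinv_le_Theta[OF N(1) d]] n by blast
      ultimately show ?thesis using w by (simp add: Angle_def)
    qed
    then have "cmod (cinner n n) \<le> \<gamma> * norm n * norm n"
      by (intro LIMSEQ_le[of "\<lambda>k. cmod (cinner n (X k))" _ "\<lambda>k. \<gamma> * norm n * norm (X k)"])
        (auto intro!: tendsto_intros tendsto_cinner X)
    moreover have "cmod (cinner n n) = (norm n)\<^sup>2" by (simp add: cinner_same norm_power)
    ultimately have "(1 - \<gamma>) * (norm n)\<^sup>2 \<le> 0" by (simp add: power2_eq_square algebra_simps)
    then show ?thesis using \<gamma>(2) by (simp add: mult_le_0_iff)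
  qed
  then show ?thesis using closed_csubspaceD(3)[OF coinvD(1)[OF N(1)]] by blast
qed

section \<open>Intersections of cyclic coinvariant subspaces\<close>

lemma coinv_iff_adjoint:
  "coinv W \<longleftrightarrow> closed_csubspace W \<and> (\<forall>i. \<forall>x\<in>C i. op_adjoint (S i x) ` W \<subseteq> W) \<and> (\<forall>a. op_adjoint (\<sigma> a) ` W \<subseteq> W)"
proof (cases "closed_csubspace W")
  case True
  have "(op_adjoint (S i x) ` W \<subseteq> W) = (\<forall>h\<in>orth_compl W. S i x h \<in> orth_compl W)" if "x \<in> C i" for i x
    using op_adjoint_invariant_iff[OF S_bounded[OF that] True] by (simp add: image_subset_iff)
  moreover have "(op_adjoint (\<sigma> a) ` W \<subseteq> W) = (\<forall>h\<in>orth_compl W. \<sigma> a h \<in> orth_compl W)" for a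
    using op_adjoint_invariant_iff[OF \<sigma>D(1) True] by (simp add: image_subset_iff)
  ultimately show ?thesis using True by (simp add: coinv_def invariant_def \<sigma>inv_def)
qed (simp add: coinv_def)

lemma coinv_Int: "coinv V \<Longrightarrow> coinv W \<Longrightarrow> coinv (V \<inter> W)"
  by (auto simp: coinv_iff_adjoint closed_csubspace_Int image_subset_iff)

text \<open>\<open>V\<close> is an auxiliary finite dimensional cyclic coinvariant subspace;
  \<open>W1\<close> and \<open>W2\<close> may be large. With
  \<open>L = reach (W1 \<inter> W2)\<close> and \<open>M\<close> its complement, both invariant, the
  projection \<open>N\<close> of \<open>V\<close> to \<open>M\<close> is finite dimensional and
  coinvariant. It meets \<open>W1 \<inter> W2\<close> trivially, since that intersection lies in
  \<open>L\<close>. So \<open>N\<close> vanishes, \<open>V\<close> lies in \<open>L\<close>, and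
  cyclicity of \<open>V\<close> gives the claim.\<close>

lemma cyclic_Int:
  assumes V: "coinv V" "reach V = UNIV" "finite_dimensional V"
    and W1: "coinv W1" "reach W1 = UNIV" and W2: "coinv W2" "reach W2 = UNIV" and d: dense_range
  shows "reach (W1 \<inter> W2) = UNIV"
proof -
  define L M where "L = reach (W1 \<inter> W2)" and "M = orth_compl L"
  note L = reach[of "W1 \<inter> W2", folded L_def]
  have Mi: "invariant M" unfolding M_def L_def by (rule invariant_orth_reach[OF coinv_Int[OF W1(1) W2(1)] d])
  have M: "closed_csubspace M" unfolding M_def by (rule closed_csubspace_orth_compl)
  have oM: "orth_compl M = L" unfolding M_def by (rule orth_compl_orth_compl[OF L(1)])
  define N where "N = closed_span (proj M ` V)"
  have NM: "N \<subseteq> M" unfolding N_def by (rule closed_span_minimal[OF _ M]) (use proj_in[OF M] in blast)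
  have Nfin: "finite_dimensional N"
  proof -
    obtain B where B: "finite B" "V \<subseteq> csubspace hull B" using V(3) by (auto simp: finite_dimensional_def)
    define H where "H = csubspace hull (proj M ` B)"
    have H: "csubspace H" unfolding H_def by (rule csubspace_hull)
    have "csubspace {v. proj M v \<in> H}"
      by (rule csubspaceI) (auto simp: proj_add[OF M] proj_scaleC[OF M] csubspaceD[OF H] proj_ident[OF M closed_csubspaceD(3)[OF M]])
    moreover have "B \<subseteq> {v. proj M v \<in> H}" unfolding H_def using hull_subset by fastforce
    ultimately have "csubspace hull B \<subseteq> {v. proj M v \<in> H}" by (intro hull_minimal)
    then have "proj M ` V \<subseteq> H" using B(2) by blast
    moreover have "closed_csubspace H"
      using H closed_finite_hull[of "proj M ` B"] B(1) by (simp add: closed_csubspace_def H_def)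
    ultimately have "N \<subseteq> H" unfolding N_def by (intro closed_span_minimal)
    then show ?thesis using B(1) by (auto simp: finite_dimensional_def H_def)
  qed
  \<comment> \<open>For \<open>y\<close> orthogonal to \<open>N\<close>, the component
    \<open>y1\<close> in \<open>M\<close> is orthogonal to all of \<open>V\<close>, so
    \<open>T y1\<close> is too. The component in \<open>L\<close> stays in \<open>L\<close>, which
    is orthogonal to \<open>N\<close>.\<close>
  have key: "T y \<in> orth_compl N"
    if T: "bounded_op UNIV T" "\<And>h. h \<in> M \<Longrightarrow> T h \<in> M" "\<And>h. h \<in> L \<Longrightarrow> T h \<in> L" "\<And>h. h \<in> orth_compl V \<Longrightarrow> T h \<in> orth_compl V"
      and y: "y \<in> orth_compl N" for T y
  proof -
    have "cinner (proj M v) (T y) = 0" if v: "v \<in> V" for v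
    proof -
      define y1 y2 where "y1 = proj M y" and "y2 = y - proj M y"
      have y12: "T y = T y1 + T y2" by (simp add: y1_def y2_def bounded_opD[OF T(1)])
      have y1: "y1 \<in> M" and y2: "y2 \<in> L" using proj_in[OF M] proj_orth[OF M] by (auto simp: y1_def y2_def oM)
      have "y1 \<in> orth_compl V"
      proof -
        have "cinner v' y1 = 0" if "v' \<in> V" for v'
        proof -
          have "cinner v' y1 = cinner (proj M v') y1" by (simp add: cinner_proj_left[OF M y1])
          also have "\<dots> = cinner (proj M v') y" by (simp add: y1_def cinner_proj_right[OF M proj_in[OF M]])
          also have "\<dots> = 0" using y that unfolding N_def orth_compl_closed_span by (simp add: orth_compl_def)
          finally show ?thesis .
        qed
        then show ?thesis by (simp add: orth_compl_def)
      qed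
      then have "cinner v (T y1) = 0" using orth_complD[OF T(4) v] by blast
      then have "cinner (proj M v) (T y1) = 0" by (simp add: cinner_proj_left[OF M T(2)[OF y1]])
      moreover have "cinner (proj M v) (T y2) = 0"
        using orth_complD[of "proj M v" L "T y2"] proj_in[OF M, of v] T(3)[OF y2] by (simp add: M_def)
      ultimately show ?thesis by (simp add: y12 cinner_add_right)
    qed
    then show ?thesis unfolding N_def orth_compl_closed_span by (auto simp: orth_compl_def)
  qed
  have N: "coinv N"
    unfolding coinv_def invariant_def \<sigma>inv_def
  proof (intro conjI allI ballI)
    show "closed_csubspace N" unfolding N_def by (rule closed_csubspace_closed_span)
    show "S i x h \<in> orth_compl N" if "x \<in> C i" "h \<in> orth_compl N" for i x h
      by (rule key[OF S_bounded[OF that(1)] _ _ _ that(2)])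
        (use that invariantD[OF Mi] invariantD[OF L(2)] coinvD[OF V(1)] in auto)
    show "\<sigma> a h \<in> orth_compl N" if "h \<in> orth_compl N" for a h
      by (rule key[OF \<sigma>D(1) _ _ _ that])
        (use invariantD[OF Mi] invariantD[OF L(2)] coinvD[OF V(1)] in auto)
  qed
  have "N \<inter> W1 \<inter> W2 = {0}"
  proof -
    have "n = 0" if "n \<in> N" "n \<in> W1" "n \<in> W2" for n
    proof (rule orth_compl_Int)
      show "n \<in> L" using L(3) that by blast
      show "n \<in> orth_compl L" using NM that by (auto simp: M_def)
    qed
    then show ?thesis
      using closed_csubspaceD(3)[OF coinvD(1)[OF N]] closed_csubspaceD(3)[OF coinvD(1)[OF W1(1)]]
        closed_csubspaceD(3)[OF coinvD(1)[OF W2(1)]] by blast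
  qed
  moreover have "finite_dimensional (N \<inter> W1)" using Nfin by (auto simp: finite_dimensional_def)
  \<comment> \<open>The intersection result is applied twice: \<open>N \<inter> W1\<close> meets the
    cyclic \<open>W2\<close> trivially and is therefore zero; then \<open>N\<close> meets the cyclic
    \<open>W1\<close> trivially.\<close>
  ultimately have "N \<inter> W1 = {0}" by (intro coinv_Int_cyclic[OF coinv_Int[OF N W1(1)] _ W2 d])
  then have "N = {0}" by (intro coinv_Int_cyclic[OF N Nfin W1 d])
  then have "proj M v = 0" if "v \<in> V" for v
    using that closed_span_superset[of "proj M ` V"] by (auto simp: N_def)
  then have "V \<subseteq> L" using proj_orth[OF M] by (metis diff_zero oM subsetI)
  then have "reach V \<subseteq> L" by (rule reach(4)[OF _ L(1,2)])
  then show ?thesis using V(2) by (simp add: L_def top.extremum_unique)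
qed

end

subsection \<open>The algebra generated by a representation\<close>

lemma wot_closure_superset:
  assumes "\<And>T. T \<in> X \<Longrightarrow> bounded_op UNIV T"
  shows "X \<subseteq> wot_closure X"
proof
  fix T assume T: "T \<in> X"
  have "\<exists>R\<in>X. \<forall>(x, y)\<in>P. cmod (cinner y (T x - R x)) < e" if "e > 0" for P e
    by (rule bexI[OF _ T]) (use that in auto)
  then show "T \<in> wot_closure X" by (simp add: wot_closure_def assms[OF T])
qed

text \<open>Vanishing of a matrix coefficient passes to WOT limits. Membership in a closed subspace
  is a family of such conditions, so it passes as well.\<close>

lemma wot_closure_orthogonal:
  assumes T: "T \<in> wot_closure X" and orth: "\<And>R. R \<in> X \<Longrightarrow> cinner y (R x) = 0"
  shows "cinner y (T x) = 0"
proof -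
  have "cmod (cinner y (T x)) < e" if e: "e > 0" for e
  proof -
    have "finite {(x, y)}" by simp
    then obtain R where "R \<in> X" "\<forall>(x, y)\<in>{(x, y)}. cmod (cinner y (T x - R x)) < e"
      using T e unfolding wot_closure_def by blast
    then show ?thesis using orth by (simp add: cinner_diff_right)
  qed
  then show ?thesis by (metis less_irrefl zero_less_norm_iff)
qed

context isometric_rep
begin

sublocale commuting_rep "\<lambda>i. carrier (gen E i)" "\<lambda>i. ip (gen E i)" "\<lambda>i. lact (gen E i)" "flip_lists" S \<sigma>
proof
  show "unital_representation UNIV \<sigma>" by (rule \<sigma>)
next
  fix i x assume x: "x \<in> carrier (gen E i)"
  show "bounded_op UNIV (S i x)" by (rule bounded_op_S[OF x])
  show "lact (gen E i) a x \<in> carrier (gen E i)" for a by (rule cstar_correspondenceD(2)[OF gen_correspondence x])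
  show "S i (lact (gen E i) a x) h = \<sigma> a (S i x h)" for a h by (rule irepD(3)[OF irep_S x])
  show "cinner (S i x h) (S i y g) = cinner h (\<sigma> (ip (gen E i) x y) g)" if "y \<in> carrier (gen E i)" for y h g
    by (rule irepD(2)[OF irep_S x that])
  show "set (flip_lists i j x y n) \<subseteq> carrier (gen E j) \<times> carrier (gen E i)" if "y \<in> carrier (gen E j)" for j y n
    by (rule flip_lists_closed[OF x that])
  show "(\<lambda>n. lsum (\<lambda>y' x'. S j y' (S i x' h)) (flip_lists i j x y n)) \<longlonglongrightarrow> S i x (S j y h)"
    if "y \<in> carrier (gen E j)" for j y h
    by (rule flip_lists_tendsto[OF x that])
qed

definition gens :: "('h \<Rightarrow> 'h) set"
  where "gens = {S i \<xi> |i \<xi>. \<xi> \<in> carrier (gen E i)} \<union> range \<sigma>"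

lemma S_gens: "\<xi> \<in> carrier (gen E i) \<Longrightarrow> S i \<xi> \<in> gens"
  unfolding gens_def by blast

lemma \<sigma>_gens: "\<sigma> a \<in> gens"
  by (simp add: gens_def)

lemma bounded_op_generated: "R \<in> generated_algebra gens \<Longrightarrow> bounded_op UNIV R"
proof (induction rule: generated_algebra.induct)
  case ident
  show ?case by (auto simp: bounded_op_def intro!: exI[of _ 1])
next
  case (incl T)
  then show ?case using bounded_op_S \<sigma>D(1) by (auto simp: gens_def)
next
  case (add R T)
  have "\<exists>K. \<forall>x. norm (R x + T x) \<le> K * norm x"
    using bounded_linear.bounded[OF bounded_linear_add[OF bounded_opD(5)[OF add.IH(1)] bounded_opD(5)[OF add.IH(2)]]]
    by (simp add: mult.commute)
  then show ?case by (auto simp: bounded_op_def bounded_opD[OF add.IH(1)] bounded_opD[OF add.IH(2)] scaleC_add_right)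
next
  case (scale T c)
  have "\<exists>K. \<forall>x. norm (c *\<^sub>C T x) \<le> K * norm x"
    using bounded_linear.bounded[OF bounded_linear_compose[OF bounded_linear_scaleC bounded_opD(5)[OF scale.IH]]]
    by (simp add: mult.commute)
  then show ?case by (auto simp: bounded_op_def bounded_opD[OF scale.IH] scaleC_add_right scaleC_scaleC mult.commute)
next
  case (comp R T)
  have "\<exists>K. \<forall>x. norm (R (T x)) \<le> K * norm x"
    using bounded_linear.bounded[OF bounded_linear_compose[OF bounded_opD(5)[OF comp.IH(1)] bounded_opD(5)[OF comp.IH(2)]]]
    by (simp add: mult.commute)
  then show ?case by (auto simp: bounded_op_def bounded_opD[OF comp.IH(1)] bounded_opD[OF comp.IH(2)])
qed

lemma invariant_generated:
  assumes L: "csubspace L" "invariant L"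
  shows "R \<in> generated_algebra gens \<Longrightarrow> h \<in> L \<Longrightarrow> R h \<in> L"
proof (induction arbitrary: h rule: generated_algebra.induct)
  case (incl T)
  then show ?case using invariantD[OF L(2)] by (auto simp: gens_def)
qed (auto simp: csubspaceD[OF L(1)])

text \<open>Replaces the WOT-closed algebra by its generators: coinvariance and the closed span of
  the orbit of \<open>W\<close> are both expressed by orthogonality relations, which neither
  generating the algebra nor closing it alters.\<close>

lemma cyclic_coinvariant_iff:
  "cyclic_coinvariant (wot_algebra E S \<sigma>) W \<longleftrightarrow> coinv W \<and> reach W = UNIV"
proof -
  define X where "X = generated_algebra gens"
  have wot: "wot_algebra E S \<sigma> = wot_closure X" by (simp add: wot_algebra_def X_def gens_def)
  have bX: "bounded_op UNIV T" if "T \<in> X" for T using that bounded_op_generated by (simp add: X_def)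
  have sup: "X \<subseteq> wot_closure X" by (rule wot_closure_superset[OF bX])
  have bw: "bounded_op UNIV T" if "T \<in> wot_closure X" for T using that by (simp add: wot_closure_def)
  have gX: "gens \<subseteq> X" by (auto simp: X_def intro: generated_algebra.incl)
  have coinv: "(\<forall>T\<in>wot_closure X. op_adjoint T ` W \<subseteq> W) \<longleftrightarrow> coinv W" if W: "closed_csubspace W"
  proof
    assume "\<forall>T\<in>wot_closure X. op_adjoint T ` W \<subseteq> W"
    then have *: "op_adjoint T ` W \<subseteq> W" if "T \<in> gens" for T using that gX sup by blast
    show "coinv W" unfolding coinv_iff_adjoint using W *[OF S_gens] *[OF \<sigma>_gens] by blast
  next
    assume W': "coinv W"
    show "\<forall>T\<in>wot_closure X. op_adjoint T ` W \<subseteq> W"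
    proof
      fix T assume T: "T \<in> wot_closure X"
      have "T x \<in> orth_compl W" if x: "x \<in> orth_compl W" for x
      proof -
        have "R x \<in> orth_compl W" if "R \<in> X" for R
          using invariant_generated[OF closed_csubspaceD(2)[OF closed_csubspace_orth_compl] _ _ x] that W'
          by (simp add: coinv_def X_def)
        then have "cinner v (T x) = 0" if "v \<in> W" for v
          using wot_closure_orthogonal[OF T] orth_complD that by blast
        then show ?thesis by (simp add: orth_compl_def)
      qed
      then show "op_adjoint T ` W \<subseteq> W" using op_adjoint_invariant_iff[OF bw[OF T] W] by blast
    qed
  qed
  have "closed_span {T w |T w. T \<in> wot_closure X \<and> w \<in> W} = reach W"
  proof
    have "T w \<in> reach W" if T: "T \<in> wot_closure X" and w: "w \<in> W" for T w
    proof -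
      have "R w \<in> reach W" if "R \<in> X" for R
        using invariant_generated[OF closed_csubspaceD(2)[OF reach(1)] reach(2)] that
          subsetD[OF reach(3) w] by (simp add: X_def)
      then have "cinner y (T w) = 0" if "y \<in> orth_compl (reach W)" for y
        using wot_closure_orthogonal[OF T] orth_complD[OF that] by blast
      then have "T w \<in> orth_compl (orth_compl (reach W))" by (simp add: orth_compl_def[of "orth_compl (reach W)"])
      then show ?thesis by (simp add: orth_compl_orth_compl[OF reach(1)])
    qed
    then show "closed_span {T w |T w. T \<in> wot_closure X \<and> w \<in> W} \<subseteq> reach W"
      by (intro closed_span_minimal[OF _ reach(1)]) blast
    define D where "D = closed_span {T w |T w. T \<in> X \<and> w \<in> W}"
    have D: "closed_csubspace D" unfolding D_def by (rule closed_csubspace_closed_span)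
    have Din: "T w \<in> D" if "T \<in> X" "w \<in> W" for T w
      unfolding D_def by (rule subsetD[OF closed_span_superset]) (use that in blast)
    have inv: "R h \<in> D" if R: "R \<in> gens" and h: "h \<in> D" for R h
    proof -
      have RX: "R \<in> X" using R gX by blast
      have "D \<subseteq> {h. R h \<in> D}"
        unfolding D_def
      proof (rule closed_span_minimal; fold D_def)
        show "closed_csubspace {h. R h \<in> D}" by (rule closed_csubspace_vimage[OF bX[OF RX] D])
        have "R (T w) \<in> D" if "T \<in> X" "w \<in> W" for T w
          using Din[of "R \<circ> T" w] that generated_algebra.comp[of R gens T] RX by (simp add: X_def)
        then show "{T w |T w. T \<in> X \<and> w \<in> W} \<subseteq> {h. R h \<in> D}" by blast
      qed
      then show ?thesis using h by blast
    qed
    have "W \<subseteq> D" using Din[of id] generated_algebra.ident[of gens] by (auto simp: X_def)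
    moreover have "invariant D"
      unfolding invariant_def \<sigma>inv_def using inv[OF S_gens] inv[OF \<sigma>_gens] by blast
    ultimately have "reach W \<subseteq> D" by (intro reach(4) D)
    also have "\<dots> \<subseteq> closed_span {T w |T w. T \<in> wot_closure X \<and> w \<in> W}"
      unfolding D_def by (rule closed_span_mono) (use sup in blast)
    finally show "reach W \<subseteq> closed_span {T w |T w. T \<in> wot_closure X \<and> w \<in> W}" .
  qed
  then show ?thesis
    unfolding cyclic_coinvariant_def wot using coinv coinvD(1) by auto
qed

text \<open>The subspace that is dilated need not be minimal; it supplies the finite dimensional
  \<open>V\<close> of \<open>cyclic_Int\<close>.\<close>

lemma finitely_correlated_coinv:
  assumes "finitely_correlated E UNIV S \<sigma>"
  obtains V where "coinv V" "reach V = UNIV" "finite_dimensional V"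
proof -
  obtain V A \<rho> where V: "finite_dimensional V" "representation E V A \<rho>" "dilates E UNIV S \<sigma> V A \<rho>"
    "minimal_dilation E UNIV S \<sigma> V" using assms by (auto simp: finitely_correlated_def)
  have Vc: "closed_csubspace V" using V(2) by (simp add: representation_def corr_representation_def)
  have "coinv V"
    using V(3) Vc by (auto simp: dilates_def corr_dilates_def coinv_def invariant_def \<sigma>inv_def image_subset_iff)
  moreover have "reach V = UNIV"
    by (rule minimal_dilation_cyclic[OF V(4) closed_csubspaceD(2)[OF Vc] reach(3) reach(1)])
      (use invariantD[OF reach(2)] in auto)
  ultimately show thesis using that V(1) by blast
qed

lemma dense_range: "fully_coisometric E UNIV S \<sigma> \<Longrightarrow> dense_range"
  unfolding dense_range_def fully_coisometric_def using fully_coisometric_dense[OF irep_S] by blast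

end

subsection \<open>Direct sums and extension of isometries\<close>

lemma lsum_Pair: "lsum (\<lambda>x y. (f x y, g x y)) u = (lsum f u, lsum g u)"
  by (induction u) (auto simp: zero_prod_def)

lemma bounded_op_prod:
  assumes "bounded_op UNIV A" "bounded_op UNIV B"
  shows "bounded_op UNIV (\<lambda>p. (A (fst p), B (snd p)))"
proof -
  have "bounded_linear (\<lambda>p. (A (fst p), B (snd p)))"
    by (intro bounded_linear_Pair bounded_linear_compose[OF bounded_opD(5)[OF assms(1)] bounded_linear_fst]
        bounded_linear_compose[OF bounded_opD(5)[OF assms(2)] bounded_linear_snd])
  from bounded_linear.bounded[OF this] have "\<exists>K. \<forall>p. norm (A (fst p), B (snd p)) \<le> K * norm p"
    by (simp add: mult.commute)
  then show ?thesis
    by (auto simp: bounded_op_def bounded_opD[OF assms(1)] bounded_opD[OF assms(2)] scaleC_prod_def)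
qed

lemma commuting_rep_prod:
  assumes "commuting_rep C ipA la fl S \<sigma>" "commuting_rep C ipA la fl T \<tau>"
  shows "commuting_rep C ipA la fl (\<lambda>i x p. (S i x (fst p), T i x (snd p))) (\<lambda>a p. (\<sigma> a (fst p), \<tau> a (snd p)))"
proof -
  interpret S: commuting_rep C ipA la fl S \<sigma> by fact
  interpret T: commuting_rep C ipA la fl T \<tau> by fact
  show ?thesis
  proof
    show "unital_representation UNIV (\<lambda>a p. (\<sigma> a (fst p), \<tau> a (snd p)))"
      unfolding unital_representation_def
      by (auto simp: bounded_op_prod S.\<sigma>D T.\<sigma>D scaleC_prod_def cinner_prod_def)
    show "(\<lambda>n. lsum (\<lambda>y' x'. (S j y' (fst (S i x' (fst h), T i x' (snd h))), T j y' (snd (S i x' (fst h), T i x' (snd h))))) (fl i j x y n))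
        \<longlonglongrightarrow> (S i x (fst (S j y (fst h), T j y (snd h))), T i x (snd (S j y (fst h), T j y (snd h))))"
      if "x \<in> C i" "y \<in> C j" for i j x y h
      using S.fl_tendsto[OF that, of "fst h"] T.fl_tendsto[OF that, of "snd h"]
      by (simp add: lsum_Pair tendsto_Pair)
  qed (auto simp: bounded_op_prod S.S_bounded T.S_bounded S.S_isometric T.S_isometric S.la_closed S.S_la T.S_la
      cinner_prod_def dest: S.fl_closed)
qed

text \<open>For a linear subspace this says that it is the graph of an isometry between its two
  coordinate images.\<close>

definition isometric_relation :: "('h::complex_hilbert \<times> 'g::complex_hilbert) set \<Rightarrow> bool"
  where "isometric_relation M \<longleftrightarrow> (\<forall>p\<in>M. \<forall>q\<in>M. cinner (fst p) (fst q) = cinner (snd p) (snd q))"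

text \<open>For fixed \<open>p\<close> the admissible \<open>q\<close> form the orthogonal
  complement of \<open>(fst p, - snd p)\<close>, hence a closed subspace. The extension is made in
  \<open>q\<close> first, then, after conjugation, in \<open>p\<close>.\<close>

lemma isometric_relation_closed_span:
  assumes "isometric_relation X"
  shows "isometric_relation (closed_span X)"
proof -
  have eq: "{q. cinner (fst p) (fst q) = cinner (snd p) (snd q)} = orth_compl {(fst p, - snd p)}"
    for p :: "'a \<times> 'b"
    by (auto simp: orth_compl_def cinner_prod_def cinner_minus_left)
  have 1: "cinner (fst p) (fst q) = cinner (snd p) (snd q)"
    if "X \<subseteq> {q. cinner (fst p) (fst q) = cinner (snd p) (snd q)}" "q \<in> closed_span X" for p q
  proof -
    have "closed_csubspace {q. cinner (fst p) (fst q) = cinner (snd p) (snd q)}"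
      unfolding eq by (rule closed_csubspace_orth_compl)
    then show ?thesis using closed_span_minimal[OF that(1)] that(2) by blast
  qed
  have 2: "cinner (fst p) (fst q) = cinner (snd p) (snd q)" if "p \<in> X" "q \<in> closed_span X" for p q
    using 1[of p q] assms that by (auto simp: isometric_relation_def)
  then have 3: "cinner (fst q) (fst p) = cinner (snd q) (snd p)" if "p \<in> X" "q \<in> closed_span X" for p q
    using that by (metis cinner_commute)
  then show ?thesis unfolding isometric_relation_def using 1 by blast
qed

lemma closed_csubspace_image:
  fixes f :: "'h::complex_hilbert \<Rightarrow> 'g::complex_hilbert"
  assumes L: "closed_csubspace L" and f: "bounded_linear f" "\<And>c x. f (c *\<^sub>C x) = c *\<^sub>C f x"
    and e: "e > 0" "\<And>x. x \<in> L \<Longrightarrow> e * norm x \<le> norm (f x)"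
  shows "closed_csubspace (f ` L)"
proof -
  have "subspace L" unfolding subspace_def using closed_csubspaceD[OF L] by (simp add: scaleR_scaleC)
  moreover have "complete L" using closed_csubspaceD(1)[OF L] by (simp add: complete_eq_closed)
  ultimately have "complete (f ` L)" using e by (intro complete_isometric_image[OF e(1) _ f(1)]) auto
  then have "closed (f ` L)" by (simp add: complete_eq_closed)
  moreover have "csubspace (f ` L)"
  proof (rule csubspaceI)
    show "0 \<in> f ` L"
      using closed_csubspaceD(3)[OF L] linear_0[OF bounded_linear.linear[OF f(1)]] by (metis imageI)
    show "x + y \<in> f ` L" if "x \<in> f ` L" "y \<in> f ` L" for x y
      using that closed_csubspaceD(4)[OF L] linear_add[OF bounded_linear.linear[OF f(1)]] by (metis (no_types, lifting) imageE imageI)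
    show "c *\<^sub>C x \<in> f ` L" if "x \<in> f ` L" for c x
      using that closed_csubspaceD(5)[OF L] f(2) by (metis (no_types, lifting) imageE imageI)
  qed
  ultimately show ?thesis by (simp add: closed_csubspace_def)
qed

section \<open>Two representations with common data and relations between them\<close>

locale commuting_rep_pair =
  S: commuting_rep C ipA la fl S \<sigma> + T: commuting_rep C ipA la fl T \<tau>
  for C :: "'k \<Rightarrow> 'e set" and ipA :: "'k \<Rightarrow> 'e \<Rightarrow> 'e \<Rightarrow> 'a::cstar_algebra" and la fl
    and S :: "'k \<Rightarrow> 'e \<Rightarrow> 'h::complex_hilbert \<Rightarrow> 'h" and \<sigma>
    and T :: "'k \<Rightarrow> 'e \<Rightarrow> 'g::complex_hilbert \<Rightarrow> 'g" and \<tau>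
begin

sublocale P: commuting_rep C ipA la fl "\<lambda>i x p. (S i x (fst p), T i x (snd p))" "\<lambda>a p. (\<sigma> a (fst p), \<tau> a (snd p))"
  by (rule commuting_rep_prod[OF S.commuting_rep_axioms T.commuting_rep_axioms])

text \<open>Inner products of \<open>S i x h\<close> and \<open>S i y g\<close> are governed by the
  action of the algebra element \<open>ipA i x y\<close>, which is the same in both components;
  invariance keeps the moved pair inside \<open>M\<close>.\<close>

lemma isometric_relation_Theta:
  assumes M: "isometric_relation M" "P.\<sigma>inv M"
  shows "isometric_relation (P.Theta i M)"
  unfolding P.Theta_def
proof (rule isometric_relation_closed_span)
  have "cinner (S i x (fst p)) (S i y (fst q)) = cinner (T i x (snd p)) (T i y (snd q))"
    if "x \<in> C i" "y \<in> C i" "p \<in> M" "q \<in> M" for x y p q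
  proof -
    have "(\<sigma> (ipA i x y) (fst q), \<tau> (ipA i x y) (snd q)) \<in> M" using M(2) that by (auto simp: P.\<sigma>inv_def)
    then show ?thesis using M(1) that by (force simp: isometric_relation_def S.S_isometric T.S_isometric)
  qed
  then show "isometric_relation {(S i x (fst h), T i x (snd h)) |x h. x \<in> C i \<and> h \<in> M}"
    by (auto simp: isometric_relation_def)
qed

text \<open>By directedness any two points of the union lie over one common word, where isometry is
  already known; it then passes to the closed span.\<close>

lemma isometric_relation_reach:
  assumes G: "isometric_relation G" "closed_csubspace G" "P.\<sigma>inv G" and le: "\<And>i. G \<subseteq> P.Theta i G"
  shows "isometric_relation (P.reach G)"
proof -
  have 1: "isometric_relation (P.Thetas w G)" for w
    by (induction w) (auto intro!: isometric_relation_Theta G P.Thetas_\<sigma>inv)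
  have "isometric_relation (\<Union>w. P.Thetas w G)"
    unfolding isometric_relation_def
  proof (intro ballI)
    fix p q assume "p \<in> (\<Union>w. P.Thetas w G)" "q \<in> (\<Union>w. P.Thetas w G)"
    then obtain w w' where "p \<in> P.Thetas w G" "q \<in> P.Thetas w' G" by blast
    then have "p \<in> P.Thetas (w @ w') G" "q \<in> P.Thetas (w @ w') G"
      using P.Thetas_directed[OF le] by blast+
    then show "cinner (fst p) (fst q) = cinner (snd p) (snd q)" using 1 unfolding isometric_relation_def by blast
  qed
  then have "isometric_relation (closed_span (\<Union>w. P.Thetas w G))" by (rule isometric_relation_closed_span)
  moreover have "P.reach G \<subseteq> closed_span (\<Union>w. P.Thetas w G)"
    by (rule order_trans[OF P.reach_le_closure[OF G(2,3) le]])
      (intro closure_minimal closed_span_superset closed_csubspaceD(1)[OF closed_csubspace_closed_span])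
  ultimately show ?thesis unfolding isometric_relation_def by blast
qed

text \<open>The graph \<open>G\<close> of \<open>U\<close> is not invariant, since \<open>U\<close>
  intertwines only compressions; the graph of \<open>Q\<close> is the closed invariant subspace
  generated by \<open>G\<close>. Isometry makes this subspace a graph in both directions, and
  cyclicity of \<open>V\<close> and \<open>W\<close> makes both coordinate projections
  surjective.\<close>

lemma extend_unitary:
  fixes U :: "'h \<Rightarrow> 'g"
  assumes V: "closed_csubspace V" "S.\<sigma>inv V" and W: "closed_csubspace W"
    and U: "U ` V = W" "\<And>x y. x \<in> V \<Longrightarrow> y \<in> V \<Longrightarrow> U (x + y) = U x + U y"
    "\<And>c x. x \<in> V \<Longrightarrow> U (c *\<^sub>C x) = c *\<^sub>C U x"
    "\<And>x y. x \<in> V \<Longrightarrow> y \<in> V \<Longrightarrow> cinner (U x) (U y) = cinner x y"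
    and US: "\<And>i \<xi> x. \<xi> \<in> C i \<Longrightarrow> x \<in> V \<Longrightarrow> U (proj V (S i \<xi> x)) = proj W (T i \<xi> (U x))"
    and U\<sigma>: "\<And>a x. x \<in> V \<Longrightarrow> U (\<sigma> a x) = \<tau> a (U x)"
    and le: "\<And>i. V \<subseteq> S.Theta i V" and cyclic: "S.reach V = UNIV" "T.reach W = UNIV"
  obtains Q where "bij Q" "\<And>x y. Q (x + y) = Q x + Q y" "\<And>c x. Q (c *\<^sub>C x) = c *\<^sub>C Q x"
    "\<And>x y. cinner (Q x) (Q y) = cinner x y"
    "\<And>i \<xi> x. \<xi> \<in> C i \<Longrightarrow> Q (S i \<xi> x) = T i \<xi> (Q x)" "\<And>a x. Q (\<sigma> a x) = \<tau> a (Q x)"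
proof -
  note Vd = closed_csubspaceD[OF V(1)]
  define G where "G = (\<lambda>v. (v, U v)) ` V"
  have GI: "v \<in> V \<Longrightarrow> (v, U v) \<in> G" for v by (simp add: G_def)
  have GE: "fst p \<in> V \<and> snd p = U (fst p)" if "p \<in> G" for p using that by (auto simp: G_def)
  have Udiff: "U (x - y) = U x - U y" if "x \<in> V" "y \<in> V" for x y
    using U(2)[of x "- y"] U(3)[of y "- 1"] that Vd by (simp add: scaleC_minus1_left)
  have Unorm: "norm (U x) = norm x" if "x \<in> V" for x
    using U(4)[OF that that] by (simp add: cinner_same flip: of_real_power)
  have G: "closed_csubspace G"
    unfolding closed_csubspace_def
  proof
    show "csubspace G"
    proof (rule csubspaceI)
      show "0 \<in> G" using GI[OF Vd(3)] U(2)[OF Vd(3) Vd(3)] by (simp add: zero_prod_def)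
      show "p + q \<in> G" if "p \<in> G" "q \<in> G" for p q
        using that by (auto simp: G_def simp flip: U(2) intro: Vd(4))
      show "c *\<^sub>C p \<in> G" if "p \<in> G" for c p
        using that by (auto simp: G_def scaleC_prod_def simp flip: U(3) intro: Vd(5))
    qed
    show "closed G"
      unfolding closed_sequential_limits
    proof (intro allI impI)
      fix X l assume X: "(\<forall>n. X n \<in> G) \<and> X \<longlonglongrightarrow> l"
      have 1: "(\<lambda>n. fst (X n)) \<longlonglongrightarrow> fst l" "(\<lambda>n. snd (X n)) \<longlonglongrightarrow> snd l"
        using X by (auto intro: tendsto_fst tendsto_snd)
      have XV: "fst (X n) \<in> V" "snd (X n) = U (fst (X n))" for n
        using GE[of "X n"] X by blast+
      have l: "fst l \<in> V" by (rule closed_csubspace_limit[OF V(1) 1(1) XV(1)])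
      have "(\<lambda>n. norm (fst (X n) - fst l)) \<longlonglongrightarrow> 0" using 1(1) by (simp add: tendsto_norm_zero LIM_zero)
      then have "(\<lambda>n. norm (U (fst (X n)) - U (fst l))) \<longlonglongrightarrow> 0"
        using Unorm[OF Vd(6)[OF XV(1) l]] Udiff[OF XV(1) l] by simp
      then have "(\<lambda>n. snd (X n)) \<longlonglongrightarrow> U (fst l)" by (simp add: XV tendsto_norm_zero_iff LIM_zero_iff)
      then have "snd l = U (fst l)" using 1(2) LIMSEQ_unique by blast
      then show "l \<in> G" using GI[OF l] by (metis prod.collapse)
    qed
  qed
  have \<sigma>V: "\<sigma> a v \<in> V" if "v \<in> V" for a v using V(2) that by (simp add: S.\<sigma>inv_def)
  have G\<sigma>: "P.\<sigma>inv G"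
    unfolding P.\<sigma>inv_def using GI[OF \<sigma>V] U\<sigma> by (auto simp: G_def)
  \<comment> \<open>Approximate \<open>v\<close> by sums of \<open>S i x h\<close> with
    \<open>h\<close> in \<open>V\<close>. The matching sums of \<open>T i x (U h)\<close>
    approximate \<open>U v\<close> equally well, because the inner products entering the two
    distances agree.\<close>
  have GTheta: "G \<subseteq> P.Theta i G" for i
  proof
    fix p assume "p \<in> G"
    then obtain v where v: "v \<in> V" "p = (v, U v)" by (auto simp: G_def)
    have "v \<in> closure (lsum (S i) ` {u. set u \<subseteq> C i \<times> V})"
      using le[of i] v(1) unfolding S.Theta_closure[OF Vd(2)] by blast
    then obtain X where X: "\<And>n. X n \<in> lsum (S i) ` {u. set u \<subseteq> C i \<times> V}" "X \<longlonglongrightarrow> v"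
      unfolding closure_sequential by blast
    have "\<forall>n. \<exists>w. set w \<subseteq> C i \<times> V \<and> X n = lsum (S i) w" using X(1) by blast
    from choice[OF this] obtain u where u: "\<And>n. set (u n) \<subseteq> C i \<times> V" "\<And>n. X n = lsum (S i) (u n)"
      by blast
    define Y where "Y n = lsum (\<lambda>x h. T i x (U h)) (u n)" for n
    \<comment> \<open>Tested against \<open>U v\<close>, which lies in \<open>W\<close>, only the
      compression of \<open>T i x (U h)\<close> to \<open>W\<close> is visible, and that is what the
      intertwining hypothesis controls.\<close>
    have 1: "cinner (U v) (lsum (\<lambda>x h. T i x (U h)) w) = cinner v (lsum (S i) w)" if "set w \<subseteq> C i \<times> V" for w
      using that
    proof (induction w)
      case (Cons q w)
      obtain x h where q: "q = (x, h)" by (cases q)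
      have xh: "x \<in> C i" "h \<in> V" using Cons.prems by (auto simp: q)
      have "cinner (U v) (T i x (U h)) = cinner (U v) (proj W (T i x (U h)))"
        using cinner_proj_right[OF W] U(1) v(1) by auto
      also have "\<dots> = cinner v (proj V (S i x h))"
        using US[OF xh] U(4)[OF v(1) proj_in[OF V(1)]] by metis
      also have "\<dots> = cinner v (S i x h)" by (rule cinner_proj_right[OF V(1) v(1)])
      finally show ?case using Cons by (simp add: q cinner_add_right)
    qed simp
    have 2: "cinner (T i x (U h)) (lsum (\<lambda>x h. T i x (U h)) w) = cinner (S i x h) (lsum (S i) w)"
      if "set w \<subseteq> C i \<times> V" "x \<in> C i" "h \<in> V" for w x h
      using that
    proof (induction w)
      case (Cons q w)
      obtain y k where q: "q = (y, k)" by (cases q)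
      have yk: "y \<in> C i" "k \<in> V" using Cons.prems by (auto simp: q)
      have "cinner (T i x (U h)) (T i y (U k)) = cinner (S i x h) (S i y k)"
        using yk Cons.prems by (simp add: S.S_isometric T.S_isometric U(4) \<sigma>V flip: U\<sigma>)
      then show ?case using Cons by (simp add: q cinner_add_right)
    qed simp
    have 3: "cinner (lsum (\<lambda>x h. T i x (U h)) w') (lsum (\<lambda>x h. T i x (U h)) w) = cinner (lsum (S i) w') (lsum (S i) w)"
      if "set w \<subseteq> C i \<times> V" "set w' \<subseteq> C i \<times> V" for w w'
      using that(2) by (induction w') (auto simp: cinner_add_left 2[OF that(1)])
    have "norm (U v - Y n) = norm (v - X n)" for n
    proof -
      have "(norm (U v - Y n))\<^sup>2 = (norm (v - X n))\<^sup>2"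
        unfolding norm_diff_square unfolding norm_square_eq
        by (simp add: Y_def u(2) 1[OF u(1)] 3[OF u(1) u(1)] U(4)[OF v(1) v(1)])
      then show ?thesis by (simp add: power2_eq_iff_nonneg)
    qed
    moreover have "(\<lambda>n. norm (v - X n)) \<longlonglongrightarrow> norm (v - v)" by (intro tendsto_intros X(2))
    ultimately have "(\<lambda>n. norm (Y n - U v)) \<longlonglongrightarrow> 0" by (simp add: norm_minus_commute)
    then have "Y \<longlonglongrightarrow> U v" by (simp add: tendsto_norm_zero_iff LIM_zero_iff)
    then have lim: "(\<lambda>n. (X n, Y n)) \<longlonglongrightarrow> p" unfolding v(2) by (intro tendsto_Pair X(2))
    show "p \<in> P.Theta i G"
    proof (rule closed_csubspace_limit[OF P.Theta_closed lim])
      fix n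
      have "(lsum (S i) w, lsum (\<lambda>x h. T i x (U h)) w) \<in> P.Theta i G" if "set w \<subseteq> C i \<times> V" for w
        using that
      proof (induction w)
        case Nil
        show ?case using closed_csubspaceD(3)[OF P.Theta_closed[of i G]] by (simp add: zero_prod_def)
      next
        case (Cons q w)
        obtain x h where q: "q = (x, h)" by (cases q)
        have "(S i x h, T i x (U h)) \<in> P.Theta i G" using P.Theta_in[of x i "(h, U h)" G] Cons.prems GI by (simp add: q)
        from closed_csubspaceD(4)[OF P.Theta_closed this, of "(lsum (S i) w, lsum (\<lambda>x h. T i x (U h)) w)"]
        show ?case using Cons by (simp add: q)
      qed
      then show "(X n, Y n) \<in> P.Theta i G" using u by (simp add: Y_def)
    qed
  qed
  define L where "L = P.reach G"
  note L = P.reach[of G, folded L_def]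
  have "isometric_relation G" using U(4) by (auto simp: isometric_relation_def G_def)
  then have iso: "cinner (fst p) (fst q) = cinner (snd p) (snd q)" if "p \<in> L" "q \<in> L" for p q
    using isometric_relation_reach[OF _ G G\<sigma> GTheta] that by (auto simp: L_def isometric_relation_def)
  have LS: "(S i x h, T i x g) \<in> L" if "x \<in> C i" "(h, g) \<in> L" for i x h g
    using P.invariantD(1)[OF L(2) that] by simp
  have L\<sigma>: "(\<sigma> a h, \<tau> a g) \<in> L" if "(h, g) \<in> L" for a h g
    using P.invariantD(2)[OF L(2) that] by simp
  have norm_L: "norm (fst p) = norm (snd p)" if "p \<in> L" for p
    using iso[OF that that] by (simp add: cinner_same flip: of_real_power)
  \<comment> \<open>On \<open>L\<close> both coordinates have equal norm, so each carries at least
    half of the norm of the pair. Thus both coordinate projections are bounded below on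
    \<open>L\<close> and have closed range.\<close>
  have norm_le: "1 / 2 * norm p \<le> norm (fst p)" "1 / 2 * norm p \<le> norm (snd p)" if "p \<in> L" for p
    using norm_Pair_le[of "fst p" "snd p"] norm_L[OF that] by auto
  have "fst ` L = UNIV"
  proof -
    have "closed_csubspace (fst ` L)"
      by (rule closed_csubspace_image[OF L(1) bounded_linear_fst, of "1/2"])
        (use norm_le in \<open>auto simp: scaleC_prod_def\<close>)
    moreover have "V \<subseteq> fst ` L" using L(3) by (force simp: G_def)
    moreover have "S.invariant (fst ` L)"
      unfolding S.invariant_def S.\<sigma>inv_def using LS L\<sigma> by force
    ultimately show ?thesis using S.reach(4) cyclic(1) by blast
  qed
  moreover have "snd ` L = UNIV"
  proof -
    have "closed_csubspace (snd ` L)"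
      by (rule closed_csubspace_image[OF L(1) bounded_linear_snd, of "1/2"])
        (use norm_le in \<open>auto simp: scaleC_prod_def\<close>)
    moreover have "W \<subseteq> snd ` L" using L(3) U(1) by (force simp: G_def)
    moreover have "T.invariant (snd ` L)"
      unfolding T.invariant_def T.\<sigma>inv_def using LS L\<sigma> by force
    ultimately show ?thesis using T.reach(4) cyclic(2) by blast
  qed
  ultimately have ex: "\<exists>g. (h, g) \<in> L" "\<exists>h. (h, g) \<in> L" for h g
    by (metis UNIV_I imageE prod.collapse)+
  have diff: "(h - h', g - g') \<in> L" if "(h, g) \<in> L" "(h', g') \<in> L" for h h' g g'
    using closed_csubspaceD(6)[OF L(1) that] by simp
  have uniq: "g = g'" if "(h, g) \<in> L" "(h, g') \<in> L" for h g g'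
    using norm_L[OF diff[OF that]] by simp
  have uniq': "h = h'" if "(h, g) \<in> L" "(h', g) \<in> L" for h h' g
    using norm_L[OF diff[OF that]] by simp
  define Q where "Q h = (SOME g. (h, g) \<in> L)" for h
  have Q: "(h, Q h) \<in> L" for h unfolding Q_def by (rule someI_ex[OF ex(1)])
  have QI: "Q h = g" if "(h, g) \<in> L" for h g by (rule uniq[OF Q that])
  show thesis
  proof
    show "bij Q"
    proof (rule bijI)
      show "inj Q" using Q uniq' by (metis injI)
      show "surj Q" using ex(2) QI by (metis surjI)
    qed
    show "Q (x + y) = Q x + Q y" for x y
      by (rule QI) (use closed_csubspaceD(4)[OF L(1) Q Q] in simp)
    show "Q (c *\<^sub>C x) = c *\<^sub>C Q x" for c x
      by (rule QI) (use closed_csubspaceD(5)[OF L(1) Q] in \<open>simp add: scaleC_prod_def\<close>)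
    show "cinner (Q x) (Q y) = cinner x y" for x y using iso[OF Q Q] by simp
    show "Q (S i \<xi> x) = T i \<xi> (Q x)" if "\<xi> \<in> C i" for i \<xi> x by (rule QI[OF LS[OF that Q]])
    show "Q (\<sigma> a x) = \<tau> a (Q x)" for a x by (rule QI[OF L\<sigma>[OF Q]])
  qed
qed

lemma transport_coinv:
  fixes U :: "'h \<Rightarrow> 'g"
  assumes U: "bij U" "\<And>x y. U (x + y) = U x + U y" "\<And>c x. U (c *\<^sub>C x) = c *\<^sub>C U x"
    "\<And>x y. cinner (U x) (U y) = cinner x y"
    "\<And>i \<xi> x. \<xi> \<in> C i \<Longrightarrow> U (S i \<xi> x) = T i \<xi> (U x)" "\<And>a x. U (\<sigma> a x) = \<tau> a (U x)"
    and W: "S.coinv W" "S.reach W = UNIV"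
  shows "T.coinv (U ` W)" "T.reach (U ` W) = UNIV"
proof -
  have norm: "norm (U x) = norm x" for x using U(4)[of x x] by (simp add: cinner_same flip: of_real_power)
  have bl: "bounded_linear U"
    by (rule bounded_linear_intro[of _ 1]) (auto simp: U(2,3) norm scaleR_scaleC)
  have img: "closed_csubspace (U ` L)" if "closed_csubspace L" for L
    by (rule closed_csubspace_image[OF that bl U(3), of 1]) (auto simp: norm)
  have inv: "T.invariant (U ` L)" if "S.invariant L" for L
    using S.invariantD[OF that] unfolding T.invariant_def T.\<sigma>inv_def
    by (auto simp flip: U(5,6))
  have orth: "orth_compl (U ` W) = U ` orth_compl W"
  proof (intro equalityI subsetI)
    fix y assume y: "y \<in> orth_compl (U ` W)"
    obtain x where x: "y = U x" using U(1) by (metis bij_pointE)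
    have "x \<in> orth_compl W" using y by (auto simp: orth_compl_def x U(4))
    then show "y \<in> U ` orth_compl W" using x by blast
  qed (auto simp: orth_compl_def U(4))
  show "T.coinv (U ` W)"
    using W(1) img inv unfolding T.coinv_def orth S.coinv_def by blast
  define L where "L = U -` T.reach (U ` W)"
  have TL: "U x \<in> T.reach (U ` W) \<longleftrightarrow> x \<in> L" for x by (simp add: L_def)
  have "closed L"
    unfolding L_def by (rule closed_vimage[OF closed_csubspaceD(1)[OF T.reach(1)] linear_continuous_on[OF bl]])
  then have "closed_csubspace L"
    using closed_csubspaceD[OF T.reach(1)[of "U ` W"]] U(3)[of 0 0]
    by (auto simp: closed_csubspace_def csubspace_def L_def U(2,3))
  moreover have "S.invariant L"
    using T.invariantD[OF T.reach(2)[of "U ` W"]] by (auto simp: S.invariant_def S.\<sigma>inv_def L_def U(5,6))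
  moreover have "W \<subseteq> L" using T.reach(3)[of "U ` W"] by (auto simp: L_def)
  ultimately have "L = UNIV" using S.reach(4)[of W L] W(2) by blast
  then show "T.reach (U ` W) = UNIV" using U(1) unfolding L_def by (metis UNIV_I UNIV_eq_I bij_pointE vimageD)
qed

end

theorem corollary3p21:
  fixes E :: "('a::cstar_algebra, 'e, 'k::{finite, linorder}) product_sys"
    and S :: "'k \<Rightarrow> 'e \<Rightarrow> 'h::complex_hilbert \<Rightarrow> 'h" and \<sigma> :: "'a \<Rightarrow> 'h \<Rightarrow> 'h"
    and T :: "'k \<Rightarrow> 'e \<Rightarrow> 'g::complex_hilbert \<Rightarrow> 'g" and \<tau> :: "'a \<Rightarrow> 'g \<Rightarrow> 'g"
    and V\<^sub>S :: "'h set" and V\<^sub>T :: "'g set"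
  assumes "product_system E"
    and "finitely_correlated E UNIV S \<sigma>" and "fully_coisometric E UNIV S \<sigma>"
    and "finitely_correlated E UNIV T \<tau>" and "fully_coisometric E UNIV T \<tau>"
    and "minimal_cyclic_coinvariant E S \<sigma> V\<^sub>S"
    and "minimal_cyclic_coinvariant E T \<tau> V\<^sub>T"
  shows "unitarily_equivalent E UNIV S \<sigma> UNIV T \<tau> \<longleftrightarrow>
    unitarily_equivalent E V\<^sub>S (compress V\<^sub>S S) \<sigma> V\<^sub>T (compress V\<^sub>T T) \<tau>"
proof -
  interpret S: isometric_rep E S \<sigma>
    using assms(1,2) by unfold_locales (auto simp: finitely_correlated_def)
  interpret T: isometric_rep E T \<tau>
    using assms(1,4) by unfold_locales (auto simp: finitely_correlated_def)
  interpret ST: commuting_rep_pair "\<lambda>i. carrier (gen E i)" "\<lambda>i. ip (gen E i)" "\<lambda>i. lact (gen E i)"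
    "isometric_rep.flip_lists E" S \<sigma> T \<tau>
    by (intro commuting_rep_pair.intro S.commuting_rep_axioms T.commuting_rep_axioms)
  interpret TS: commuting_rep_pair "\<lambda>i. carrier (gen E i)" "\<lambda>i. ip (gen E i)" "\<lambda>i. lact (gen E i)"
    "isometric_rep.flip_lists E" T \<tau> S \<sigma>
    by (intro commuting_rep_pair.intro S.commuting_rep_axioms T.commuting_rep_axioms)
  have VS: "S.coinv V\<^sub>S" "S.reach V\<^sub>S = UNIV"
    and minS: "S.coinv W \<Longrightarrow> S.reach W = UNIV \<Longrightarrow> W \<subseteq> V\<^sub>S \<Longrightarrow> W = V\<^sub>S" for W
    using assms(6) unfolding minimal_cyclic_coinvariant_def S.cyclic_coinvariant_iff by blast+
  have VT: "T.coinv V\<^sub>T" "T.reach V\<^sub>T = UNIV"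
    and minT: "T.coinv W \<Longrightarrow> T.reach W = UNIV \<Longrightarrow> W \<subseteq> V\<^sub>T \<Longrightarrow> W = V\<^sub>T" for W
    using assms(7) unfolding minimal_cyclic_coinvariant_def T.cyclic_coinvariant_iff by blast+
  note S_dense = S.dense_range[OF assms(3)] and T_dense = T.dense_range[OF assms(5)]
  \<comment> \<open>Minimality alone excludes proper subspaces of \<open>V\<^sub>S\<close>.
    Intersecting with an arbitrary cyclic coinvariant \<open>W\<close> upgrades it to being the
    smallest one.\<close>
  have leS: "V\<^sub>S \<subseteq> W" if W: "S.coinv W" "S.reach W = UNIV" for W
  proof -
    obtain V where V: "S.coinv V" "S.reach V = UNIV" "finite_dimensional V"
      using S.finitely_correlated_coinv[OF assms(2)] .
    have "V\<^sub>S \<inter> W = V\<^sub>S"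
      by (rule minS[OF S.coinv_Int[OF VS(1) W(1)] S.cyclic_Int[OF V VS W S_dense]]) blast
    then show ?thesis by blast
  qed
  have leT: "V\<^sub>T \<subseteq> W" if W: "T.coinv W" "T.reach W = UNIV" for W
  proof -
    obtain V where V: "T.coinv V" "T.reach V = UNIV" "finite_dimensional V"
      using T.finitely_correlated_coinv[OF assms(4)] .
    have "V\<^sub>T \<inter> W = V\<^sub>T"
      by (rule minT[OF T.coinv_Int[OF VT(1) W(1)] T.cyclic_Int[OF V VT W T_dense]]) blast
    then show ?thesis by blast
  qed
  show ?thesis
  proof
    assume "unitarily_equivalent E UNIV S \<sigma> UNIV T \<tau>"
    then obtain U where U: "bij U" "\<And>x y. U (x + y) = U x + U y" "\<And>c x. U (c *\<^sub>C x) = c *\<^sub>C U x"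
      "\<And>x y. cinner (U x) (U y) = cinner x y"
      "\<And>i \<xi> x. \<xi> \<in> carrier (gen E i) \<Longrightarrow> U (S i \<xi> x) = T i \<xi> (U x)" "\<And>a x. U (\<sigma> a x) = \<tau> a (U x)"
      by (auto simp: unitarily_equivalent_def)
    have Uinv: "U (inv U y) = y" for y using U(1) by (simp add: bij_is_surj surj_f_inv_f)
    have inj: "U x = U y \<Longrightarrow> x = y" for x y using U(1) by (simp add: bij_is_inj inj_eq)
    define R where "R = inv U"
    have R: "bij R" "\<And>x y. R (x + y) = R x + R y" "\<And>c x. R (c *\<^sub>C x) = c *\<^sub>C R x"
      "\<And>x y. cinner (R x) (R y) = cinner x y"
      "\<And>i \<xi> x. \<xi> \<in> carrier (gen E i) \<Longrightarrow> R (T i \<xi> x) = S i \<xi> (R x)" "\<And>a x. R (\<tau> a x) = \<sigma> a (R x)"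
      unfolding R_def using bij_imp_bij_inv[OF U(1)] 
      by (auto intro!: inj simp: U(2,3,5,6) Uinv simp flip: U(4))
    \<comment> \<open>A unitary equivalence carries cyclic coinvariant subspaces to such subspaces.
      So each minimal subspace lies in the image of the other, under \<open>U\<close> and under its
      inverse.\<close>
    have "V\<^sub>T \<subseteq> U ` V\<^sub>S" by (rule leT[OF ST.transport_coinv[OF U VS]])
    moreover have "V\<^sub>S \<subseteq> R ` V\<^sub>T" by (rule leS[OF TS.transport_coinv[OF R VT]])
    then have "U ` V\<^sub>S \<subseteq> V\<^sub>T" using Uinv by (auto simp: R_def)
    ultimately have UV: "U ` V\<^sub>S = V\<^sub>T" by blast
    note cS = S.coinvD(1)[OF VS(1)] and cT = T.coinvD(1)[OF VT(1)]
    \<comment> \<open>As \<open>U\<close> maps \<open>V\<^sub>S\<close> onto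
      \<open>V\<^sub>T\<close> and preserves orthogonality, it intertwines the projections;
      therefore its restriction intertwines the compressions.\<close>
    have proj: "U (proj V\<^sub>S x) = proj V\<^sub>T (U x)" for x
    proof (rule sym, rule proj_eqI[OF cT])
      show "U (proj V\<^sub>S x) \<in> V\<^sub>T" using proj_in[OF cS] UV by blast
      have "U x - U (proj V\<^sub>S x) = U (x - proj V\<^sub>S x)" using U(2)[of "x - proj V\<^sub>S x" "proj V\<^sub>S x"] by simp
      then show "U x - U (proj V\<^sub>S x) \<in> orth_compl V\<^sub>T"
        using proj_orth[OF cS, of x] by (auto simp: orth_compl_def U(4) simp flip: UV)
    qed
    have "bij_betw U V\<^sub>S V\<^sub>T" using UV inj by (auto simp: bij_betw_def inj_on_def)
    then show "unitarily_equivalent E V\<^sub>S (compress V\<^sub>S S) \<sigma> V\<^sub>T (compress V\<^sub>T T) \<tau>"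
      unfolding unitarily_equivalent_def compress_def
      by (intro exI[of _ U]) (simp add: U(2,3,4,6) proj U(5))
  next
    assume "unitarily_equivalent E V\<^sub>S (compress V\<^sub>S S) \<sigma> V\<^sub>T (compress V\<^sub>T T) \<tau>"
    then obtain U where U: "bij_betw U V\<^sub>S V\<^sub>T" "\<And>x y. x \<in> V\<^sub>S \<Longrightarrow> y \<in> V\<^sub>S \<Longrightarrow> U (x + y) = U x + U y"
      "\<And>c x. x \<in> V\<^sub>S \<Longrightarrow> U (c *\<^sub>C x) = c *\<^sub>C U x"
      "\<And>x y. x \<in> V\<^sub>S \<Longrightarrow> y \<in> V\<^sub>S \<Longrightarrow> cinner (U x) (U y) = cinner x y"
      "\<And>i \<xi> x. \<xi> \<in> carrier (gen E i) \<Longrightarrow> x \<in> V\<^sub>S \<Longrightarrow> U (proj V\<^sub>S (S i \<xi> x)) = proj V\<^sub>T (T i \<xi> (U x))"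
      "\<And>a x. x \<in> V\<^sub>S \<Longrightarrow> U (\<sigma> a x) = \<tau> a (U x)"
      by (auto simp: unitarily_equivalent_def compress_def)
    have img: "U ` V\<^sub>S = V\<^sub>T" using U(1) by (simp add: bij_betw_def)
    obtain Q where Q: "bij Q" "\<And>x y. Q (x + y) = Q x + Q y" "\<And>c x. Q (c *\<^sub>C x) = c *\<^sub>C Q x"
      "\<And>x y. cinner (Q x) (Q y) = cinner x y"
      "\<And>i \<xi> x. \<xi> \<in> carrier (gen E i) \<Longrightarrow> Q (S i \<xi> x) = T i \<xi> (Q x)" "\<And>a x. Q (\<sigma> a x) = \<tau> a (Q x)"
      by (rule ST.extend_unitary[OF S.coinvD(1,4)[OF VS(1)] T.coinvD(1)[OF VT(1)] img U(2-6)
          S.coinv_le_Theta[OF VS(1) S_dense] VS(2) VT(2)];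
          (assumption | rule that; assumption))
    then show "unitarily_equivalent E UNIV S \<sigma> UNIV T \<tau>"
      unfolding unitarily_equivalent_def by (intro exI[of _ Q]) (simp add: Q)
  qed
qed

end
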